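(* Let $k-1\ge a\ge 1$ be integers. For $n\ge0$ let $\overline{F}_{k,a}(n)$ be the number of lattice paths (as described in the context) with major index $n$ that satisfy the special $(k,a)$-conditions and such that every peak of relative height $k-1$, with weight $x$, satisfies $x\equiv W(x)+a-1 \pmod 2$. Let $\overline{D}_{k,a}(n)$ be the number of overpartitions $\lambda$ of $n$ such that (i) $f_1(\lambda)\le a-1$; (ii) $f_l(\lambda)+f_{\overline{l}}(\lambda)+f_{l+1}(\lambda)\le k-1$ for all $l\ge1$; and (iii) whenever $f_l(\lambda)+f_{\overline{l}}(\lambda)+f_{l+1}(\lambda)=k-1$, we have $lf_l(\lambda)+lf_{\overline{l}}(\lambda)+(l+1)f_{l+1}(\lambda)\equiv V_\lambda(l)+a-1\pmod 2$. Then $\overline{F}_{k,a}(n)=\overline{D}_{k,a}(n)$ for all $n$, and \[ \sum_{n\ge0}\overline{F}_{k,a}(n)q^n=\sum_{N_1\geq \cdots\geq N_{k-1}\geq0}\frac{q^{\frac{(N_1+1)N_1}{2}+N_2^2+\cdots+N_{k-1}^2+N_{a+1}+\cdots+N_{k-1}}(-q)_{N_1-1}(1+q^{N_a})}{(q)_{N_1-N_2}\cdots(q)_{N_{k-2}-N_{k-1}}(q^2;q^2)_{N_{k-1}}}=\frac{(-q)_\infty(q^a,q^{2k-1-a},q^{2k-1};q^{2k-1})_\infty}{(q)_\infty}. \]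
   Context: Notation: $(a;q)_n=\prod_{i=0}^{n-1}(1-aq^i)$, $(a)_n=(a;q)_n$, $(a;q)_\infty=\prod_{i\ge0}(1-aq^i)$, $(a_1,\dots,a_j;q)_\infty=\prod_i(a_i;q)_\infty$; for negative $n$, $(a;q)_n=(a;q)_\infty/(aq^n;q)_\infty$ (so $(-q)_{-1}=1/2$). Empty sums are $0$. An overpartition of $n$ is a non-increasing sequence of positive integers summing to $n$ where the first occurrence of each integer may be overlined. $f_l(\lambda)$ (resp. $f_{\overline l}(\lambda)$) is the number of non-overlined (resp. overlined) parts equal to $l$; $V_\lambda(l)$ is the number of overlined parts of $\lambda$ that are $\le l$. Lattice paths: paths in the first quadrant starting on the $y$-axis and ending on the $x$-axis, using unit steps NE $(x,y)\to(x+1,y+1)$, SE $(x,y)\to(x+1,y-1)$, N $(x,y-1)\to(x,y)$, and E $(x,0)\to(x+1,0)$ (E steps only at height $0$). Height = $y$-coordinate, weight = $x$-coordinate. A peak is a vertex preceded by an NE step (NESE peak) or an N step (NSE peak) and followed by an SE step. Paths are empty or end with an SE step; as stated in the paper, if the leftmost peak is an NSE peak, the path must start with an NE step, except when it starts at $(0,0)$ with an E step. Major index = sum of weights of peaks. Special $(k,a)$-conditions: the path starts at height $k-a$ and all heights are $<k$. The relative height of a peak $(x,y)$ is the largest integer $h$ for which there are two vertices $(x',y-h)$ and $(x'',y-h)$ of the path with $x'\le x<x''$ such that between these two vertices there is no peak of height $>y$ and every peak of height $y$ has abscissa $\ge x$. $W(x)$ denotes the number of NSE peaks of the path whose weight is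 $\le x$.
   Formalization: The path definition is corrected: if the leftmost peak is an NSE peak the path must start with an SE (not NE) step, and every N step must be followed by an SE step; as printed the identity fails (e.g. k=2, a=1, n=1 gives F=0, D=1). *)

theory Defs
  imports "HOL-Analysis.Analysis" "HOL-Number_Theory.Cong"
begin

section \<open>Lattice paths\<close>

datatype step = NE_step | SE_step | N_step | E_step

fun move :: "step \<Rightarrow> int \<times> int \<Rightarrow> int \<times> int" where
  "move NE_step (x, y) = (x + 1, y + 1)"
| "move SE_step (x, y) = (x + 1, y - 1)"
| "move N_step (x, y) = (x, y + 1)"
| "move E_step (x, y) = (x + 1, y)"

text \<open>A path is given by the height of its starting point on the y-axis and its list of steps;
  its vertices are numbered from 0 up to the number of steps, in the order of traversal.\<close>

type_synonym path = "int \<times> step list"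

definition vertex :: "path \<Rightarrow> nat \<Rightarrow> int \<times> int" where
  "vertex P i = fold move (take i (snd P)) (0, fst P)"

definition weight :: "path \<Rightarrow> nat \<Rightarrow> int" where
  "weight P i = fst (vertex P i)"

definition height :: "path \<Rightarrow> nat \<Rightarrow> int" where
  "height P i = snd (vertex P i)"

definition peak :: "path \<Rightarrow> nat \<Rightarrow> bool" where
  "peak P i \<longleftrightarrow> 0 < i \<and> i < length (snd P) \<and>
     snd P ! (i - 1) \<in> {NE_step, N_step} \<and> snd P ! i = SE_step"

definition nse_peak :: "path \<Rightarrow> nat \<Rightarrow> bool" where
  "nse_peak P i \<longleftrightarrow> peak P i \<and> snd P ! (i - 1) = N_step"

text \<open>Two conventions on N steps are part of the notion of path. First, as for the mirrored
  south steps of Corteel and Mallet, an N step is always followed by an SE step, so that each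
  N step produces an NSE peak. Second, if the leftmost peak is an NSE peak, then the path starts
  with an SE step, or else it starts at the origin (where no SE step is possible) with an E step.
  The printed form of the second condition, with NE in place of SE, is a slip: under it the
  only path of major index 1 for \<open>k = 2\<close>, \<open>a = 1\<close>, namely SE, N, SE from \<open>(0, 1)\<close>,
  would be excluded, while there is one overpartition (a single overlined 1) to match it.\<close>

definition lattice_path :: "path \<Rightarrow> bool" where
  "lattice_path P \<longleftrightarrow>
     (\<forall>i\<le>length (snd P). 0 \<le> weight P i \<and> 0 \<le> height P i) \<and>
     height P (length (snd P)) = 0 \<and>
     (\<forall>i<length (snd P). snd P ! i = E_step \<longrightarrow> height P i = 0) \<and>
     (\<forall>i. i + 1 < length (snd P) \<and> snd P ! i = N_step \<longrightarrow> snd P ! (i + 1) = SE_step) \<and>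
     (snd P = [] \<or> last (snd P) = SE_step) \<and>
     (\<forall>i. nse_peak P i \<and> (\<forall>j. peak P j \<longrightarrow> i \<le> j) \<longrightarrow>
        snd P ! 0 = SE_step \<or> (fst P = 0 \<and> snd P ! 0 = E_step))"

definition major_index :: "path \<Rightarrow> int" where
  "major_index P = (\<Sum>i | peak P i. weight P i)"

definition special_conditions :: "nat \<Rightarrow> nat \<Rightarrow> path \<Rightarrow> bool" where
  "special_conditions k a P \<longleftrightarrow>
     fst P = int k - int a \<and> (\<forall>i\<le>length (snd P). height P i < int k)"

text \<open>For a peak the maximum exists: \<open>h = 1\<close> is always admissible, and \<open>h\<close> cannot exceed the
  height of the peak.\<close>

definition relative_height :: "path \<Rightarrow> nat \<Rightarrow> int" where
  "relative_height P i = (GREATEST h.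
     \<exists>u\<le>length (snd P). \<exists>v\<le>length (snd P).
       height P u = height P i - h \<and> height P v = height P i - h \<and>
       weight P u \<le> weight P i \<and> weight P i < weight P v \<and>
       (\<forall>j. u \<le> j \<and> j \<le> v \<and> peak P j \<longrightarrow>
          height P j \<le> height P i \<and> (height P j = height P i \<longrightarrow> weight P i \<le> weight P j)))"

definition nse_count :: "path \<Rightarrow> int \<Rightarrow> nat" where
  "nse_count P x = card {i. nse_peak P i \<and> weight P i \<le> x}"

definition F_bar :: "nat \<Rightarrow> nat \<Rightarrow> nat \<Rightarrow> nat" where
  "F_bar k a n = card {P. lattice_path P \<and> special_conditions k a P \<and> major_index P = int n \<and>
     (\<forall>i. peak P i \<and> relative_height P i = int k - 1 \<longrightarrow>
        [weight P i = int (nse_count P (weight P i)) + int a - 1] (mod 2))}"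


section \<open>Overpartitions\<close>

text \<open>A part is a pair of its size and a flag telling whether it is overlined.\<close>

definition overpartition :: "nat \<Rightarrow> (nat \<times> bool) list \<Rightarrow> bool" where
  "overpartition n L \<longleftrightarrow>
     sorted_wrt (\<ge>) (map fst L) \<and> (\<forall>p\<in>set L. 0 < fst p) \<and> sum_list (map fst L) = n \<and>
     (\<forall>i<length L. snd (L ! i) \<longrightarrow> (\<forall>j<i. fst (L ! j) \<noteq> fst (L ! i)))"

definition f_plain :: "(nat \<times> bool) list \<Rightarrow> nat \<Rightarrow> nat" where
  "f_plain L l = count_list L (l, False)"

definition f_over :: "(nat \<times> bool) list \<Rightarrow> nat \<Rightarrow> nat" where
  "f_over L l = count_list L (l, True)"

definition V :: "(nat \<times> bool) list \<Rightarrow> nat \<Rightarrow> nat" where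
  "V L l = length (filter (\<lambda>p. snd p \<and> fst p \<le> l) L)"

definition D_bar :: "nat \<Rightarrow> nat \<Rightarrow> nat \<Rightarrow> nat" where
  "D_bar k a n = card {L. overpartition n L \<and>
     int (f_plain L 1) \<le> int a - 1 \<and>
     (\<forall>l\<ge>1. int (f_plain L l + f_over L l + f_plain L (l + 1)) \<le> int k - 1) \<and>
     (\<forall>l\<ge>1. int (f_plain L l + f_over L l + f_plain L (l + 1)) = int k - 1 \<longrightarrow>
        [int (l * f_plain L l + l * f_over L l + (l + 1) * f_plain L (l + 1))
          = int (V L l) + int a - 1] (mod 2))}"


section \<open>q-series as formal power series\<close>

text \<open>Infinite products and sums are taken with respect to the usual (X-adic) topology
  on formal power series.\<close>

definition qpoch_inf :: "real fps \<Rightarrow> real fps \<Rightarrow> real fps" where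
  "qpoch_inf a q = (\<Prod>i. 1 - a * q ^ i)"

text \<open>For negative \<open>n\<close> this is the convention
  \<open>(a;q)\<^sub>n = (a;q)\<^sub>\<infinity> / (a q\<^sup>n;q)\<^sub>\<infinity>\<close>, for use when \<open>a\<close> is divisible by \<open>q\<^sup>-\<^sup>n\<close> (division of
  power series is then exact); in particular \<open>(-X;X)\<^sub>-\<^sub>1 = 1/2\<close>.\<close>

definition qpoch :: "real fps \<Rightarrow> real fps \<Rightarrow> int \<Rightarrow> real fps" where
  "qpoch a q n = (if 0 \<le> n then (\<Prod>i<nat n. 1 - a * q ^ i)
     else qpoch_inf a q / qpoch_inf (a / q ^ nat (- n)) q)"

definition decreasing_tuples :: "nat \<Rightarrow> (nat \<Rightarrow> nat) set" where
  "decreasing_tuples m = {N \<in> {1..m} \<rightarrow>\<^sub>E UNIV. \<forall>i\<in>{1..<m}. N (i + 1) \<le> N i}"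

end

theory Submission
  imports Defs
begin

text \<open>
  All three expressions are shown to equal \<open>(-q)\<^sub>\<infinity>/(q)\<^sub>\<infinity>\<close> times the theta series
  \<open>\<Sum>\<^sub>r (-1)\<^sup>r q\<^bsup>(2k-1)r(r-1)/2+ar\<^esup>\<close>, which the Jacobi triple product turns into the infinite product.

  Paths: weight minus number of N steps plus height has the parity of \<open>k-a\<close> plus the number of E steps.
  Hence the condition on the peaks of relative height \<open>k-1\<close> says that the ceiling is \<open>k-1\<close> while the number
  of E steps is even and \<open>k-2\<close> while it is odd. Reflecting the second regime glues the two strips into one
  strip of heights from \<open>-(k-1)\<close> to \<open>k-1\<close>, where the generating function \<open>p\<^sub>h\<^sub>,\<^sub>n\<close> of the paths with \<open>n\<close> peaks
  from height \<open>h\<close> satisfies a linear recurrence. Its solution is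
  \<open>p\<^sub>h\<^sub>,\<^sub>n = q\<^bsup>n(n-1)/2\<^esup>(-q)\<^sub>n \<Sum>\<^sub>r (-1)\<^sup>r q\<^bsup>(k-1)r\<^sup>2+hr\<^esup>/((q)\<^bsub>n-r\<^esub>(q)\<^bsub>n+r\<^esub>)\<close>.
  Iterating the Bailey lemma produces the same sum over \<open>r\<close> from the terms of the multisum with \<open>N\<^sub>1 = n\<close>, and
  the sum over \<open>n\<close> is a limiting case of the q-Gauss sum.

  Overpartitions: removing the parts equal to 1 gives a q-difference system for the generating functions
  in which a variable \<open>x\<close> counts the parts; specializing \<open>x = q\<^sup>m\<close> (all parts exceed \<open>m\<close>) keeps the argument
  within power series in one variable. The system is solved by an explicit alternating series.
\<close>

section \<open>Power series modulo powers of the variable\<close>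

text \<open>Identities between infinite objects are proved modulo \<open>X^L\<close> for every L,
  with L both the precision and the cut-off of sums and products; they meet in
  \<open>plus_qfac L * inv_qfac fps_X (int L) * theta (2 * k - 1) a L\<close>. Both combinatorial
  systems are settled by exhibiting a solution and proving uniqueness. For paths with n > 0 peaks
  each reference to the same n carries a factor \<open>X^n\<close>, so agreement modulo
  \<open>X^N\<close> improves to \<open>X^(N+1)\<close>. For overpartitions, level m refers to level
  m+1 and to smaller i, and at m = L all is known modulo \<open>X^L\<close>. The obstacle for paths
  is that relative height depends on the whole path. The way out is to look at the first vertex of
  height k-1 after the last visit to height 0. The condition on the leftmost peak turns
  \<open>(-q)_n\<close> into \<open>(-q)_(n-1)\<close> and one Bailey sum into the pair with h =
  k-a-1 and h = k-a; in the multisum the same pair comes from \<open>1 + q^(N_a)\<close>. In the sum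
  over n this pair supplies a factor \<open>1 + q^|r|\<close>, after which q-Gauss gives
  \<open>(-q)_inf/(q)_inf\<close> times \<open>q^(|r|(|r|+1)/2)\<close>.\<close>

definition eq_upto :: "nat \<Rightarrow> real fps \<Rightarrow> real fps \<Rightarrow> bool" where
  "eq_upto N f g \<longleftrightarrow> (\<forall>i<N. fps_nth f i = fps_nth g i)"

lemma eq_upto_refl [simp]: "eq_upto N f f"
  by (simp add: eq_upto_def)

lemma eq_upto_sym: "eq_upto N f g \<Longrightarrow> eq_upto N g f"
  by (simp add: eq_upto_def)

lemma eq_upto_trans [trans]: "eq_upto N f g \<Longrightarrow> eq_upto N g h \<Longrightarrow> eq_upto N f h"
  by (simp add: eq_upto_def)

lemma eq_upto_mono: "eq_upto N f g \<Longrightarrow> L \<le> N \<Longrightarrow> eq_upto L f g"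
  by (simp add: eq_upto_def)

lemma eq_upto_add: "eq_upto N f g \<Longrightarrow> eq_upto N f' g' \<Longrightarrow> eq_upto N (f + f') (g + g')"
  by (simp add: eq_upto_def)

lemma eq_upto_diff: "eq_upto N f g \<Longrightarrow> eq_upto N f' g' \<Longrightarrow> eq_upto N (f - f') (g - g')"
  by (simp add: eq_upto_def)

lemma eq_upto_mult: "eq_upto N f g \<Longrightarrow> eq_upto N f' g' \<Longrightarrow> eq_upto N (f * f') (g * g')"
  by (auto simp: eq_upto_def fps_mult_nth intro!: sum.cong)

lemma eq_upto_sum: "(\<And>i. i \<in> A \<Longrightarrow> eq_upto N (f i) (g i)) \<Longrightarrow> eq_upto N (sum f A) (sum g A)"
  by (induction A rule: infinite_finite_induct) (auto intro: eq_upto_add)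

lemma eq_upto_X_power: "N \<le> m \<Longrightarrow> eq_upto N (fps_X ^ m * f) 0"
  by (simp add: eq_upto_def fps_X_power_mult_nth)

text \<open>A power of the variable buys precision. This gain drives the uniqueness argument for the
  path series and repays the loss caused by shifting a summation index.\<close>

lemma eq_upto_X_power_shift:
  assumes "eq_upto (N - s) f g" "s \<le> m"
  shows "eq_upto N (fps_X ^ m * f) (fps_X ^ m * g)"
  using assms by (auto simp: eq_upto_def fps_X_power_mult_nth)

lemma eq_upto_all_imp_eq: "(\<And>N. eq_upto N f g) \<Longrightarrow> f = g"
  unfolding fps_eq_iff eq_upto_def by blast

lemma eq_upto_cancel_unit:
  assumes "eq_upto N (u * f) (u * g)" "fps_nth u 0 \<noteq> 0"
  shows "eq_upto N f g"
proof -
  have "inverse u * u = 1" using assms(2) by (rule inverse_mult_eq_1)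
  then have *: "inverse u * (u * f) = f" for f by (simp flip: mult.assoc)
  show ?thesis using eq_upto_mult[OF eq_upto_refl[of N "inverse u"] assms(1)] by (simp only: *)
qed

lemma nth_0_one_nonzero: "fps_nth f 0 = 1 \<Longrightarrow> f \<noteq> (0 :: real fps)"
  by auto

lemma nth_0_prod_one: "(\<And>i. i \<in> A \<Longrightarrow> fps_nth (f i) 0 = 1) \<Longrightarrow> fps_nth (prod f A) 0 = (1::real)"
  by (induction A rule: infinite_finite_induct) auto

definition tri :: "nat \<Rightarrow> nat" where "tri n = n * (n + 1) div 2"

lemma two_tri: "2 * tri n = n * (n + 1)"
  unfolding tri_def by simp

lemma tri_0 [simp]: "tri 0 = 0"
  by (simp add: tri_def)

lemma tri_Suc: "tri (Suc n) = tri n + Suc n"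
  using two_tri[of n] two_tri[of "Suc n"] by simp

lemma tri_add: "tri (s + m) = tri s + tri m + s * m"
  using two_tri[of s] two_tri[of m] two_tri[of "s + m"] by (simp add: algebra_simps)

lemma le_tri: "n \<le> tri n"
  by (induction n) (simp_all add: tri_Suc)

section \<open>q-factorials, the q-Vandermonde sum and the Bailey lemma\<close>

definition qfac :: "real fps \<Rightarrow> nat \<Rightarrow> real fps" where
  "qfac Q n = (\<Prod>i<n. 1 - Q ^ Suc i)"

text \<open>Setting \<open>1/(q)\<^sub>j = 0\<close> for \<open>j < 0\<close> lets sums over \<open>r\<close> run over any range containing \<open>-n, \<dots>, n\<close>.\<close>

definition inv_qfac :: "real fps \<Rightarrow> int \<Rightarrow> real fps" where
  "inv_qfac Q j = (if j < 0 then 0 else inverse (qfac Q (nat j)))"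

text \<open>The matrix of Bailey pairs relative to 1. Letting r take both signs gives sums over all
  integers, on which the reflections r -> -r and r -> -1-r can act.\<close>

definition bailey_kernel :: "real fps \<Rightarrow> nat \<Rightarrow> int \<Rightarrow> real fps" where
  "bailey_kernel Q n r = inv_qfac Q (int n - r) * inv_qfac Q (int n + r)"

lemma bailey_kernel_minus: "bailey_kernel Q n (- r) = bailey_kernel Q n r"
  by (simp add: bailey_kernel_def mult.commute)

lemma bailey_kernel_eq_0: "int n < \<bar>r\<bar> \<Longrightarrow> bailey_kernel Q n r = 0"
  by (auto simp: bailey_kernel_def inv_qfac_def)

lemma qfac_0 [simp]: "qfac Q 0 = 1"
  by (simp add: qfac_def)

lemma inv_qfac_0 [simp]: "inv_qfac Q 0 = 1"
  by (simp add: inv_qfac_def)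

lemma inv_qfac_neg [simp]: "j < 0 \<Longrightarrow> inv_qfac Q j = 0"
  by (simp add: inv_qfac_def)

context
  fixes Q :: "real fps"
  assumes Q0: "fps_nth Q 0 = 0"
begin

lemma qfac_nth_0: "fps_nth (qfac Q n) 0 = 1"
  unfolding qfac_def by (rule nth_0_prod_one) (simp add: Q0)

lemma inv_qfac_mult_qfac: "inv_qfac Q (int n) * qfac Q n = 1"
  by (simp add: inv_qfac_def inverse_mult_eq_1 qfac_nth_0)

lemma inv_qfac_Suc: "(1 - Q ^ Suc n) * inv_qfac Q (int (Suc n)) = inv_qfac Q (int n)"
proof -
  have "(1 - Q ^ Suc n) * inv_qfac Q (int (Suc n)) = (inv_qfac Q (int n) * qfac Q n) * ((1 - Q ^ Suc n) * inv_qfac Q (int (Suc n)))"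
    by (simp only: inv_qfac_mult_qfac mult_1)
  also have "\<dots> = inv_qfac Q (int n) * (inv_qfac Q (int (Suc n)) * qfac Q (Suc n))"
    by (simp add: qfac_def)
  finally show ?thesis by (simp only: inv_qfac_mult_qfac mult_1_right)
qed

text \<open>At j = 0 the factor \<open>1 - Q^0\<close> vanishes, and below 0 the convention makes
  both sides 0; so denominators may be lowered inside a sum without regard to the ends of its
  range.\<close>

lemma inv_qfac_pred: "(1 - Q ^ nat j) * inv_qfac Q j = inv_qfac Q (j - 1)"
proof (cases "j \<le> 0")
  case True
  then show ?thesis by (cases "j = 0") auto
next
  case False
  then obtain n where "j = int (Suc n)" by (metis not_le zero_less_imp_eq_int gr0_implies_Suc of_nat_0_less_iff)
  moreover from this have "nat j = Suc n" "j - 1 = int n" by auto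
  ultimately show ?thesis using inv_qfac_Suc[of n] by (simp only:)
qed

lemma bailey_kernel_step: "(1 - Q ^ nat (int n - r)) * (1 - Q ^ nat (int n + r)) * bailey_kernel Q n r = inv_qfac Q (int n - 1 - r) * inv_qfac Q (int n - 1 + r)"
proof -
  have "(1 - Q ^ nat (int n - r)) * (1 - Q ^ nat (int n + r)) * bailey_kernel Q n r
    = ((1 - Q ^ nat (int n - r)) * inv_qfac Q (int n - r)) * ((1 - Q ^ nat (int n + r)) * inv_qfac Q (int n + r))"
    by (simp add: bailey_kernel_def)
  also have "\<dots> = inv_qfac Q (int n - r - 1) * inv_qfac Q (int n + r - 1)" by (simp only: inv_qfac_pred)
  finally show ?thesis by (simp add: algebra_simps)
qed

text \<open>q-Chu-Vandermonde with one parameter sent to infinity. The induction on N, with M free,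
  splits \<open>1 - Q^(N+1) = (1 - Q^(N+1-j)) + Q^(N+1-j) (1 - Q^j)\<close>: the first part lowers
  N, the second shifts j and raises M.\<close>

lemma q_vandermonde:
  "(\<Sum>j\<le>N. Q ^ (j\<^sup>2 + j * M) * inv_qfac Q (int N - int j) * inv_qfac Q (int j) * inv_qfac Q (int (M + j)))
     = inv_qfac Q (int N) * inv_qfac Q (int (N + M))"
proof (induction N arbitrary: M)
  case 0
  then show ?case by simp
next
  case (Suc N)
  let ?f = "\<lambda>N M j. Q ^ (j\<^sup>2 + j * M) * inv_qfac Q (int N - int j) * inv_qfac Q (int j) * inv_qfac Q (int (M + j))"
  have term1: "(1 - Q ^ nat (int (Suc N) - int j)) * ?f (Suc N) M j = ?f N M j" for j
  proof -
    have "(1 - Q ^ nat (int (Suc N) - int j)) * inv_qfac Q (int (Suc N) - int j) = inv_qfac Q (int N - int j)"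
      using inv_qfac_pred[of "int (Suc N) - int j"] by (simp add: algebra_simps del: inv_qfac_neg)
    then have "(1 - Q ^ nat (int (Suc N) - int j)) * inv_qfac Q (int (Suc N) - int j) * (Q ^ (j\<^sup>2 + j * M) * inv_qfac Q (int j) * inv_qfac Q (int (M + j)))
       = inv_qfac Q (int N - int j) * (Q ^ (j\<^sup>2 + j * M) * inv_qfac Q (int j) * inv_qfac Q (int (M + j)))" by (simp only:)
    then show ?thesis by (simp only: mult_ac)
  qed
  have term2: "Q ^ (Suc N - Suc j) * (1 - Q ^ Suc j) * ?f (Suc N) M (Suc j) = Q ^ (Suc N + M) * ?f N (Suc M) j" if "j \<le> N" for j
  proof -
    have e: "N - j + ((Suc j)\<^sup>2 + Suc j * M) = Suc N + M + (j\<^sup>2 + j * Suc M)"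
      using that by (simp add: power2_eq_square algebra_simps)
    have "Q ^ (Suc N - Suc j) * (1 - Q ^ Suc j) * ?f (Suc N) M (Suc j)
       = Q ^ (N - j + ((Suc j)\<^sup>2 + Suc j * M)) * inv_qfac Q (int N - int j) * ((1 - Q ^ Suc j) * inv_qfac Q (int (Suc j))) * inv_qfac Q (int (M + Suc j))"
      by (simp add: power_add mult_ac)
    also have "\<dots> = Q ^ (Suc N + M + (j\<^sup>2 + j * Suc M)) * inv_qfac Q (int N - int j) * inv_qfac Q (int j) * inv_qfac Q (int (Suc M + j))"
      by (simp only: e inv_qfac_Suc) simp
    finally show ?thesis by (simp only: power_add mult.assoc)
  qed
  have "(1 - Q ^ Suc N) * (\<Sum>j\<le>Suc N. ?f (Suc N) M j)
      = (\<Sum>j\<le>Suc N. (1 - Q ^ nat (int (Suc N) - int j)) * ?f (Suc N) M j + Q ^ (Suc N - j) * (1 - Q ^ j) * ?f (Suc N) M j)"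
    unfolding sum_distrib_left
  proof (rule sum.cong[OF refl])
    fix j assume "j \<in> {..Suc N}"
    then have "nat (int (Suc N) - int j) = Suc N - j" "Q ^ Suc N = Q ^ (Suc N - j) * Q ^ j"
      by (auto simp flip: power_add)
    then show "(1 - Q ^ Suc N) * ?f (Suc N) M j = (1 - Q ^ nat (int (Suc N) - int j)) * ?f (Suc N) M j + Q ^ (Suc N - j) * (1 - Q ^ j) * ?f (Suc N) M j"
      by (simp only: flip: distrib_right) (simp add: algebra_simps)
  qed
  also have "\<dots> = (\<Sum>j\<le>Suc N. ?f N M j) + (\<Sum>j\<le>Suc N. Q ^ (Suc N - j) * (1 - Q ^ j) * ?f (Suc N) M j)"
    by (simp only: term1 sum.distrib)
  also have "(\<Sum>j\<le>Suc N. ?f N M j) = (\<Sum>j\<le>N. ?f N M j)"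
    by simp
  also have "(\<Sum>j\<le>Suc N. Q ^ (Suc N - j) * (1 - Q ^ j) * ?f (Suc N) M j)
     = (\<Sum>j\<le>N. Q ^ (Suc N - Suc j) * (1 - Q ^ Suc j) * ?f (Suc N) M (Suc j))"
    by (subst sum.atMost_Suc_shift) simp
  also have "\<dots> = (\<Sum>j\<le>N. Q ^ (Suc N + M) * ?f N (Suc M) j)"
    by (rule sum.cong[OF refl], rule term2) simp
  also have "\<dots> = Q ^ (Suc N + M) * (inv_qfac Q (int N) * inv_qfac Q (int (N + Suc M)))"
    by (simp only: sum_distrib_left[symmetric] Suc.IH)
  also have "(\<Sum>j\<le>N. ?f N M j) = inv_qfac Q (int N) * inv_qfac Q (int (N + M))"
    by (rule Suc.IH)
  also have "inv_qfac Q (int (N + M)) = (1 - Q ^ Suc (N + M)) * inv_qfac Q (int (Suc (N + M)))"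
    by (simp only: inv_qfac_Suc)
  also have "inv_qfac Q (int N) * ((1 - Q ^ Suc (N + M)) * inv_qfac Q (int (Suc (N + M)))) + Q ^ (Suc N + M) * (inv_qfac Q (int N) * inv_qfac Q (int (N + Suc M)))
    = inv_qfac Q (int N) * inv_qfac Q (int (Suc N + M))"
    by (simp add: algebra_simps)
  also have "\<dots> = (1 - Q ^ Suc N) * (inv_qfac Q (int (Suc N)) * inv_qfac Q (int (Suc N + M)))"
    by (simp only: inv_qfac_Suc[of N, symmetric] mult.assoc)
  finally have eq: "(1 - Q ^ Suc N) * (\<Sum>j\<le>Suc N. ?f (Suc N) M j) = (1 - Q ^ Suc N) * (inv_qfac Q (int (Suc N)) * inv_qfac Q (int (Suc N + M)))" .
  have "1 - Q ^ Suc N \<noteq> 0" by (rule nth_0_one_nonzero) (simp add: Q0)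
  then show ?case using eq unfolding mult_cancel_left by blast
qed

text \<open>Putting m = j + r turns the sum into \<open>q_vandermonde\<close> with N = n - r and M =
  2r.\<close>

lemma bailey_step_nonneg:
  "(\<Sum>m\<le>n. Q ^ (m\<^sup>2) * bailey_kernel Q m (int r) * inv_qfac Q (int n - int m)) = Q ^ (r\<^sup>2) * bailey_kernel Q n (int r)"
proof (cases "r \<le> n")
  case False
  then have "bailey_kernel Q m (int r) = 0" if "m \<le> n" for m using that by (intro bailey_kernel_eq_0) auto
  then show ?thesis using False by (simp add: bailey_kernel_eq_0)
next
  case True
  have "(\<Sum>m\<le>n. Q ^ (m\<^sup>2) * bailey_kernel Q m (int r) * inv_qfac Q (int n - int m))
      = (\<Sum>m=r..n. Q ^ (m\<^sup>2) * bailey_kernel Q m (int r) * inv_qfac Q (int n - int m))"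
    by (intro sum.mono_neutral_right) (auto simp: bailey_kernel_eq_0)
  also have "\<dots> = (\<Sum>j\<le>n - r. Q ^ ((j + r)\<^sup>2) * bailey_kernel Q (j + r) (int r) * inv_qfac Q (int n - int (j + r)))"
    using True sum.shift_bounds_cl_nat_ivl[of _ 0 r "n - r"] by (simp add: atMost_atLeast0 del: of_nat_add)
  also have "\<dots> = (\<Sum>j\<le>n - r. Q ^ (r\<^sup>2) * (Q ^ (j\<^sup>2 + j * (2 * r)) * inv_qfac Q (int (n - r) - int j) * inv_qfac Q (int j) * inv_qfac Q (int (2 * r + j))))"
  proof (rule sum.cong[OF refl])
    fix j assume "j \<in> {..n - r}"
    have e1: "(j + r)\<^sup>2 = r\<^sup>2 + (j\<^sup>2 + j * (2 * r))" by (simp add: power2_eq_square algebra_simps)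
    have e2: "int n - int (j + r) = int (n - r) - int j" using True by simp
    have e3: "bailey_kernel Q (j + r) (int r) = inv_qfac Q (int j) * inv_qfac Q (int (2 * r + j))"
      by (simp add: bailey_kernel_def algebra_simps)
    show "Q ^ ((j + r)\<^sup>2) * bailey_kernel Q (j + r) (int r) * inv_qfac Q (int n - int (j + r)) = Q ^ (r\<^sup>2) * (Q ^ (j\<^sup>2 + j * (2 * r)) * inv_qfac Q (int (n - r) - int j) * inv_qfac Q (int j) * inv_qfac Q (int (2 * r + j)))"
      unfolding e1 e2 e3 power_add[of Q "r\<^sup>2"] by (simp only: mult_ac)
  qed
  also have "\<dots> = Q ^ (r\<^sup>2) * (inv_qfac Q (int (n - r)) * inv_qfac Q (int (n - r + 2 * r)))"
    by (simp only: sum_distrib_left[symmetric] q_vandermonde)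
  also have "\<dots> = Q ^ (r\<^sup>2) * bailey_kernel Q n (int r)"
    using True by (simp add: bailey_kernel_def of_nat_diff algebra_simps)
  finally show ?thesis .
qed

text \<open>The Bailey lemma with both parameters sent to infinity, for a single r: one pass only
  multiplies the kernel by \<open>Q^(r^2)\<close>.\<close>

lemma bailey_step:
  "(\<Sum>m\<le>n. Q ^ (m\<^sup>2) * bailey_kernel Q m r * inv_qfac Q (int n - int m)) = Q ^ nat (r\<^sup>2) * bailey_kernel Q n r"
proof -
  have r: "r = int (nat \<bar>r\<bar>) \<or> r = - int (nat \<bar>r\<bar>)" by auto
  have e: "nat (r\<^sup>2) = (nat \<bar>r\<bar>)\<^sup>2" by (simp add: nat_power_eq power2_eq_square nat_mult_distrib[symmetric] abs_mult[symmetric])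
  have "bailey_kernel Q m r = bailey_kernel Q m (int (nat \<bar>r\<bar>))" for m
    using r bailey_kernel_minus by metis
  then show ?thesis using bailey_step_nonneg[where n=n and r="nat \<bar>r\<bar>"] by (simp only: e)
qed

end

lemma sum_int_minus: "(\<Sum>r=a..b. f (- r)) = (\<Sum>r=-b..-a. f (r::int))"
  by (rule sum.reindex_bij_witness[of _ "\<lambda>r. - r" "\<lambda>r. - r"]) auto

section \<open>Bailey pairs relative to 1\<close>

definition parity_sign :: "int \<Rightarrow> real fps" where
  "parity_sign r = (if even r then 1 else - 1)"

lemma fps_X_nth_0: "fps_nth (fps_X :: real fps) 0 = 0"
  by simp

lemma parity_sign_minus [simp]: "parity_sign (- r) = parity_sign r"
  by (simp add: parity_sign_def)

lemma parity_sign_plus_1: "parity_sign (r + 1) = - parity_sign r"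
  by (simp add: parity_sign_def)

lemma parity_sign_minus_1: "parity_sign (r - 1) = - parity_sign r"
  by (simp add: parity_sign_def)

lemma mult_pull: "a * b = c * d \<Longrightarrow> a * (s * b * k) = s * (c * d) * k" for a b c d s k :: "real fps"
proof -
  assume "a * b = c * d"
  then have "s * (a * b) * k = s * (c * d) * k" by (simp only:)
  then show ?thesis by (simp only: mult_ac)
qed

text \<open>The term r = n vanishes through \<open>inv_qfac\<close> of -1; on the remaining range
  the involution r -> -1-r exchanges the two reciprocal factorials and negates g.\<close>

lemma sum_antisymmetric_zero:
  fixes g :: "int \<Rightarrow> real fps"
  assumes "\<And>r. g (- 1 - r) = - g r"
  shows "(\<Sum>r=-int n..int n. g r * (inv_qfac Q (int n - r - 1) * inv_qfac Q (int n + r))) = 0"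
proof -
  let ?t = "\<lambda>r. g r * (inv_qfac Q (int n - r - 1) * inv_qfac Q (int n + r))"
  have "(\<Sum>r=-int n..int n. ?t r) = (\<Sum>r=-int n..int n - 1. ?t r)"
  proof (rule sum.mono_neutral_right)
    show "\<forall>i\<in>{- int n..int n} - {- int n..int n - 1}. ?t i = 0"
    proof
      fix i assume "i \<in> {- int n..int n} - {- int n..int n - 1}"
      then have "i = int n" by auto
      then show "?t i = 0" by simp
    qed
  qed auto
  moreover have "(\<Sum>r=-int n..int n - 1. ?t r) = (\<Sum>r=-int n..int n - 1. - ?t r)"
  proof (rule sum.reindex_bij_witness[of _ "\<lambda>r. - 1 - r" "\<lambda>r. - 1 - r"])
    fix r
    have e: "int n - (- 1 - r) - 1 = int n + r" "int n + (- 1 - r) = int n - r - 1" by simp_all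
    show "- ?t (- 1 - r) = ?t r" by (simp only: e assms) simp
  qed auto
  ultimately have "(\<Sum>r=-int n..int n. ?t r) = - (\<Sum>r=-int n..int n. ?t r)"
    unfolding sum_negf by argo
  then have "2 * (\<Sum>r=-int n..int n. ?t r) = 0" unfolding eq_neg_iff_add_eq_0 mult_2 .
  then show ?thesis by (simp only: mult_eq_0_iff) simp
qed

lemma quad_nonneg: "\<bar>h\<bar> \<le> c \<Longrightarrow> 0 \<le> c * r\<^sup>2 + h * (r::int)"
proof -
  assume h: "\<bar>h\<bar> \<le> c"
  have "\<bar>h * r\<bar> \<le> c * r\<^sup>2"
  proof (cases "r = 0")
    case False
    have "\<bar>h * r\<bar> = \<bar>h\<bar> * \<bar>r\<bar>" by (simp add: abs_mult)
    also have "\<dots> \<le> c * \<bar>r\<bar>" using h by (intro mult_right_mono) auto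
    also have "\<dots> \<le> c * (\<bar>r\<bar> * \<bar>r\<bar>)" using h False mult_left_mono[of 1 "\<bar>r\<bar>" "\<bar>r\<bar>"] by (intro mult_left_mono) auto
    also have "\<dots> = c * r\<^sup>2" by (simp add: power2_eq_square abs_mult_self_eq)
    finally show ?thesis .
  qed simp
  then show ?thesis by linarith
qed

text \<open>Only used for \<open>\<bar>h\<bar> \<le> c\<close>, where the exponents are nonnegative and \<open>nat\<close> is exact.\<close>

definition bailey_sum :: "int \<Rightarrow> nat \<Rightarrow> int \<Rightarrow> real fps" where
  "bailey_sum c n h = (\<Sum>r=-int n..int n. parity_sign r * fps_X ^ nat (c * r\<^sup>2 + h * r) * bailey_kernel fps_X n r)"

lemma bailey_sum_minus: "bailey_sum c n (- h) = bailey_sum c n h"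
proof -
  have "bailey_sum c n (- h) = (\<Sum>r=-int n..int n. parity_sign (- r) * fps_X ^ nat (c * (- r)\<^sup>2 + h * (- r)) * bailey_kernel fps_X n (- r))"
    by (simp add: bailey_sum_def bailey_kernel_minus)
  also have "\<dots> = bailey_sum c n h"
    unfolding bailey_sum_def by (subst sum_int_minus) simp
  finally show ?thesis .
qed

lemma bailey_sum_0 [simp]: "bailey_sum c 0 h = 1"
  by (simp add: bailey_sum_def parity_sign_def bailey_kernel_def)

text \<open>Trading a shift of h by 1 or -1 for \<open>X^(n+r)\<close> or \<open>X^(n-r)\<close>
  produces exactly the powers in the factors \<open>1 - X^(n+r)\<close> and
  \<open>1 - X^(n-r)\<close> that lower \<open>bailey_kernel\<close>.\<close>

lemma X_power_pull:
  assumes "\<bar>h\<bar> \<le> c" "\<bar>h + j\<bar> \<le> c" "\<bar>r\<bar> \<le> int n" "\<bar>j\<bar> \<le> 1"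
  shows "fps_X ^ n * fps_X ^ nat (c * r\<^sup>2 + (h + j) * r) = fps_X ^ nat (int n + j * r) * (fps_X ^ nat (c * r\<^sup>2 + h * r) :: real fps)"
proof -
  have "0 \<le> c * r\<^sup>2 + h * r" "0 \<le> c * r\<^sup>2 + (h + j) * r" using assms by (auto intro: quad_nonneg)
  moreover have "\<bar>j * r\<bar> \<le> int n" using assms(3,4) mult_mono[of "\<bar>j\<bar>" 1 "\<bar>r\<bar>" "int n"] by (simp add: abs_mult)
  ultimately have "n + nat (c * r\<^sup>2 + (h + j) * r) = nat (int n + j * r) + nat (c * r\<^sup>2 + h * r)"
    by (simp add: algebra_simps)
  then show ?thesis by (simp flip: power_add)
qed

text \<open>The summands of the difference of both sides are antisymmetric under \<open>r \<mapsto> -1-r\<close>.\<close>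

lemma bailey_sum_top:
  assumes "1 \<le> c"
  shows "bailey_sum c n c = fps_X ^ n * bailey_sum c n (c - 1)"
proof -
  let ?X = "fps_X :: real fps"
  have "bailey_sum c n c - ?X ^ n * bailey_sum c n (c - 1)
      = (\<Sum>r=-int n..int n. parity_sign r * ?X ^ nat (c * r\<^sup>2 + c * r) * (inv_qfac ?X (int n - r - 1) * inv_qfac ?X (int n + r)))"
    unfolding bailey_sum_def sum_distrib_left sum_subtractf[symmetric]
  proof (rule sum.cong[OF refl])
    fix r assume r: "r \<in> {- int n..int n}"
    have "?X ^ n * ?X ^ nat (c * r\<^sup>2 + (c - 1) * r) = ?X ^ nat (int n - r) * ?X ^ nat (c * r\<^sup>2 + c * r)"
      using X_power_pull[of c c "- 1" r n] r assms by auto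
    then have "?X ^ n * (parity_sign r * ?X ^ nat (c * r\<^sup>2 + (c - 1) * r) * bailey_kernel ?X n r) = parity_sign r * (?X ^ nat (int n - r) * ?X ^ nat (c * r\<^sup>2 + c * r)) * bailey_kernel ?X n r"
      by (rule mult_pull)
    from arg_cong[OF this, of "\<lambda>x. parity_sign r * ?X ^ nat (c * r\<^sup>2 + c * r) * bailey_kernel ?X n r - x"] have "parity_sign r * ?X ^ nat (c * r\<^sup>2 + c * r) * bailey_kernel ?X n r - ?X ^ n * (parity_sign r * ?X ^ nat (c * r\<^sup>2 + (c - 1) * r) * bailey_kernel ?X n r)
      = parity_sign r * ?X ^ nat (c * r\<^sup>2 + c * r) * (((1 - ?X ^ nat (int n - r)) * inv_qfac ?X (int n - r)) * inv_qfac ?X (int n + r))"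
      by (rule trans) (unfold bailey_kernel_def, simp only: ring_distribs mult_ac mult_1 mult_1_right)
    then show "parity_sign r * ?X ^ nat (c * r\<^sup>2 + c * r) * bailey_kernel ?X n r - ?X ^ n * (parity_sign r * ?X ^ nat (c * r\<^sup>2 + (c - 1) * r) * bailey_kernel ?X n r)
      = parity_sign r * ?X ^ nat (c * r\<^sup>2 + c * r) * (inv_qfac ?X (int n - r - 1) * inv_qfac ?X (int n + r))"
      by (simp only: inv_qfac_pred[OF fps_X_nth_0])
  qed
  also have "\<dots> = 0"
  proof (rule sum_antisymmetric_zero)
    fix r :: int
    have "c * (- 1 - r)\<^sup>2 + c * (- 1 - r) = c * r\<^sup>2 + c * r"
      by (simp add: power2_eq_square algebra_simps)
    moreover have "parity_sign (- 1 - r) = - parity_sign r" by (simp add: parity_sign_def)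
    ultimately show "parity_sign (- 1 - r) * ?X ^ nat (c * (- 1 - r)\<^sup>2 + c * (- 1 - r)) = - (parity_sign r * ?X ^ nat (c * r\<^sup>2 + c * r))"
      by simp
  qed
  finally show ?thesis by simp
qed

text \<open>With \<open>u = X^(n+1-r)\<close> and \<open>v = X^(n+1+r)\<close> the terms combine to
  \<open>1 + uv - u - v = (1-u)(1-v)\<close>, which lowers both factorials of the kernel and so
  takes n+1 to n.\<close>

lemma bailey_sum_recurrence:
  assumes "\<bar>h\<bar> + 1 \<le> c"
  shows "(1 + fps_X ^ (2 * Suc n)) * bailey_sum c (Suc n) h - fps_X ^ Suc n * (bailey_sum c (Suc n) (h - 1) + bailey_sum c (Suc n) (h + 1)) = bailey_sum c n h"
proof -
  let ?X = "fps_X :: real fps" and ?n = "Suc n"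
  let ?e = "\<lambda>h r. ?X ^ nat (c * r\<^sup>2 + h * r)"
  have "(1 + ?X ^ (2 * ?n)) * bailey_sum c ?n h - ?X ^ ?n * (bailey_sum c ?n (h - 1) + bailey_sum c ?n (h + 1))
     = (\<Sum>r=-int ?n..int ?n. parity_sign r * ?e h r * (inv_qfac ?X (int n - r) * inv_qfac ?X (int n + r)))"
    unfolding bailey_sum_def sum_distrib_left sum_subtractf[symmetric] sum.distrib[symmetric]
  proof (rule sum.cong[OF refl])
    fix r assume r: "r \<in> {- int ?n..int ?n}"
    have 1: "?X ^ ?n * ?e (h - 1) r = ?X ^ nat (int ?n - r) * ?e h r"
      using X_power_pull[of h c "- 1" r ?n] r assms by auto
    have 2: "?X ^ ?n * ?e (h + 1) r = ?X ^ nat (int ?n + r) * ?e h r"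
      using X_power_pull[of h c 1 r ?n] r assms by auto
    have 3: "?X ^ (2 * ?n) = ?X ^ nat (int ?n - r) * ?X ^ nat (int ?n + r)"
    proof -
      have "nat (int ?n - r) + nat (int ?n + r) = 2 * ?n" using r by auto
      then show ?thesis by (simp flip: power_add)
    qed
    let ?u = "?X ^ nat (int ?n - r)" and ?v = "?X ^ nat (int ?n + r)"
    have "(1 + ?X ^ (2 * ?n)) * (parity_sign r * ?e h r * bailey_kernel ?X ?n r) - ?X ^ ?n * (parity_sign r * ?e (h - 1) r * bailey_kernel ?X ?n r + parity_sign r * ?e (h + 1) r * bailey_kernel ?X ?n r)
      = (1 + ?X ^ (2 * ?n)) * (parity_sign r * ?e h r * bailey_kernel ?X ?n r) - (parity_sign r * (?X ^ ?n * ?e (h - 1) r) * bailey_kernel ?X ?n r + parity_sign r * (?X ^ ?n * ?e (h + 1) r) * bailey_kernel ?X ?n r)"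
      by (simp only: ring_distribs mult_ac)
    also have "\<dots> = (1 + ?u * ?v) * (parity_sign r * ?e h r * bailey_kernel ?X ?n r) - (parity_sign r * (?u * ?e h r) * bailey_kernel ?X ?n r + parity_sign r * (?v * ?e h r) * bailey_kernel ?X ?n r)"
      by (simp only: 1 2 3)
    also have "\<dots> = parity_sign r * ?e h r * ((1 - ?u) * (1 - ?v) * bailey_kernel ?X ?n r)"
      by (simp only: ring_distribs mult_ac) (simp add: algebra_simps)
    also have "\<dots> = parity_sign r * ?e h r * (inv_qfac ?X (int ?n - 1 - r) * inv_qfac ?X (int ?n - 1 + r))"
      by (simp only: bailey_kernel_step[OF fps_X_nth_0])
    finally show "(1 + ?X ^ (2 * ?n)) * (parity_sign r * ?e h r * bailey_kernel ?X ?n r) - ?X ^ ?n * (parity_sign r * ?e (h - 1) r * bailey_kernel ?X ?n r + parity_sign r * ?e (h + 1) r * bailey_kernel ?X ?n r)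
      = parity_sign r * ?e h r * (inv_qfac ?X (int n - r) * inv_qfac ?X (int n + r))"
      by simp
  qed
  also have "\<dots> = (\<Sum>r=-int n..int n. parity_sign r * ?e h r * (inv_qfac ?X (int n - r) * inv_qfac ?X (int n + r)))"
    by (rule sum.mono_neutral_right) auto
  finally show ?thesis by (simp add: bailey_sum_def bailey_kernel_def)
qed

text \<open>One pass raises the coefficient c of \<open>r^2\<close> by one and keeps h; this carries
  out the innermost sum of the multisum.\<close>

lemma bailey_sum_bailey:
  "(\<Sum>m\<le>n. fps_X ^ (m\<^sup>2) * inv_qfac fps_X (int n - int m) * bailey_sum c m h) = bailey_sum (c + 1) n h"
  if "\<bar>h\<bar> \<le> c"
proof -
  let ?X = "fps_X :: real fps"
  let ?f = "\<lambda>m r. parity_sign r * ?X ^ nat (c * r\<^sup>2 + h * r) * (?X ^ (m\<^sup>2) * bailey_kernel ?X m r * inv_qfac ?X (int n - int m))"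
  have "?X ^ (m\<^sup>2) * inv_qfac ?X (int n - int m) * bailey_sum c m h = (\<Sum>r=-int n..int n. ?f m r)" if "m \<le> n" for m
  proof -
    have "?X ^ (m\<^sup>2) * inv_qfac ?X (int n - int m) * bailey_sum c m h = (\<Sum>r=-int m..int m. ?f m r)"
      unfolding bailey_sum_def sum_distrib_left by (rule sum.cong[OF refl]) (simp only: mult_ac)
    also have "\<dots> = (\<Sum>r=-int n..int n. ?f m r)"
      using that by (intro sum.mono_neutral_left) (auto simp: bailey_kernel_eq_0)
    finally show ?thesis .
  qed
  then have "(\<Sum>m\<le>n. ?X ^ (m\<^sup>2) * inv_qfac ?X (int n - int m) * bailey_sum c m h) = (\<Sum>m\<le>n. \<Sum>r=-int n..int n. ?f m r)"
    by simp
  also have "\<dots> = (\<Sum>r=-int n..int n. parity_sign r * ?X ^ nat (c * r\<^sup>2 + h * r) * (?X ^ nat (r\<^sup>2) * bailey_kernel ?X n r))"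
    by (subst sum.swap) (simp only: sum_distrib_left[symmetric] bailey_step[OF fps_X_nth_0])
  also have "\<dots> = bailey_sum (c + 1) n h"
    unfolding bailey_sum_def
  proof (rule sum.cong[OF refl])
    fix r
    have "nat (c * r\<^sup>2 + h * r) + nat (r\<^sup>2) = nat ((c + 1) * r\<^sup>2 + h * r)"
      using quad_nonneg[OF \<open>\<bar>h\<bar> \<le> c\<close>, of r] by (simp add: algebra_simps flip: nat_add_distrib)
    then show "parity_sign r * ?X ^ nat (c * r\<^sup>2 + h * r) * (?X ^ nat (r\<^sup>2) * bailey_kernel ?X n r) = parity_sign r * ?X ^ nat ((c + 1) * r\<^sup>2 + h * r) * bailey_kernel ?X n r"
      by (simp only: power_add[symmetric] mult.assoc[symmetric]) (simp only: mult.assoc power_add[symmetric])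
  qed
  finally show ?thesis .
qed

text \<open>At c = 1 the recurrence closes up: h = 1 and h = -1 agree by symmetry and reduce to h =
  0 by \<open>bailey_sum_top\<close>, leaving \<open>1 + X^(2n) - 2 X^(2n) = 1 - X^(2n)\<close>.
  This seed is the denominator with base \<open>q^2\<close> in the multisum.\<close>

lemma bailey_sum_base: "bailey_sum 1 n 0 = inv_qfac (fps_X ^ 2) (int n)"
proof (induction n)
  case 0
  show ?case by simp
next
  case (Suc n)
  let ?X = "fps_X :: real fps"
  have top: "bailey_sum 1 (Suc n) 1 = ?X ^ Suc n * bailey_sum 1 (Suc n) 0" using bailey_sum_top[of 1 "Suc n"] by simp
  have "bailey_sum 1 n 0 = (1 + ?X ^ (2 * Suc n)) * bailey_sum 1 (Suc n) 0 - ?X ^ Suc n * (bailey_sum 1 (Suc n) 1 + bailey_sum 1 (Suc n) 1)"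
    using bailey_sum_recurrence[of 0 1 n] bailey_sum_minus[of 1 "Suc n" 1] by simp
  also have "\<dots> = (1 + ?X ^ (2 * Suc n)) * bailey_sum 1 (Suc n) 0 - 2 * (?X ^ Suc n * ?X ^ Suc n) * bailey_sum 1 (Suc n) 0"
    unfolding top by (simp only: ring_distribs mult_2 mult_ac)
  also have "\<dots> = (1 - (?X ^ 2) ^ Suc n) * bailey_sum 1 (Suc n) 0"
    unfolding power_add[symmetric] power_mult[symmetric] mult_2[symmetric] by (simp add: algebra_simps)
  finally have 1: "(1 - (?X ^ 2) ^ Suc n) * bailey_sum 1 (Suc n) 0 = inv_qfac (?X ^ 2) (int n)" using Suc by simp
  have 2: "(1 - (?X ^ 2) ^ Suc n) * inv_qfac (?X ^ 2) (int (Suc n)) = inv_qfac (?X ^ 2) (int n)"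
    by (rule inv_qfac_Suc) (simp add: fps_nth_power_0)
  have "1 - (?X ^ 2) ^ Suc n \<noteq> 0" by (rule nth_0_one_nonzero) (simp add: fps_nth_power_0)
  with 1 2 show ?case unfolding 2[symmetric] mult_cancel_left by blast
qed

section \<open>Summation over the number of peaks and the triple product\<close>

lemma eq_upto_one_minus_X_power: "L \<le> m \<Longrightarrow> eq_upto L (1 - fps_X ^ m) 1"
  using eq_upto_diff[OF eq_upto_refl eq_upto_X_power[of L m 1], of 1] by simp

lemma eq_upto_one_plus_X_power: "L \<le> m \<Longrightarrow> eq_upto L (1 + fps_X ^ m) 1"
  using eq_upto_add[OF eq_upto_refl eq_upto_X_power[of L m 1], of 1] by simp

lemma eq_upto_prod_lessThan:
  assumes "L \<le> n" "\<And>i. L \<le> i \<Longrightarrow> eq_upto L (f i) 1"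
  shows "eq_upto L (\<Prod>i<n. f i) (\<Prod>i<L. f i)"
  using assms(1)
proof (induction n rule: dec_induct)
  case (step n)
  have "eq_upto L ((\<Prod>i<n. f i) * f n) ((\<Prod>i<L. f i) * 1)"
    using step assms(2) by (intro eq_upto_mult) auto
  then show ?case by simp
qed simp

lemma qfac_eq_upto:
  assumes "0 < M" "L \<le> n"
  shows "eq_upto L (qfac (fps_X ^ M) n) (qfac (fps_X ^ M) L)"
  unfolding qfac_def
proof (rule eq_upto_prod_lessThan[OF assms(2)])
  fix i assume "L \<le> i"
  also have "i \<le> M * Suc i" using assms(1) by (cases M) auto
  finally show "eq_upto L (1 - (fps_X ^ M) ^ Suc i) 1"
    unfolding power_mult[symmetric] by (rule eq_upto_one_minus_X_power)
qed

lemma inv_qfac_eq_upto: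
  assumes "0 < M" "L \<le> n"
  shows "eq_upto L (inv_qfac (fps_X ^ M) (int n)) (inv_qfac (fps_X ^ M) (int L))"
proof -
  let ?Q = "fps_X ^ M :: real fps"
  have Q0: "fps_nth ?Q 0 = 0" using assms(1) by (simp add: fps_nth_power_0)
  have "inv_qfac ?Q (int n) = inv_qfac ?Q (int L) * (inv_qfac ?Q (int n) * qfac ?Q L)"
    using inv_qfac_mult_qfac[OF Q0, of L] by (simp add: mult_ac)
  moreover have "eq_upto L (inv_qfac ?Q (int L) * (inv_qfac ?Q (int n) * qfac ?Q L)) (inv_qfac ?Q (int L) * (inv_qfac ?Q (int n) * qfac ?Q n))"
    by (intro eq_upto_mult eq_upto_refl eq_upto_sym[OF qfac_eq_upto] assms)
  ultimately have "eq_upto L (inv_qfac ?Q (int n)) (inv_qfac ?Q (int L) * (inv_qfac ?Q (int n) * qfac ?Q n))" by (simp only:)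
  then show ?thesis by (simp only: inv_qfac_mult_qfac[OF Q0] mult_1_right)
qed

lemma inv_qfac_X_eq_upto: "L \<le> n \<Longrightarrow> eq_upto L (inv_qfac fps_X (int n)) (inv_qfac fps_X (int L))"
  using inv_qfac_eq_upto[of 1 L n] by simp

section \<open>The limiting q-Gauss sum\<close>

definition plus_qfac :: "nat \<Rightarrow> real fps" where
  "plus_qfac n = (\<Prod>i<n. 1 + fps_X ^ Suc i)"

lemma plus_qfac_0 [simp]: "plus_qfac 0 = 1"
  by (simp add: plus_qfac_def)

lemma plus_qfac_Suc: "plus_qfac (Suc n) = plus_qfac n * (1 + fps_X ^ Suc n)"
  by (simp add: plus_qfac_def)

lemma plus_qfac_eq_upto: "L \<le> n \<Longrightarrow> eq_upto L (plus_qfac n) (plus_qfac L)"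
  unfolding plus_qfac_def by (intro eq_upto_prod_lessThan eq_upto_one_plus_X_power) auto

lemma plus_qfac_add: "plus_qfac (s + m) = plus_qfac s * (\<Prod>i<m. 1 + fps_X ^ (Suc s + i))"
  by (induction m) (simp_all add: plus_qfac_Suc mult.assoc)

text \<open>Here \<open>fps_const (1/2)\<close> is the paper's \<open>(-q)\<^sub>-\<^sub>1\<close>.\<close>

definition first_factor :: "nat \<Rightarrow> real fps" where
  "first_factor n = fps_X ^ tri n * (if n = 0 then fps_const (1 / 2) else plus_qfac (n - 1))"

text \<open>Up to the factor \<open>1/(q)_(s+d)\<close>, a term of the series 2phi1(A,B;C;C/(AB))
  with \<open>A = -q^s\<close>, \<open>C = q^(s+d+1)\<close> and B sent to infinity, whose sum makes
  the total \<open>(-q^(d+1))_inf / (q)_inf\<close>. Only d = s is wanted in the end; a free d can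
  be pushed to infinity.\<close>

definition gauss_term :: "nat \<Rightarrow> nat \<Rightarrow> nat \<Rightarrow> real fps" where
  "gauss_term s d m = fps_X ^ (tri m + d * m) * (\<Prod>i<m. 1 + fps_X ^ (s + i)) * inv_qfac fps_X (int m) * inv_qfac fps_X (int (s + d + m))"

text \<open>The difference between the two sides of the contiguous relation telescopes.\<close>

lemma gauss_term_sum_step:
  "(\<Sum>m<L. gauss_term s d m) = (1 + fps_X ^ Suc d) * (\<Sum>m<L. gauss_term s (Suc d) m) - (1 - fps_X ^ L) * gauss_term s d L"
proof (induction L)
  case 0
  then show ?case by simp
next
  case (Suc L)
  let ?X = "fps_X :: real fps"
  define C where "C = ?X ^ (tri L + d * L) * (\<Prod>i<L. 1 + ?X ^ (s + i)) * inv_qfac ?X (int L) * inv_qfac ?X (int (Suc (s + d + L)))"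
  have rS: "inv_qfac ?X (int (s + d + L)) = (1 - ?X ^ Suc (s + d + L)) * inv_qfac ?X (int (Suc (s + d + L)))"
    by (simp only: inv_qfac_Suc[OF fps_X_nth_0])
  have 1: "gauss_term s d L = (1 - ?X ^ Suc (s + d + L)) * C"
    unfolding gauss_term_def C_def rS by (simp only: mult_ac)
  have 2: "gauss_term s (Suc d) L = ?X ^ L * C"
  proof -
    have "tri L + Suc d * L = L + (tri L + d * L)" by simp
    moreover have "s + Suc d + L = Suc (s + d + L)" by simp
    ultimately show ?thesis unfolding gauss_term_def C_def by (simp only: power_add mult_ac)
  qed
  have 3: "(1 - ?X ^ Suc L) * gauss_term s d (Suc L) = ?X ^ Suc (L + d) * (1 + ?X ^ (s + L)) * C"
  proof -
    have e: "tri (Suc L) + d * Suc L = Suc (L + d) + (tri L + d * L)" by (simp add: tri_Suc)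
    have e': "s + d + Suc L = Suc (s + d + L)" by simp
    have "(1 - ?X ^ Suc L) * gauss_term s d (Suc L) = ?X ^ Suc (L + d) * ?X ^ (tri L + d * L) * ((\<Prod>i<L. 1 + ?X ^ (s + i)) * (1 + ?X ^ (s + L))) * ((1 - ?X ^ Suc L) * inv_qfac ?X (int (Suc L))) * inv_qfac ?X (int (Suc (s + d + L)))"
      unfolding gauss_term_def e e' power_add[of ?X "Suc (L + d)"] prod.lessThan_Suc by (simp only: mult_ac)
    also have "\<dots> = ?X ^ Suc (L + d) * (1 + ?X ^ (s + L)) * C"
      unfolding inv_qfac_Suc[OF fps_X_nth_0] C_def by (simp only: mult_ac)
    finally show ?thesis .
  qed
  have "(1 + ?X ^ Suc d) * (\<Sum>m<Suc L. gauss_term s (Suc d) m) - (1 - ?X ^ Suc L) * gauss_term s d (Suc L)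
     = (\<Sum>m<L. gauss_term s d m) + (1 - ?X ^ L) * gauss_term s d L + (1 + ?X ^ Suc d) * gauss_term s (Suc d) L - (1 - ?X ^ Suc L) * gauss_term s d (Suc L)"
    unfolding Suc.IH sum.lessThan_Suc by (simp only: ring_distribs) simp
  also have "\<dots> = (\<Sum>m<L. gauss_term s d m) + gauss_term s d L"
    unfolding 1 2 3 by (simp add: algebra_simps power_add)
  finally show ?case by simp
qed

lemma gauss_term_eq_upto_0: "L \<le> d * m \<or> L \<le> m \<Longrightarrow> eq_upto L (gauss_term s d m) 0"
  unfolding gauss_term_def mult.assoc using le_tri[of m] by (intro eq_upto_X_power) auto

lemma gauss_term_sum_eq_upto_step: "eq_upto L (\<Sum>m<L. gauss_term s d m) ((1 + fps_X ^ Suc d) * (\<Sum>m<L. gauss_term s (Suc d) m))"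
proof -
  have "eq_upto L ((1 + fps_X ^ Suc d) * (\<Sum>m<L. gauss_term s (Suc d) m) - (1 - fps_X ^ L) * gauss_term s d L)
      ((1 + fps_X ^ Suc d) * (\<Sum>m<L. gauss_term s (Suc d) m) - (1 - fps_X ^ L) * 0)"
    by (intro eq_upto_diff eq_upto_mult eq_upto_refl gauss_term_eq_upto_0) simp
  then show ?thesis unfolding gauss_term_sum_step[of s d L] by simp
qed

lemma gauss_term_sum_eq_upto_iter: "eq_upto L (\<Sum>m<L. gauss_term s d m) ((\<Prod>i<D. 1 + fps_X ^ (Suc d + i)) * (\<Sum>m<L. gauss_term s (d + D) m))"
proof (induction D)
  case (Suc D)
  note Suc.IH
  also have "eq_upto L ((\<Prod>i<D. 1 + fps_X ^ (Suc d + i)) * (\<Sum>m<L. gauss_term s (d + D) m))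
     ((\<Prod>i<D. 1 + fps_X ^ (Suc d + i)) * ((1 + fps_X ^ Suc (d + D)) * (\<Sum>m<L. gauss_term s (Suc (d + D)) m)))"
    by (intro eq_upto_mult eq_upto_refl gauss_term_sum_eq_upto_step)
  finally show ?case by (simp add: mult.assoc)
qed simp

text \<open>For d >= L the factor \<open>X^(d m)\<close> kills every term except m = 0.\<close>

lemma gauss_term_sum_eq_upto_limit:
  assumes "L \<le> d"
  shows "eq_upto L (\<Sum>m<L. gauss_term s d m) (inv_qfac fps_X (int L))"
proof (cases L)
  case 0
  then show ?thesis by (simp add: eq_upto_def)
next
  case (Suc L')
  have "eq_upto L (\<Sum>m<L. gauss_term s d m) (\<Sum>m<L. if m = 0 then inv_qfac fps_X (int L) else 0)"
  proof (rule eq_upto_sum)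
    fix m
    show "eq_upto L (gauss_term s d m) (if m = 0 then inv_qfac fps_X (int L) else 0)"
    proof (cases m)
      case 0
      then show ?thesis using assms inv_qfac_X_eq_upto[of L "s + d"] by (simp add: gauss_term_def)
    next
      case (Suc m')
      then have "L \<le> d * m" using assms by simp
      then show ?thesis using Suc by (simp add: gauss_term_eq_upto_0)
    qed
  qed
  then show ?thesis using Suc sum.delta[of "{..<L}" 0 "\<lambda>_. inv_qfac fps_X (int L)"] by simp
qed

text \<open>For n = m + s the factor \<open>1 + X^s\<close> completes \<open>(-q)_(n-1)\<close> to
  \<open>(-q)_s\<close> times the product in \<open>gauss_term\<close>, also for s = 0 thanks to the
  value 1/2 at n = 0. The q-Gauss sum at d = s supplies the missing tail of \<open>(-q)_inf\<close>,
  so the result depends on s only through \<open>X^(tri s)\<close>.\<close>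

lemma first_factor_bailey_kernel_sum:
  "eq_upto L ((1 + fps_X ^ s) * (\<Sum>n<L. first_factor n * bailey_kernel fps_X n (int s))) (fps_X ^ tri s * (plus_qfac L * inv_qfac fps_X (int L)))"
proof (cases "s < L")
  case False
  then have "bailey_kernel fps_X n (int s) = 0" if "n < L" for n using that by (intro bailey_kernel_eq_0) auto
  moreover have "L \<le> tri s" using False le_tri[of s] by linarith
  ultimately show ?thesis by (simp add: eq_upto_sym[OF eq_upto_X_power])
next
  case True
  let ?X = "fps_X :: real fps"
  have summand: "(1 + ?X ^ s) * (first_factor (m + s) * bailey_kernel ?X (m + s) (int s)) = ?X ^ tri s * (plus_qfac s * gauss_term s s m)" for m
  proof -
    let ?C = "if m + s = 0 then fps_const (1 / 2) else plus_qfac (m + s - 1)"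
    have 1: "(1 + ?X ^ s) * ?C = plus_qfac s * (\<Prod>i<m. 1 + ?X ^ (s + i))"
    proof (cases s)
      case 0
      have two: "2 * fps_const (1 / 2 :: real) = 1" by (simp add: fps_eq_iff fps_numeral_nth)
      have "2 * plus_qfac m' = (\<Prod>i<Suc m'. 1 + ?X ^ i)" for m'
        by (induction m') (simp_all add: plus_qfac_Suc mult.assoc[symmetric])
      then show ?thesis using 0 two by (cases m) auto
    next
      case (Suc s')
      have "plus_qfac (s' + m) = plus_qfac s' * (\<Prod>i<m. 1 + ?X ^ (s + i))" using plus_qfac_add[of s' m] Suc by simp
      then show ?thesis using Suc by (simp add: plus_qfac_Suc add.commute mult_ac)
    qed
    have 2: "tri (m + s) = tri s + (tri m + s * m)" by (simp add: tri_add)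
    have 3: "bailey_kernel ?X (m + s) (int s) = inv_qfac ?X (int m) * inv_qfac ?X (int (s + s + m))"
      by (simp add: bailey_kernel_def algebra_simps)
    have "(1 + ?X ^ s) * (first_factor (m + s) * bailey_kernel ?X (m + s) (int s)) = ?X ^ tri (m + s) * ((1 + ?X ^ s) * ?C) * bailey_kernel ?X (m + s) (int s)"
      unfolding first_factor_def by (simp only: mult_ac)
    also have "\<dots> = ?X ^ tri s * (plus_qfac s * gauss_term s s m)"
      unfolding 1 2 3 gauss_term_def power_add[of ?X "tri s"] by (simp only: mult_ac)
    finally show ?thesis .
  qed
  have "(\<Sum>n<L. first_factor n * bailey_kernel ?X n (int s)) = (\<Sum>n=s..<L. first_factor n * bailey_kernel ?X n (int s))"
    by (rule sum.mono_neutral_right) (auto simp: bailey_kernel_eq_0)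
  also have "\<dots> = (\<Sum>m<L - s. first_factor (m + s) * bailey_kernel ?X (m + s) (int s))"
    using True sum.shift_bounds_nat_ivl[of "\<lambda>n. first_factor n * bailey_kernel ?X n (int s)" 0 s "L - s"] by (simp add: atLeast0LessThan)
  finally have eq: "(1 + ?X ^ s) * (\<Sum>n<L. first_factor n * bailey_kernel ?X n (int s)) = ?X ^ tri s * (plus_qfac s * (\<Sum>m<L - s. gauss_term s s m))"
    by (simp only: sum_distrib_left summand)
  \<comment> \<open>Only L - s terms remain after the shift by s; the lost precision returns with
    the factor \<open>X^(tri s)\<close>, as s <= tri s.\<close>
  have "eq_upto (L - s) (plus_qfac s * (\<Sum>m<L - s. gauss_term s s m)) (plus_qfac s * ((\<Prod>i<L. 1 + ?X ^ (Suc s + i)) * (\<Sum>m<L - s. gauss_term s (s + L) m)))"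
    by (intro eq_upto_mult eq_upto_refl gauss_term_sum_eq_upto_iter)
  also have "eq_upto (L - s) \<dots> (plus_qfac s * ((\<Prod>i<L. 1 + ?X ^ (Suc s + i)) * inv_qfac ?X (int (L - s))))"
    by (intro eq_upto_mult eq_upto_refl gauss_term_sum_eq_upto_limit) simp
  also have "\<dots> = plus_qfac (s + L) * inv_qfac ?X (int (L - s))"
    by (simp only: plus_qfac_add mult.assoc)
  also have "eq_upto (L - s) \<dots> (plus_qfac L * inv_qfac ?X (int L))"
    by (intro eq_upto_mult eq_upto_mono[OF plus_qfac_eq_upto] eq_upto_sym[OF inv_qfac_X_eq_upto]) auto
  finally show ?thesis unfolding eq by (rule eq_upto_X_power_shift) (rule le_tri)
qed

section \<open>The truncated theta series\<close>

definition theta_exp :: "nat \<Rightarrow> nat \<Rightarrow> int \<Rightarrow> int" where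
  "theta_exp M a r = int M * (r * (r - 1) div 2) + int a * r"

definition theta :: "nat \<Rightarrow> nat \<Rightarrow> nat \<Rightarrow> real fps" where
  "theta M a L = (\<Sum>r=1 - int L..int L - 1. parity_sign r * fps_X ^ nat (theta_exp M a r))"

lemma two_th: "2 * theta_exp M a r = int M * (r * (r - 1)) + 2 * int a * r"
proof -
  have "2 * (r * (r - 1) div 2) = r * (r - 1)" by simp
  then show ?thesis unfolding theta_exp_def by (metis distrib_left mult.assoc mult.left_commute)
qed

lemma theta_exp_plus_1: "theta_exp M a (r + 1) = theta_exp M a r + int M * r + int a"
  using two_th[of M a r] two_th[of M a "r + 1"] by (simp add: algebra_simps)

text \<open>Terms with |r| >= L thus vanish modulo \<open>X^L\<close>, which is what the cut-off in
  \<open>theta\<close> relies on. At r = -1 the exponent is M - a, hence the condition a <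
  M.\<close>

lemma theta_exp_ge_abs:
  assumes "0 < a" "a < M"
  shows "\<bar>r\<bar> \<le> theta_exp M a r"
proof (cases "0 \<le> r")
  case True
  then have "0 \<le> r * (r - 1)" by (cases "r = 0") auto
  then have "0 \<le> int M * (r * (r - 1) div 2)" by simp
  moreover have "1 * r \<le> int a * r" using True assms(1) by (intro mult_right_mono) auto
  ultimately show ?thesis unfolding theta_exp_def using True by linarith
next
  case False
  have "2 * - r \<le> r * (r - 1)" using False mult_right_mono[of 2 "1 - r" "- r"] by (simp add: algebra_simps)
  then have "int M * (2 * - r) \<le> int M * (r * (r - 1))" by (intro mult_left_mono) auto
  moreover have "(int a + 1) * - r \<le> int M * - r" using False assms(2) by (intro mult_right_mono) auto
  ultimately have "2 * - r \<le> 2 * theta_exp M a r" unfolding two_th by (simp add: algebra_simps)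
  then show ?thesis using False by simp
qed

text \<open>The pair h-1, h makes the sum over n computable: for each r its two powers share the
  factor \<open>1 + X^|r|\<close> demanded by \<open>first_factor_bailey_kernel_sum\<close>. The
  extra \<open>X^(tri |r|)\<close> raises c to c + 1/2, hence the modulus 2c+1; reversing r matches
  the sign convention of \<open>theta_exp\<close>.\<close>

lemma first_factor_bailey_sum_sum:
  assumes "1 \<le> h" "h \<le> c"
  shows "eq_upto L (\<Sum>n<L. first_factor n * (bailey_sum (int c) n (int h - 1) + bailey_sum (int c) n (int h)))
     (plus_qfac L * inv_qfac fps_X (int L) * theta (2 * c + 1) (c + 1 - h) L)"
proof -
  let ?X = "fps_X :: real fps"
  let ?e = "\<lambda>h r. nat (int c * r\<^sup>2 + h * r)"
  let ?f = "\<lambda>n r. first_factor n * (parity_sign r * (?X ^ ?e (int h - 1) r + ?X ^ ?e (int h) r) * bailey_kernel ?X n r)"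
  have "(\<Sum>n<L. first_factor n * (bailey_sum (int c) n (int h - 1) + bailey_sum (int c) n (int h))) = (\<Sum>n<L. \<Sum>r=1 - int L..int L - 1. ?f n r)"
  proof (rule sum.cong[OF refl])
    fix n assume n: "n \<in> {..<L}"
    have "first_factor n * (bailey_sum (int c) n (int h - 1) + bailey_sum (int c) n (int h)) = (\<Sum>r=-int n..int n. ?f n r)"
      unfolding bailey_sum_def sum.distrib[symmetric] sum_distrib_left
      by (rule sum.cong[OF refl]) (simp only: ring_distribs mult_ac)
    also have "\<dots> = (\<Sum>r=1 - int L..int L - 1. ?f n r)"
      using n by (intro sum.mono_neutral_left) (auto simp: bailey_kernel_eq_0)
    finally show "first_factor n * (bailey_sum (int c) n (int h - 1) + bailey_sum (int c) n (int h)) = (\<Sum>r=1 - int L..int L - 1. ?f n r)" .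
  qed
  also have "\<dots> = (\<Sum>r=1 - int L..int L - 1. \<Sum>n<L. ?f n r)"
    by (rule sum.swap)
  also have "eq_upto L \<dots> (\<Sum>r=1 - int L..int L - 1. parity_sign (- r) * ?X ^ nat (theta_exp (2 * c + 1) (c + 1 - h) (- r)) * (plus_qfac L * inv_qfac ?X (int L)))"
  proof (rule eq_upto_sum)
    fix r
    let ?s = "nat \<bar>r\<bar>"
    \<comment> \<open>The smaller of the two exponents; they differ by |r|.\<close>
    define e where "e = (if r \<ge> 0 then ?e (int h - 1) r else ?e (int h) r)"
    have nn: "0 \<le> int c * r\<^sup>2 + (int h - 1) * r" "0 \<le> int c * r\<^sup>2 + int h * r"
      using assms by (auto intro!: quad_nonneg)
    have pow: "?X ^ ?e (int h - 1) r + ?X ^ ?e (int h) r = ?X ^ e * (1 + ?X ^ ?s)"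
    proof (cases "r \<ge> 0")
      case True
      then have "?e (int h) r = e + ?s" using nn unfolding e_def by (simp add: algebra_simps)
      then show ?thesis using True by (simp add: e_def power_add ring_distribs)
    next
      case False
      then have "?e (int h - 1) r = e + ?s" using nn unfolding e_def by (simp add: algebra_simps)
      then show ?thesis using False by (simp add: e_def power_add ring_distribs)
    qed
    have "2 * int (tri ?s) = \<bar>r\<bar> * (\<bar>r\<bar> + 1)"
      using two_tri[of ?s] by (metis abs_ge_zero int_nat_eq of_nat_1 of_nat_add of_nat_mult of_nat_numeral)
    moreover have "int e = (if r \<ge> 0 then int c * r\<^sup>2 + (int h - 1) * r else int c * r\<^sup>2 + int h * r)"
      using nn by (simp add: e_def)
    ultimately have "2 * theta_exp (2 * c + 1) (c + 1 - h) (- r) = 2 * int (e + tri ?s)"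
      unfolding two_th using assms by (auto simp: power2_eq_square algebra_simps of_nat_diff split: if_splits)
    then have ex: "nat (theta_exp (2 * c + 1) (c + 1 - h) (- r)) = e + tri ?s" by simp
    have K: "bailey_kernel ?X n r = bailey_kernel ?X n (int ?s)" for n
      by (cases "r \<ge> 0") (auto simp: bailey_kernel_minus)
    have "(\<Sum>n<L. ?f n r) = parity_sign r * ?X ^ e * ((1 + ?X ^ ?s) * (\<Sum>n<L. first_factor n * bailey_kernel ?X n (int ?s)))"
      unfolding pow K sum_distrib_left by (rule sum.cong[OF refl]) (simp only: mult_ac)
    also have "eq_upto L \<dots> (parity_sign r * ?X ^ e * (?X ^ tri ?s * (plus_qfac L * inv_qfac ?X (int L))))"
      by (intro eq_upto_mult eq_upto_refl first_factor_bailey_kernel_sum)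
    also have "\<dots> = parity_sign (- r) * ?X ^ nat (theta_exp (2 * c + 1) (c + 1 - h) (- r)) * (plus_qfac L * inv_qfac ?X (int L))"
      unfolding ex parity_sign_minus power_add by (simp only: mult_ac)
    finally show "eq_upto L (\<Sum>n<L. ?f n r) (parity_sign (- r) * ?X ^ nat (theta_exp (2 * c + 1) (c + 1 - h) (- r)) * (plus_qfac L * inv_qfac ?X (int L)))" .
  qed
  also have "(\<Sum>r=1 - int L..int L - 1. parity_sign (- r) * ?X ^ nat (theta_exp (2 * c + 1) (c + 1 - h) (- r)) * (plus_qfac L * inv_qfac ?X (int L)))
     = theta (2 * c + 1) (c + 1 - h) L * (plus_qfac L * inv_qfac ?X (int L))"
    unfolding theta_def sum_distrib_right
    using sum_int_minus[of "\<lambda>r. parity_sign r * ?X ^ nat (theta_exp (2 * c + 1) (c + 1 - h) r) * (plus_qfac L * inv_qfac ?X (int L))" "1 - int L" "int L - 1"]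
    by simp
  finally show ?thesis by (simp only: mult_ac)
qed

section \<open>The Jacobi triple product\<close>

context
  fixes M a :: nat
  assumes a_pos: "0 < a" and a_less: "a < M"
begin

private abbreviation (input) "Q \<equiv> fps_X ^ M :: real fps"
private abbreviation (input) "\<T> r \<equiv> parity_sign r * fps_X ^ nat (theta_exp M a r) :: real fps"

private lemma Q_nth_0: "fps_nth Q 0 = 0"
  using a_less by (simp add: fps_nth_power_0)

private lemma theta_exp_nonneg: "0 \<le> theta_exp M a r"
  using theta_exp_ge_abs[OF a_pos a_less, of r] by linarith

private lemma T_shift_down:
  assumes "0 < N" "1 - int N \<le> r"
  shows "\<T> (r - 1) * Q ^ nat (int N + (r - 1)) = - (fps_X ^ (M * N - a) * \<T> r)"
proof -
  have "a \<le> M * N" using assms(1) a_less by (cases N) auto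
  moreover have "theta_exp M a r = theta_exp M a (r - 1) + int M * (r - 1) + int a"
    using theta_exp_plus_1[of M a "r - 1"] by simp
  ultimately have "int (nat (theta_exp M a (r - 1)) + M * nat (int N + (r - 1))) = int (M * N - a + nat (theta_exp M a r))"
    using theta_exp_nonneg[of r] theta_exp_nonneg[of "r - 1"] assms by (simp add: of_nat_diff algebra_simps)
  then have "nat (theta_exp M a (r - 1)) + M * nat (int N + (r - 1)) = M * N - a + nat (theta_exp M a r)"
    by (simp only: of_nat_eq_iff)
  then show ?thesis
    by (simp add: parity_sign_minus_1 mult.left_commute[of _ "parity_sign r"] mult.assoc flip: power_mult power_add)
qed

private lemma T_shift_up:
  assumes "r \<le> int N"
  shows "\<T> (r + 1) * Q ^ nat (int N - r) = - (fps_X ^ (a + M * N) * \<T> r)"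
proof -
  have "int (nat (theta_exp M a (r + 1)) + M * nat (int N - r)) = int (a + M * N + nat (theta_exp M a r))"
    using theta_exp_nonneg[of r] theta_exp_nonneg[of "r + 1"] theta_exp_plus_1[of M a r] assms by (simp add: algebra_simps)
  then have "nat (theta_exp M a (r + 1)) + M * nat (int N - r) = a + M * N + nat (theta_exp M a r)"
    by (simp only: of_nat_eq_iff)
  then show ?thesis
    by (simp add: parity_sign_plus_1 mult.left_commute[of _ "parity_sign r"] mult.assoc flip: power_mult power_add)
qed

text \<open>The finite form of the triple product is proved by passing from \<open>N\<close> to \<open>N+1\<close> in two half-steps.\<close>

private definition "full N = (\<Sum>r=-int N..int N. \<T> r * (inv_qfac Q (int N - r) * inv_qfac Q (int N + r)))"
private definition "half N = (\<Sum>r=-int N..int N. \<T> r * (inv_qfac Q (int N - r) * inv_qfac Q (int N - 1 + r)))"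

text \<open>Split \<open>1 - uv = (1-v) + v(1-u)\<close> with \<open>u = Q^(N-r)\<close> and
  \<open>v = Q^(N+r)\<close>. The first part gives \<open>half N\<close>; in the second, replacing r
  by r-1 turns v times the theta term into \<open>- X^(MN-a)\<close> times the theta term at
  r.\<close>

private lemma full_half: "0 < N \<Longrightarrow> (1 - Q ^ (2 * N)) * full N = (1 - fps_X ^ (M * N - a)) * half N"
proof -
  assume N: "0 < N"
  let ?g = "\<lambda>r. \<T> r * Q ^ nat (int N + r) * (inv_qfac Q (int N - (r + 1)) * inv_qfac Q (int N - 1 + (r + 1)))"
  have "(1 - Q ^ (2 * N)) * full N = (\<Sum>r=-int N..int N. \<T> r * (inv_qfac Q (int N - r) * inv_qfac Q (int N - 1 + r)) + ?g r)"
    unfolding full_def sum_distrib_left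
  proof (rule sum.cong[OF refl])
    fix r assume r: "r \<in> {- int N..int N}"
    let ?u = "Q ^ nat (int N - r)" and ?v = "Q ^ nat (int N + r)"
    have "nat (int N - r) + nat (int N + r) = 2 * N" using r by auto
    then have pow: "Q ^ (2 * N) = ?u * ?v" by (metis power_add)
    have 1: "(1 - ?v) * inv_qfac Q (int N + r) = inv_qfac Q (int N - 1 + r)"
      using inv_qfac_pred[OF Q_nth_0, of "int N + r"] by (simp add: algebra_simps)
    have 2: "(1 - ?u) * inv_qfac Q (int N - r) = inv_qfac Q (int N - (r + 1))"
      using inv_qfac_pred[OF Q_nth_0, of "int N - r"] by (simp add: algebra_simps)
    have 3: "int N - 1 + (r + 1) = int N + r" by simp
    show "(1 - Q ^ (2 * N)) * (\<T> r * (inv_qfac Q (int N - r) * inv_qfac Q (int N + r))) = \<T> r * (inv_qfac Q (int N - r) * inv_qfac Q (int N - 1 + r)) + ?g r"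
      unfolding pow 3 1[symmetric] 2[symmetric] by (simp only: ring_distribs mult_ac) simp
  qed
  also have "\<dots> = half N + (\<Sum>r=-int N..int N. ?g r)"
    by (simp only: sum.distrib half_def)
  also have "(\<Sum>r=-int N..int N. ?g r) = (\<Sum>r=-int N..int N - 1. ?g r)"
    by (rule sum.mono_neutral_right) auto
  also have "\<dots> = (\<Sum>r=1 - int N..int N. ?g (r - 1))"
    by (rule sum.reindex_bij_witness[of _ "\<lambda>r. r - 1" "\<lambda>r. r + 1"]) auto
  also have "\<dots> = (\<Sum>r=1 - int N..int N. - (fps_X ^ (M * N - a) * (\<T> r * (inv_qfac Q (int N - r) * inv_qfac Q (int N - 1 + r)))))"
  proof (rule sum.cong[OF refl])
    fix r assume r: "r \<in> {1 - int N..int N}"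
    have "\<T> (r - 1) * Q ^ nat (int N + (r - 1)) = - (fps_X ^ (M * N - a) * \<T> r)"
      using r N by (intro T_shift_down) auto
    then show "?g (r - 1) = - (fps_X ^ (M * N - a) * (\<T> r * (inv_qfac Q (int N - r) * inv_qfac Q (int N - 1 + r))))"
      by (simp add: mult.assoc)
  qed
  also have "\<dots> = (\<Sum>r=-int N..int N. - (fps_X ^ (M * N - a) * (\<T> r * (inv_qfac Q (int N - r) * inv_qfac Q (int N - 1 + r)))))"
    by (rule sum.mono_neutral_left) auto
  also have "\<dots> = - (fps_X ^ (M * N - a) * half N)"
    by (simp only: half_def sum_negf sum_distrib_left)
  finally show ?thesis by (simp add: left_diff_distrib)
qed

private lemma half_full: "(1 - Q ^ Suc (2 * N)) * half (Suc N) = (1 - fps_X ^ (a + M * N)) * full N"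
proof -
  let ?g = "\<lambda>r. \<T> r * Q ^ nat (int N - (r - 1)) * (inv_qfac Q (int N - (r - 1)) * inv_qfac Q (int N + (r - 1)))"
  let ?h = "\<lambda>r. \<T> r * (inv_qfac Q (int N - r) * inv_qfac Q (int N + r))"
  have "(1 - Q ^ Suc (2 * N)) * half (Suc N) = (\<Sum>r=-int (Suc N)..int (Suc N). ?h r + ?g r)"
    unfolding half_def sum_distrib_left
  proof (rule sum.cong[OF refl])
    fix r assume r: "r \<in> {- int (Suc N)..int (Suc N)}"
    let ?u = "Q ^ nat (int N - (r - 1))" and ?v = "Q ^ nat (int N + r)"
    have i: "int (Suc N) - r = int N - (r - 1)" "int (Suc N) - 1 + r = int N + r" by simp_all
    have 1: "(1 - ?v) * inv_qfac Q (int N + r) = inv_qfac Q (int N + (r - 1))"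
      using inv_qfac_pred[OF Q_nth_0, of "int N + r"] by (simp add: algebra_simps)
    have 2: "(1 - ?u) * inv_qfac Q (int N - (r - 1)) = inv_qfac Q (int N - r)"
      using inv_qfac_pred[OF Q_nth_0, of "int N - (r - 1)"] by (simp add: algebra_simps)
    show "(1 - Q ^ Suc (2 * N)) * (\<T> r * (inv_qfac Q (int (Suc N) - r) * inv_qfac Q (int (Suc N) - 1 + r))) = ?h r + ?g r"
    \<comment> \<open>At this end N + r = -1 and \<open>nat\<close> would falsify the exponent, but
      every term carries an \<open>inv_qfac\<close> of negative index.\<close>
    proof (cases "r = - int (Suc N)")
      case True
      then show ?thesis by simp
    next
      case False
      then have "nat (int N - (r - 1)) + nat (int N + r) = Suc (2 * N)" using r by auto
      then have pow: "Q ^ Suc (2 * N) = ?u * ?v" by (metis power_add)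
      show ?thesis
        unfolding pow i 1[symmetric] 2[symmetric] by (simp only: ring_distribs mult_ac) simp
    qed
  qed
  also have "\<dots> = (\<Sum>r=-int (Suc N)..int (Suc N). ?h r) + (\<Sum>r=-int (Suc N)..int (Suc N). ?g r)"
    by (simp only: sum.distrib)
  also have "(\<Sum>r=-int (Suc N)..int (Suc N). ?h r) = full N"
    unfolding full_def by (rule sum.mono_neutral_right) auto
  also have "(\<Sum>r=-int (Suc N)..int (Suc N). ?g r) = (\<Sum>r=1-int N..int (Suc N). ?g r)"
    by (rule sum.mono_neutral_right) auto
  also have "\<dots> = (\<Sum>r=- int N..int N. ?g (r + 1))"
    by (rule sum.reindex_bij_witness[of _ "\<lambda>r. r + 1" "\<lambda>r. r - 1"]) auto
  also have "\<dots> = (\<Sum>r=- int N..int N. - (fps_X ^ (a + M * N) * ?h r))"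
  proof (rule sum.cong[OF refl])
    fix r assume r: "r \<in> {- int N..int N}"
    have "\<T> (r + 1) * Q ^ nat (int N - r) = - (fps_X ^ (a + M * N) * \<T> r)"
      using r by (intro T_shift_up) auto
    then show "?g (r + 1) = - (fps_X ^ (a + M * N) * ?h r)"
      by (simp add: mult.assoc)
  qed
  also have "\<dots> = - (fps_X ^ (a + M * N) * full N)"
    by (simp only: full_def sum_negf sum_distrib_left)
  finally show ?thesis by (simp add: left_diff_distrib)
qed

private lemma finite_jacobi_triple:
  "qfac Q (2 * N) * full N = (\<Prod>i<N. 1 - fps_X ^ a * Q ^ i) * (\<Prod>i<N. 1 - fps_X ^ (M - a) * Q ^ i)"
proof (induction N)
  case 0
  show ?case by (simp add: full_def parity_sign_def theta_exp_def)
next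
  case (Suc N)
  have "qfac Q (2 * Suc N) * full (Suc N) = qfac Q (2 * N) * ((1 - Q ^ Suc (2 * N)) * ((1 - Q ^ (2 * Suc N)) * full (Suc N)))"
    by (simp add: qfac_def mult_ac)
  also have "\<dots> = qfac Q (2 * N) * ((1 - Q ^ Suc (2 * N)) * half (Suc N)) * (1 - fps_X ^ (M * Suc N - a))"
    by (subst full_half) (simp_all only: mult_ac zero_less_Suc)
  also have "\<dots> = (qfac Q (2 * N) * full N) * (1 - fps_X ^ (a + M * N)) * (1 - fps_X ^ (M * Suc N - a))"
    by (subst half_full) (simp only: mult_ac)
  also have "fps_X ^ (a + M * N) = fps_X ^ a * Q ^ N" by (simp add: power_add power_mult)
  also have "M * Suc N - a = (M - a) + M * N" using a_less by simp
  also have "fps_X ^ ((M - a) + M * N) = fps_X ^ (M - a) * Q ^ N" by (simp add: power_add power_mult)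
  finally show ?case unfolding Suc.IH prod.lessThan_Suc by (simp only: mult_ac)
qed

lemma jacobi_triple_eq_upto:
  "eq_upto L (theta M a L) (qfac (fps_X ^ M) L * ((\<Prod>i<L. 1 - fps_X ^ a * (fps_X ^ M) ^ i) * (\<Prod>i<L. 1 - fps_X ^ (M - a) * (fps_X ^ M) ^ i)))"
proof (cases "L = 0")
  case True
  then show ?thesis by (simp add: eq_upto_def)
next
  case L: False
  let ?P = "\<lambda>N. (\<Prod>i<N. 1 - fps_X ^ a * Q ^ i) * (\<Prod>i<N. 1 - fps_X ^ (M - a) * Q ^ i)"
  let ?r = "inv_qfac Q (int L)"
  have M: "0 < M" using a_less by simp
  \<comment> \<open>With N = 2L both indices 2L - r and 2L + r are at least L whenever |r| < L, so
    both reciprocals have reached their limit modulo \<open>X^L\<close>.\<close>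
  have "eq_upto L (full (2 * L)) (\<Sum>r=-int (2 * L)..int (2 * L). if \<bar>r\<bar> < int L then \<T> r * (?r * ?r) else 0)"
    unfolding full_def
  proof (rule eq_upto_sum)
    fix r assume r: "r \<in> {- int (2 * L)..int (2 * L)}"
    show "eq_upto L (\<T> r * (inv_qfac Q (int (2 * L) - r) * inv_qfac Q (int (2 * L) + r))) (if \<bar>r\<bar> < int L then \<T> r * (?r * ?r) else 0)"
    proof (cases "\<bar>r\<bar> < int L")
      case True
      have e: "int (2 * L) - r = int (nat (int (2 * L) - r))" "int (2 * L) + r = int (nat (int (2 * L) + r))"
        "L \<le> nat (int (2 * L) - r)" "L \<le> nat (int (2 * L) + r)"
        using True by auto
      have "eq_upto L (inv_qfac Q (int (2 * L) - r)) ?r" "eq_upto L (inv_qfac Q (int (2 * L) + r)) ?r"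
        by (subst e, rule inv_qfac_eq_upto[OF M], rule e)+
      then show ?thesis using True by (auto intro!: eq_upto_mult)
    next
      case False
      then have "L \<le> nat (theta_exp M a r)" using theta_exp_ge_abs[OF a_pos a_less, of r] by simp
      then have "eq_upto L (fps_X ^ nat (theta_exp M a r) * (parity_sign r * (inv_qfac Q (int (2 * L) - r) * inv_qfac Q (int (2 * L) + r)))) 0"
        by (rule eq_upto_X_power)
      then show ?thesis using False by (simp add: mult_ac)
    qed
  qed
  also have "(\<Sum>r=-int (2 * L)..int (2 * L). if \<bar>r\<bar> < int L then \<T> r * (?r * ?r) else 0)
     = (\<Sum>r=1 - int L..int L - 1. if \<bar>r\<bar> < int L then \<T> r * (?r * ?r) else 0)"
    by (rule sum.mono_neutral_right) auto
  also have "\<dots> = (\<Sum>r=1 - int L..int L - 1. \<T> r * (?r * ?r))"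
    by (rule sum.cong) auto
  also have "\<dots> = theta M a L * (?r * ?r)"
    by (simp only: theta_def sum_distrib_right)
  finally have full: "eq_upto L (full (2 * L)) (theta M a L * (?r * ?r))" .
  have "theta M a L = qfac Q L * (qfac Q L * (theta M a L * (?r * ?r)))"
  proof -
    have "qfac Q L * (qfac Q L * (theta M a L * (?r * ?r))) = theta M a L * (?r * qfac Q L) * (?r * qfac Q L)"
      by (simp only: mult_ac)
    then show ?thesis by (simp only: inv_qfac_mult_qfac[OF Q_nth_0] mult_1_right)
  qed
  also have "eq_upto L \<dots> (qfac Q L * (qfac Q (2 * (2 * L)) * full (2 * L)))"
    by (intro eq_upto_mult eq_upto_refl eq_upto_sym[OF full] eq_upto_sym[OF qfac_eq_upto[OF M]]) simp
  also have "qfac Q (2 * (2 * L)) * full (2 * L) = ?P (2 * L)"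
    by (rule finite_jacobi_triple)
  also have "eq_upto L (qfac Q L * ?P (2 * L)) (qfac Q L * ?P L)"
  proof (intro eq_upto_mult eq_upto_refl eq_upto_prod_lessThan)
    fix i assume "L \<le> i"
    moreover have "i \<le> M * i" using M by simp
    ultimately have "L \<le> a + M * i" "L \<le> (M - a) + M * i" by linarith+
    then show "eq_upto L (1 - fps_X ^ a * Q ^ i) 1" "eq_upto L (1 - fps_X ^ (M - a) * Q ^ i) 1"
      by (auto simp flip: power_mult power_add intro!: eq_upto_one_minus_X_power)
  qed auto
  finally show ?thesis .
qed

end

section \<open>Infinite products and the multisum\<close>

text \<open>The limit is assembled diagonally, coefficient n from the first n+1 factors.
  \<open>has_prod\<close> as used here demands a nonzero limit; its constant term is 1 minus that of
  a, whence the second assumption.\<close>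

lemma qpoch_inf_eq_upto:
  assumes "0 < M" "fps_nth a 0 \<noteq> 1"
  shows "eq_upto L (qpoch_inf a (fps_X ^ M)) (\<Prod>i<L. 1 - a * (fps_X ^ M) ^ i)"
proof -
  let ?f = "\<lambda>i. 1 - a * (fps_X ^ M) ^ i"
  define p where "p = Abs_fps (\<lambda>n. fps_nth (\<Prod>i<Suc n. ?f i) n)"
  have tail: "eq_upto L (?f i) 1" if "L \<le> i" for L i
  proof -
    have "L \<le> M * i" using that assms(1) by (metis le_trans mult_le_mono1 nat_mult_1 One_nat_def Suc_leI)
    then have "eq_upto L (1 - fps_X ^ (M * i) * a) (1 - 0)" by (intro eq_upto_diff eq_upto_refl eq_upto_X_power)
    then show ?thesis by (simp add: power_mult mult.commute)
  qed
  have p: "eq_upto L p (\<Prod>i<L. ?f i)" for L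
    unfolding eq_upto_def
  proof (intro allI impI)
    fix n assume "n < L"
    then have "eq_upto (Suc n) (\<Prod>i<L. ?f i) (\<Prod>i<Suc n. ?f i)"
      by (intro eq_upto_prod_lessThan tail) auto
    then show "fps_nth p n = fps_nth (\<Prod>i<L. ?f i) n" by (simp add: p_def eq_upto_def)
  qed
  have "fps_nth p 0 = 1 - fps_nth a 0"
    using p[of 1] by (simp add: eq_upto_def)
  then have "p \<noteq> 0" using assms(2) by auto
  have "(\<lambda>n. \<Prod>i\<le>n. ?f i) \<longlonglongrightarrow> p"
  proof (rule tendsto_fpsI)
    fix n
    show "\<forall>\<^sub>F m in sequentially. fps_nth (\<Prod>i\<le>m. ?f i) n = fps_nth p n"
    proof (rule eventually_sequentiallyI[of n])
      fix m assume "n \<le> m"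
      then have "eq_upto (Suc n) p (\<Prod>i<Suc m. ?f i)" using p[of "Suc m"] by (auto intro: eq_upto_mono)
      then show "fps_nth (\<Prod>i\<le>m. ?f i) n = fps_nth p n"
        unfolding lessThan_Suc_atMost by (simp add: eq_upto_def)
    qed
  qed
  then have "?f has_prod p"
    using \<open>p \<noteq> 0\<close> by (simp add: has_prod_def raw_has_prod_def)
  then have "qpoch_inf a (fps_X ^ M) = p"
    unfolding qpoch_inf_def by (rule has_prod_unique[symmetric])
  then show ?thesis using p by simp
qed

lemma qpoch_X_power: "qpoch (fps_X ^ M) (fps_X ^ M) (int m) = qfac (fps_X ^ M) m"
  by (simp add: qpoch_def qfac_def)

lemma qpoch_X: "qpoch fps_X fps_X (int m) = qfac fps_X m"
  using qpoch_X_power[of 1 m] by simp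

lemma qpoch_inf_minus_X: "eq_upto L (qpoch_inf (- fps_X) fps_X) (plus_qfac L)"
  using qpoch_inf_eq_upto[of 1 "- fps_X" L] by (simp add: plus_qfac_def)

text \<open>The factor with i = 0 is 1 + 1; it is the source of the value 1/2 in
  \<open>qpoch_minus_X\<close>.\<close>

lemma qpoch_inf_minus_1: "qpoch_inf (- 1) fps_X = 2 * qpoch_inf (- fps_X) fps_X"
proof (rule eq_upto_all_imp_eq)
  fix N
  have eq: "(\<Prod>i<Suc N. 1 + fps_X ^ i) = 2 * plus_qfac N"
    by (subst prod.lessThan_Suc_shift) (simp add: plus_qfac_def)
  have "eq_upto (Suc N) (qpoch_inf (- 1) fps_X) (\<Prod>i<Suc N. 1 + fps_X ^ i)"
    using qpoch_inf_eq_upto[of 1 "- 1" "Suc N"] by simp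
  then have "eq_upto N (qpoch_inf (- 1) fps_X) (2 * plus_qfac N)"
    unfolding eq by (rule eq_upto_mono) simp
  also have "eq_upto N \<dots> (2 * qpoch_inf (- fps_X) fps_X)"
    by (intro eq_upto_mult eq_upto_refl eq_upto_sym[OF qpoch_inf_minus_X])
  finally show "eq_upto N (qpoch_inf (- 1) fps_X) (2 * qpoch_inf (- fps_X) fps_X)" .
qed

lemma qpoch_minus_X:
  "qpoch (- fps_X) fps_X (int n - 1) = (if n = 0 then fps_const (1 / 2) else plus_qfac (n - 1))"
proof (cases n)
  case (Suc m)
  then show ?thesis by (simp add: qpoch_def plus_qfac_def)
next
  case 0
  let ?A = "qpoch_inf (- fps_X) fps_X"
  have A0: "fps_nth ?A 0 = 1" using qpoch_inf_minus_X[of 1] by (simp add: eq_upto_def plus_qfac_def)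
  have "- fps_X / fps_X = (- 1 :: real fps)"
    by (metis fps_X_neq_zero minus_mult_minus mult_minus_left mult_1 nonzero_mult_div_cancel_right)
  then have "qpoch (- fps_X) fps_X (int n - 1) = ?A / (2 * ?A)"
    using 0 by (simp add: qpoch_def qpoch_inf_minus_1)
  also have "\<dots> = ?A * inverse (2 * ?A)"
    by (rule fps_divide_unit) (simp add: A0 fps_numeral_nth)
  also have "\<dots> = (?A * inverse ?A) * inverse 2"
    by (simp add: fps_inverse_mult)
  also have "?A * inverse ?A = 1" using A0 by (simp add: inverse_mult_eq_1')
  finally show ?thesis using 0 by (simp add: numeral_fps_const fps_const_inverse inverse_eq_divide)
qed

text \<open>X-adic summability from a grading d: coefficient n of a finite partial sum is final once
  all indices of grade at most n are included.\<close>

lemma has_sum_fpsI: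
  fixes f :: "'a \<Rightarrow> real fps"
  assumes "\<And>L. finite {x \<in> A. d x < L}" "\<And>x L. x \<in> A \<Longrightarrow> L \<le> d x \<Longrightarrow> eq_upto L (f x) 0"
    and "\<And>L. eq_upto L (\<Sum>x | x \<in> A \<and> d x < L. f x) s"
  shows "(f has_sum s) A"
  unfolding has_sum_def
proof (rule tendsto_fpsI)
  fix n
  let ?L = "Suc n"
  have "fps_nth (sum f F) n = fps_nth s n" if F: "finite F" "{x \<in> A. d x < ?L} \<subseteq> F" "F \<subseteq> A" for F
  proof -
    have "sum f F = sum f {x \<in> A. d x < ?L} + sum f (F - {x \<in> A. d x < ?L})"
      using sum.subset_diff[OF F(2,1), of f] by (simp only: add.commute)
    moreover have "eq_upto ?L (sum f (F - {x \<in> A. d x < ?L})) (\<Sum>x\<in>F - {x \<in> A. d x < ?L}. 0)"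
      using F by (intro eq_upto_sum assms(2)) auto
    ultimately show ?thesis using assms(3)[of ?L] by (simp add: eq_upto_def)
  qed
  then show "\<forall>\<^sub>F F in finite_subsets_at_top A. fps_nth (sum f F) n = fps_nth s n"
    unfolding eventually_finite_subsets_at_top using assms(1)[of ?L] by blast
qed

lemma divide_eq_mult_inverse:
  fixes D R f :: "real fps"
  assumes "R * D = 1"
  shows "f / D = f * R"
proof -
  have "D \<noteq> 0" using assms by auto
  have "f / D = (f * R) * D / D" by (simp only: assms mult.assoc mult_1_right)
  also have "\<dots> = f * R" using \<open>D \<noteq> 0\<close> by (rule nonzero_mult_div_cancel_right)
  finally show ?thesis .
qed

section \<open>The multisum evaluated by iterated Bailey steps\<close>

definition tuples :: "nat \<Rightarrow> nat \<Rightarrow> (nat \<Rightarrow> nat) set" where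
  "tuples m n = {N \<in> decreasing_tuples m. N 1 = n}"

lemma tuples_1: "tuples 1 n = {(\<lambda>i. if i = 1 then n else undefined)}"
  by (auto simp: tuples_def decreasing_tuples_def PiE_iff extensional_def fun_eq_iff)

lemma bij_betw_tuples_Suc:
  assumes "1 \<le> j"
  shows "bij_betw (\<lambda>(N, m). N(Suc j := m)) (SIGMA N:tuples j n. {..N j}) (tuples (Suc j) n)"
proof (rule bij_betwI[where g = "\<lambda>N. (restrict N {1..j}, N (Suc j))"])
  show "(\<lambda>(N, m). N(Suc j := m)) \<in> (SIGMA N:tuples j n. {..N j}) \<rightarrow> tuples (Suc j) n"
    using assms by (auto simp: tuples_def decreasing_tuples_def PiE_iff extensional_def less_Suc_eq)
  show "(\<lambda>N. (restrict N {1..j}, N (Suc j))) \<in> tuples (Suc j) n \<rightarrow> (SIGMA N:tuples j n. {..N j})"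
    using assms by (auto simp: tuples_def decreasing_tuples_def)
  show "(restrict ((\<lambda>(N, m). N(Suc j := m)) x) {1..j}, ((\<lambda>(N, m). N(Suc j := m)) x) (Suc j)) = x"
    if "x \<in> (SIGMA N:tuples j n. {..N j})" for x
    using that by (auto simp: tuples_def decreasing_tuples_def PiE_iff extensional_def fun_eq_iff)
  show "(\<lambda>(N, m). N(Suc j := m)) (restrict N {1..j}, N (Suc j)) = N" if "N \<in> tuples (Suc j) n" for N
    using that by (auto simp: tuples_def decreasing_tuples_def PiE_iff extensional_def fun_eq_iff)
qed

lemma finite_tuples: "1 \<le> m \<Longrightarrow> finite (tuples m n)"
proof (induction m rule: dec_induct)
  case base
  show ?case unfolding tuples_1 by simp
next
  case (step m)
  then have "finite (SIGMA N:tuples m n. {..N m})" by (intro finite_SigmaI) auto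
  then show ?case using bij_betw_finite[OF bij_betw_tuples_Suc] step(1) by blast
qed

context
  fixes k a :: nat
  assumes a_ge: "1 \<le> a" and a_le: "a + 1 \<le> k"
begin

private definition lin :: "nat \<Rightarrow> nat \<Rightarrow> real fps" where
  "lin j n = (if j > a then fps_X ^ n else if j = a then 1 + fps_X ^ n else 1)"

text \<open>The value of the sums over \<open>N_(j+1)\<close>, ..., \<open>N_(k-1)\<close> when
  \<open>N_j = n\<close>, including the linear factors from index j on. For j > a each factor
  \<open>q^n\<close> lifts h from c-1 to its top value c = k-j by \<open>bailey_sum_top\<close>. At
  j = a the factor \<open>1 + q^n\<close> keeps both, and this pair stays fixed while c grows
  further as j decreases.\<close>

private definition level :: "nat \<Rightarrow> nat \<Rightarrow> real fps" where
  "level j n = (if j > a then bailey_sum (int k - int j) n (int k - int j)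
     else bailey_sum (int k - int j) n (int k - int a - 1) + bailey_sum (int k - int j) n (int k - int a))"

private lemma lin_bailey_sum:
  assumes "a \<le> j" "j \<le> k - 1"
  shows "lin j n * bailey_sum (int k - int j) n (int k - int j - 1) = level j n"
  using assms bailey_sum_top[of "int k - int j" n] a_le by (auto simp: lin_def level_def ring_distribs)

private lemma level_last: "level (k - 1) n = lin (k - 1) n * inv_qfac (fps_X ^ 2) (int n)"
  using lin_bailey_sum[of "k - 1" n] a_le by (simp add: of_nat_diff bailey_sum_base)

private lemma level_step:
  assumes "1 \<le> j" "j < k - 1"
  shows "level j n = lin j n * (\<Sum>m\<le>n. fps_X ^ (m\<^sup>2) * inv_qfac fps_X (int n - int m) * level (Suc j) m)"
proof (cases "a \<le> j")
  case True
  have "(\<Sum>m\<le>n. fps_X ^ (m\<^sup>2) * inv_qfac fps_X (int n - int m) * level (Suc j) m) = bailey_sum (int k - int j) n (int k - int j - 1)"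
    using True assms bailey_sum_bailey[of "int k - int (Suc j)" "int k - int (Suc j)" n] by (simp add: level_def algebra_simps)
  then show ?thesis using lin_bailey_sum[of j n] True assms by simp
next
  case False
  have "(\<Sum>m\<le>n. fps_X ^ (m\<^sup>2) * inv_qfac fps_X (int n - int m) * level (Suc j) m)
      = bailey_sum (int k - int j) n (int k - int a - 1) + bailey_sum (int k - int j) n (int k - int a)"
    using False assms a_le bailey_sum_bailey[of "int k - int a - 1" "int k - int (Suc j)" n] bailey_sum_bailey[of "int k - int a" "int k - int (Suc j)" n]
    by (simp add: level_def ring_distribs sum.distrib algebra_simps)
  then show ?thesis using False by (simp add: level_def lin_def)
qed

text \<open>The sum over prefixes closed off by \<open>level j\<close> does not depend on j: passing
  to j+1 merely expands \<open>level j\<close> by \<open>level_step\<close>. At j = k-1 it is, apart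
  from \<open>first_factor n\<close>, the multisum with \<open>N_1 = n\<close> fixed.\<close>

private lemma tuple_sum:
  assumes "1 \<le> j" "j \<le> k - 1"
  shows "(\<Sum>N\<in>tuples j n. (\<Prod>i=1..<j. lin i (N i) * inv_qfac fps_X (int (N i) - int (N (i + 1))) * fps_X ^ ((N (i + 1))\<^sup>2)) * level j (N j)) = level 1 n"
  using assms
proof (induction j rule: dec_induct)
  case base
  show ?case unfolding tuples_1 by simp
next
  case (step j)
  let ?p = "\<lambda>N i. lin i (N i) * inv_qfac fps_X (int (N i) - int (N (i + 1))) * fps_X ^ ((N (i + 1))\<^sup>2)"
  have "(\<Sum>N\<in>tuples (Suc j) n. (\<Prod>i=1..<Suc j. ?p N i) * level (Suc j) (N (Suc j)))
      = (\<Sum>x\<in>(SIGMA N:tuples j n. {..N j}). (case x of (N, m) \<Rightarrow> (\<Prod>i=1..<j. ?p N i) * (lin j (N j) * inv_qfac fps_X (int (N j) - int m) * fps_X ^ (m\<^sup>2)) * level (Suc j) m))"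
  proof (rule sum.reindex_bij_betw[OF bij_betw_tuples_Suc, symmetric, THEN trans])
    show "1 \<le> j" by fact
    show "(\<Sum>x\<in>(SIGMA N:tuples j n. {..N j}). (\<Prod>i=1..<Suc j. ?p ((\<lambda>(N, m). N(Suc j := m)) x) i) * level (Suc j) (((\<lambda>(N, m). N(Suc j := m)) x) (Suc j)))
      = (\<Sum>x\<in>(SIGMA N:tuples j n. {..N j}). (case x of (N, m) \<Rightarrow> (\<Prod>i=1..<j. ?p N i) * (lin j (N j) * inv_qfac fps_X (int (N j) - int m) * fps_X ^ (m\<^sup>2)) * level (Suc j) m))"
    proof (rule sum.cong[OF refl])
      fix x assume "x \<in> (SIGMA N:tuples j n. {..N j})"
      obtain N m where x: "x = (N, m)" by (cases x)
      have "(\<Prod>i=1..<j. ?p (N(Suc j := m)) i) = (\<Prod>i=1..<j. ?p N i)"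
        by (rule prod.cong) auto
      then show "(\<Prod>i=1..<Suc j. ?p ((\<lambda>(N, m). N(Suc j := m)) x) i) * level (Suc j) (((\<lambda>(N, m). N(Suc j := m)) x) (Suc j))
        = (case x of (N, m) \<Rightarrow> (\<Prod>i=1..<j. ?p N i) * (lin j (N j) * inv_qfac fps_X (int (N j) - int m) * fps_X ^ (m\<^sup>2)) * level (Suc j) m)"
        using step(1) by (simp add: x)
    qed
  qed
  also have "\<dots> = (\<Sum>N\<in>tuples j n. \<Sum>m\<le>N j. (\<Prod>i=1..<j. ?p N i) * (lin j (N j) * inv_qfac fps_X (int (N j) - int m) * fps_X ^ (m\<^sup>2)) * level (Suc j) m)"
    using finite_tuples[OF step(1)] by (subst sum.Sigma[symmetric]) auto
  also have "\<dots> = (\<Sum>N\<in>tuples j n. (\<Prod>i=1..<j. ?p N i) * level j (N j))"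
  proof (rule sum.cong[OF refl])
    fix N assume "N \<in> tuples j n"
    have "j < k - 1" using step by simp
    show "(\<Sum>m\<le>N j. (\<Prod>i=1..<j. ?p N i) * (lin j (N j) * inv_qfac fps_X (int (N j) - int m) * fps_X ^ (m\<^sup>2)) * level (Suc j) m) = (\<Prod>i=1..<j. ?p N i) * level j (N j)"
      unfolding level_step[OF step(1) \<open>j < k - 1\<close>] sum_distrib_left by (rule sum.cong[OF refl]) (simp only: mult_ac)
  qed
  finally show ?case using step by simp
qed

definition summand :: "(nat \<Rightarrow> nat) \<Rightarrow> real fps" where
  "summand N = fps_X ^ ((N 1 + 1) * N 1 div 2 + (\<Sum>i=2..k-1. (N i)\<^sup>2) + (\<Sum>i=a+1..k-1. N i))
           * qpoch (- fps_X) fps_X (int (N 1) - 1) * (1 + fps_X ^ N a)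
           / ((\<Prod>i=1..k-2. qpoch fps_X fps_X (int (N i) - int (N (i + 1))))
               * qpoch (fps_X ^ 2) (fps_X ^ 2) (int (N (k - 1))))"

private lemma prod_lin:
  "(\<Prod>i=1..k - 1. lin i (N i)) = fps_X ^ (\<Sum>i=a+1..k-1. N i) * (1 + fps_X ^ N a)"
proof -
  have "(\<Prod>i=1..k - 1. lin i (N i)) = (\<Prod>i=1..k - 1. (if a < i then fps_X ^ N i else 1) * (if i = a then 1 + fps_X ^ N i else 1))"
    by (rule prod.cong) (auto simp: lin_def)
  also have "\<dots> = (\<Prod>i=1..k - 1. if a < i then fps_X ^ N i else 1) * (1 + fps_X ^ N a)"
    using a_ge a_le by (simp add: prod.distrib)
  also have "(\<Prod>i=1..k - 1. if a < i then fps_X ^ N i else 1) = (\<Prod>i=a + 1..k - 1. if a < i then fps_X ^ N i else 1)"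
    by (rule prod.mono_neutral_right) auto
  also have "\<dots> = (\<Prod>i=a + 1..k - 1. fps_X ^ N i)"
    by (rule prod.cong) auto
  finally show ?thesis by (simp only: power_sum)
qed

private lemma summand_eq:
  assumes "N \<in> decreasing_tuples (k - 1)"
  shows "summand N = first_factor (N 1) * ((\<Prod>i=1..<k - 1. lin i (N i) * inv_qfac fps_X (int (N i) - int (N (i + 1))) * fps_X ^ ((N (i + 1))\<^sup>2)) * level (k - 1) (N (k - 1)))"
proof -
  let ?X = "fps_X :: real fps"
  let ?I = "{1..<k - 1}"
  have I: "{1..k - 2} = ?I" "{2..k - 1} = {Suc 1..<Suc (k - 1)}" using a_ge a_le by auto
  have dec: "int (N i) - int (N (i + 1)) = int (N i - N (i + 1))" if "i \<in> ?I" for i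
    using assms that by (auto simp: decreasing_tuples_def of_nat_diff)
  let ?D = "(\<Prod>i\<in>?I. qpoch ?X ?X (int (N i) - int (N (i + 1)))) * qpoch (?X ^ 2) (?X ^ 2) (int (N (k - 1)))"
  let ?R = "(\<Prod>i\<in>?I. inv_qfac ?X (int (N i) - int (N (i + 1)))) * inv_qfac (?X ^ 2) (int (N (k - 1)))"
  have "inv_qfac ?X (int (N i) - int (N (i + 1))) * qpoch ?X ?X (int (N i) - int (N (i + 1))) = 1" if "i \<in> ?I" for i
    unfolding dec[OF that] qpoch_X by (rule inv_qfac_mult_qfac[OF fps_X_nth_0])
  then have "(\<Prod>i\<in>?I. inv_qfac ?X (int (N i) - int (N (i + 1)))) * (\<Prod>i\<in>?I. qpoch ?X ?X (int (N i) - int (N (i + 1)))) = 1" (is "?R1 * ?D1 = 1")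
    unfolding prod.distrib[symmetric] by (intro prod.neutral) blast
  moreover have "inv_qfac (?X ^ 2) (int (N (k - 1))) * qpoch (?X ^ 2) (?X ^ 2) (int (N (k - 1))) = 1" (is "?R2 * ?D2 = 1")
    unfolding qpoch_X_power by (rule inv_qfac_mult_qfac) (simp add: fps_nth_power_0)
  moreover have "?R * ?D = (?R1 * ?D1) * (?R2 * ?D2)" by (simp only: mult_ac)
  ultimately have RD: "?R * ?D = 1" by (simp only: mult_1_right)
  have "f / ?D = f * ?R" for f
    using RD by (rule divide_eq_mult_inverse)
  then have 1: "summand N = ?X ^ ((N 1 + 1) * N 1 div 2 + (\<Sum>i=2..k-1. (N i)\<^sup>2) + (\<Sum>i=a+1..k-1. N i))
           * qpoch (- fps_X) fps_X (int (N 1) - 1) * (1 + fps_X ^ N a) * ?R"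
    unfolding summand_def I(1) by simp
  have "(N 1 + 1) * N 1 div 2 = tri (N 1)" by (simp add: tri_def mult.commute)
  moreover have "?X ^ (\<Sum>i=2..k-1. (N i)\<^sup>2) = (\<Prod>i\<in>?I. ?X ^ ((N (i + 1))\<^sup>2))"
    unfolding I(2) sum.shift_bounds_Suc_ivl power_sum by simp
  ultimately have 2: "summand N = (?X ^ tri (N 1) * qpoch (- fps_X) fps_X (int (N 1) - 1)) * (\<Prod>i\<in>?I. ?X ^ ((N (i + 1))\<^sup>2))
      * (\<Prod>i=1..k - 1. lin i (N i)) * ?R"
    unfolding 1 power_add prod_lin by (simp only: mult_ac)
  have "{1..k - 1} = insert (k - 1) ?I" using a_ge a_le by auto
  then have 3: "(\<Prod>i=1..k - 1. lin i (N i)) = lin (k - 1) (N (k - 1)) * (\<Prod>i\<in>?I. lin i (N i))"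
    by simp
  show ?thesis
    unfolding 2 3 level_last prod.distrib first_factor_def qpoch_minus_X by (simp only: mult_ac)
qed

lemma summand_has_sum:
  assumes "\<And>L. eq_upto L s (\<Sum>n<L. first_factor n * (bailey_sum (int k - 1) n (int k - int a - 1) + bailey_sum (int k - 1) n (int k - int a)))"
  shows "(summand has_sum s) (decreasing_tuples (k - 1))"
proof (rule has_sum_fpsI[where d = "\<lambda>N. N 1"])
  fix L
  have k: "1 \<le> k - 1" using a_ge a_le by simp
  have un: "{N \<in> decreasing_tuples (k - 1). N 1 < L} = (\<Union>n<L. tuples (k - 1) n)"
    by (auto simp: tuples_def)
  show "finite {N \<in> decreasing_tuples (k - 1). N 1 < L}"
    unfolding un using finite_tuples[OF k] by blast
  show "eq_upto L (summand N) 0" if "N \<in> decreasing_tuples (k - 1)" "L \<le> N 1" for N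
    unfolding summand_eq[OF that(1)] first_factor_def mult.assoc
    using that(2) le_tri[of "N 1"] by (intro eq_upto_X_power) simp
  have "(\<Sum>N | N \<in> decreasing_tuples (k - 1) \<and> N 1 < L. summand N) = (\<Sum>n<L. \<Sum>N\<in>tuples (k - 1) n. summand N)"
    unfolding un using finite_tuples[OF k] by (intro sum.UNION_disjoint) (auto simp: tuples_def)
  also have "\<dots> = (\<Sum>n<L. first_factor n * level 1 n)"
  proof (rule sum.cong[OF refl])
    fix n
    have "(\<Sum>N\<in>tuples (k - 1) n. summand N) = (\<Sum>N\<in>tuples (k - 1) n. first_factor n * ((\<Prod>i=1..<k - 1. lin i (N i) * inv_qfac fps_X (int (N i) - int (N (i + 1))) * fps_X ^ ((N (i + 1))\<^sup>2)) * level (k - 1) (N (k - 1))))"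
      by (rule sum.cong) (auto simp: summand_eq tuples_def)
    also have "\<dots> = first_factor n * level 1 n"
      using tuple_sum[OF k order_refl, of n] by (simp only: sum_distrib_left[symmetric])
    finally show "(\<Sum>N\<in>tuples (k - 1) n. summand N) = first_factor n * level 1 n" .
  qed
  also have "\<dots> = (\<Sum>n<L. first_factor n * (bailey_sum (int k - 1) n (int k - int a - 1) + bailey_sum (int k - 1) n (int k - int a)))"
    using a_ge by (simp add: level_def)
  finally show "eq_upto L (\<Sum>N | N \<in> decreasing_tuples (k - 1) \<and> N 1 < L. summand N) s"
    using eq_upto_sym[OF assms[of L]] by simp
qed

end

section \<open>The q-difference system for overpartitions\<close>

context
  fixes k :: nat
  assumes k_ge: "2 \<le> k"
begin

private lemma minus_diff_add: "- b - z + a = a - b - (z :: real fps)"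
  by simp

text \<open>The part of the exponents shared by p and q for all i. Subtracting k n leaves only
  natural numbers to be added back: (k-i) n for p, k n for q.\<close>

private definition T :: "nat \<Rightarrow> nat" where
  "T n = (2 * k - 1) * tri n - k * n"

private lemma T_eq: "T n + k * n = (2 * k - 1) * tri n"
proof -
  have "k * n \<le> (2 * k - 1) * tri n" using k_ge le_tri[of n] by (intro mult_mono) auto
  then show ?thesis by (simp add: T_def)
qed

private lemma T_0: "T 0 = 0"
  by (simp add: T_def)

private lemma T_Suc: "T (Suc n) = T n + (2 * k - 1) * n + (k - 1)"
proof -
  have "T (Suc n) + k * Suc n = T n + k * n + (2 * k - 1) * Suc n"
    by (simp only: T_eq tri_Suc distrib_left)
  also have "\<dots> = T n + (2 * k - 1) * n + (k - 1) + k * Suc n"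
  proof -
    have "(2 * k - 1) * Suc n = (2 * k - 1) * n + (k - 1) + k" using k_ge by simp
    then show ?thesis by simp
  qed
  finally have "T (Suc n) + k * Suc n = T n + (2 * k - 1) * n + (k - 1) + k * Suc n" .
  then show ?thesis by (simp only: add_right_cancel)
qed

private lemma le_T: "n \<le> T n"
proof -
  have "(k + 1) * n \<le> (2 * k - 1) * tri n" using k_ge le_tri[of n] by (intro mult_mono) auto
  then show ?thesis using T_eq[of n] by (simp add: algebra_simps)
qed

text \<open>At \<open>x = q^m\<close> the quotient \<open>(q)_inf / (x q^(n+1))_inf\<close> is the
  finite \<open>(q)_(m+n)\<close>, so no infinite product enters.\<close>

private definition W :: "nat \<Rightarrow> nat \<Rightarrow> real fps" where
  "W n m = parity_sign (int n) * qfac fps_X (m + n) * inv_qfac fps_X (int n)"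

private lemma W_Suc_right: "W n (Suc m) = (1 - fps_X ^ Suc (m + n)) * W n m"
  by (simp add: W_def qfac_def mult_ac)

private lemma W_Suc_left: "(1 - fps_X ^ Suc n) * W (Suc n) m = - W n (Suc m)"
proof -
  have "(1 - fps_X ^ Suc n) * W (Suc n) m = parity_sign (int n + 1) * qfac fps_X (m + Suc n) * ((1 - fps_X ^ Suc n) * inv_qfac fps_X (int (Suc n)))"
    by (simp add: W_def mult_ac add.commute)
  then show ?thesis unfolding inv_qfac_Suc[OF fps_X_nth_0] parity_sign_plus_1 by (simp add: W_def)
qed

text \<open>
  The solution of the q-difference system is
  \<open>(-xq)\<^sub>\<infinity> \<Sum>\<^sub>n (-1)\<^sup>n x\<^bsup>(k-1)n\<^esup> q\<^bsup>(2k-1)n(n+1)/2-in\<^esup> (1 - x\<^sup>i q\<^bsup>(2n+1)i\<^esup>) / ((q)\<^sub>n (xq\<^bsup>n+1\<^esup>)\<^sub>\<infinity>)\<close>.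
  At \<open>x = q\<^sup>m\<close>, multiplied by \<open>(-q)\<^sub>m (q)\<^sub>\<infinity>/(-q)\<^sub>\<infinity>\<close>, its summand is \<open>p i n m - q i n m\<close>.
\<close>

private definition p :: "nat \<Rightarrow> nat \<Rightarrow> nat \<Rightarrow> real fps" where
  "p i n m = fps_X ^ (m * (k - 1) * n + T n + (k - i) * n) * W n m"

private definition q :: "nat \<Rightarrow> nat \<Rightarrow> nat \<Rightarrow> real fps" where
  "q i n m = fps_X ^ (m * (k - 1) * n + T n + k * n + i * Suc (m + n)) * W n m"

text \<open>\<open>1 - z^2 = (1-z)(1+z)\<close> with \<open>z = X^(m+n+1)\<close>: the first factor
  raises m in \<open>W\<close>, the second yields the two terms on the right. Differences of q-terms
  become p-terms at the same n.\<close>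

private lemma step_q:
  assumes "i + 2 \<le> k"
  shows "q i n m - q (i + 2) n m = fps_X ^ (i * Suc m) * (p (k - i - 1) n (Suc m) + fps_X ^ Suc m * p (k - i - 2) n (Suc m))"
proof -
  obtain l where k: "k = Suc (Suc (i + l))" using assms by (metis add.commute add_2_eq_Suc' le_Suc_ex add_Suc)
  let ?c = "m * (k - 1) * n + T n + k * n + i * Suc (m + n)"
  have "q i n m - q (i + 2) n m = fps_X ^ ?c * (1 - fps_X ^ Suc (m + n) * fps_X ^ Suc (m + n)) * W n m"
    unfolding q_def by (simp add: algebra_simps power_add)
  also have "\<dots> = fps_X ^ ?c * (1 + fps_X ^ Suc (m + n)) * W n (Suc m)"
    unfolding W_Suc_right by (simp add: algebra_simps)
  also have "\<dots> = fps_X ^ ?c * W n (Suc m) + fps_X ^ (?c + Suc (m + n)) * W n (Suc m)"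
    by (simp only: ring_distribs power_add mult_1 mult_1_right mult_ac)
  also have "fps_X ^ ?c * W n (Suc m) = fps_X ^ (i * Suc m) * p (k - i - 1) n (Suc m)"
  proof -
    have "?c = i * Suc m + (Suc m * (k - 1) * n + T n + (k - (k - i - 1)) * n)" unfolding k by (simp add: algebra_simps)
    then show ?thesis unfolding p_def by (simp only: power_add mult_ac)
  qed
  also have "fps_X ^ (?c + Suc (m + n)) * W n (Suc m) = fps_X ^ (i * Suc m) * (fps_X ^ Suc m * p (k - i - 2) n (Suc m))"
  proof -
    have "?c + Suc (m + n) = i * Suc m + (Suc m + (Suc m * (k - 1) * n + T n + (k - (k - i - 2)) * n))" unfolding k by (simp add: algebra_simps)
    then show ?thesis unfolding p_def by (simp only: power_add mult_ac)
  qed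
  finally show ?thesis by (simp only: ring_distribs)
qed

text \<open>The same factorization with \<open>z = X^(n+1)\<close>: now \<open>1 - z\<close> lowers
  n and raises m in \<open>W\<close>, so p-terms at n+1 become q-terms at n.\<close>

private lemma step_p:
  assumes "i + 2 \<le> k"
  shows "p (i + 2) (Suc n) m - p i (Suc n) m = - (fps_X ^ (i * Suc m) * (q (k - i - 1) n (Suc m) + fps_X ^ Suc m * q (k - i - 2) n (Suc m)))"
proof -
  obtain l where k: "k = Suc (Suc (i + l))" using assms by (metis add.commute add_2_eq_Suc' le_Suc_ex add_Suc)
  let ?c = "m * (k - 1) * Suc n + T (Suc n) + l * Suc n"
  have "p (i + 2) (Suc n) m - p i (Suc n) m = fps_X ^ ?c * (1 - fps_X ^ Suc n * fps_X ^ Suc n) * W (Suc n) m"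
    unfolding p_def unfolding k by (simp add: algebra_simps power_add)
  also have "\<dots> = fps_X ^ ?c * (1 + fps_X ^ Suc n) * ((1 - fps_X ^ Suc n) * W (Suc n) m)"
    by (simp add: algebra_simps)
  also have "\<dots> = - (fps_X ^ (?c + Suc n) * W n (Suc m) + fps_X ^ ?c * W n (Suc m))"
    unfolding W_Suc_left by (simp add: algebra_simps power_add)
  also have "fps_X ^ (?c + Suc n) * W n (Suc m) = fps_X ^ (i * Suc m) * q (k - i - 1) n (Suc m)"
  proof -
    have "?c + Suc n = i * Suc m + (Suc m * (k - 1) * n + T n + k * n + (k - i - 1) * Suc (Suc m + n))"
      unfolding T_Suc unfolding k by (simp add: algebra_simps)
    then show ?thesis unfolding q_def by (simp only: power_add mult_ac)
  qed
  also have "fps_X ^ ?c * W n (Suc m) = fps_X ^ (i * Suc m) * (fps_X ^ Suc m * q (k - i - 2) n (Suc m))"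
  proof -
    have "?c = i * Suc m + (Suc m + (Suc m * (k - 1) * n + T n + k * n + (k - i - 2) * Suc (Suc m + n)))"
      unfolding T_Suc unfolding k by (simp add: algebra_simps)
    then show ?thesis unfolding q_def by (simp only: power_add mult_ac)
  qed
  finally show ?thesis by (simp only: ring_distribs)
qed

private lemma step_q_1:
  "p 1 n m - fps_X ^ Suc m * q 1 n m = p k n (Suc m) + fps_X ^ Suc m * p (k - 1) n (Suc m)"
proof -
  let ?c = "m * (k - 1) * n + T n + (k - 1) * n"
  have e: "Suc m + (m * (k - 1) * n + T n + k * n + 1 * Suc (m + n)) = ?c + Suc (m + n) + Suc (m + n)"
    using k_ge by (cases k) (simp_all add: algebra_simps)
  have "p 1 n m - fps_X ^ Suc m * q 1 n m = fps_X ^ ?c * (1 - fps_X ^ Suc (m + n) * fps_X ^ Suc (m + n)) * W n m"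
    unfolding p_def q_def mult.assoc[symmetric] power_add[symmetric] e by (simp add: algebra_simps power_add)
  also have "\<dots> = fps_X ^ ?c * (1 + fps_X ^ Suc (m + n)) * W n (Suc m)"
    unfolding W_Suc_right by (simp add: algebra_simps)
  also have "\<dots> = fps_X ^ ?c * W n (Suc m) + fps_X ^ (?c + Suc (m + n)) * W n (Suc m)"
    by (simp only: ring_distribs power_add mult_1 mult_1_right mult_ac)
  also have "fps_X ^ ?c * W n (Suc m) = p k n (Suc m)"
    unfolding p_def by (simp add: add_mult_distrib add.commute add.left_commute)
  also have "fps_X ^ (?c + Suc (m + n)) * W n (Suc m) = fps_X ^ Suc m * p (k - 1) n (Suc m)"
  proof -
    have "?c + Suc (m + n) = Suc m + (Suc m * (k - 1) * n + T n + (k - (k - 1)) * n)"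
    proof -
      have "k - (k - 1) = 1" using k_ge by simp
      then show ?thesis by (simp only: mult_Suc add_mult_distrib mult_1 add_Suc_right add_Suc add_ac)
    qed
    then show ?thesis unfolding p_def by (simp only: power_add mult_ac)
  qed
  finally show ?thesis .
qed

private lemma step_p_1:
  "fps_X ^ Suc m * p 1 (Suc n) m - q 1 (Suc n) m = - (q k n (Suc m) + fps_X ^ Suc m * q (k - 1) n (Suc m))"
proof -
  obtain l where k: "k = Suc l" using k_ge by (cases k) auto
  let ?c = "Suc m + (m * (k - 1) * Suc n + T (Suc n) + (k - 1) * Suc n)"
  have e: "m * (k - 1) * Suc n + T (Suc n) + k * Suc n + 1 * Suc (m + Suc n) = ?c + Suc n + Suc n"
    using k by (simp add: algebra_simps)
  have "fps_X ^ Suc m * p 1 (Suc n) m - q 1 (Suc n) m = fps_X ^ ?c * (1 - fps_X ^ Suc n * fps_X ^ Suc n) * W (Suc n) m"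
    unfolding p_def q_def mult.assoc[symmetric] power_add[symmetric] e by (simp add: algebra_simps power_add)
  also have "\<dots> = fps_X ^ ?c * (1 + fps_X ^ Suc n) * ((1 - fps_X ^ Suc n) * W (Suc n) m)"
    by (simp add: algebra_simps)
  also have "\<dots> = - (fps_X ^ (?c + Suc n) * W n (Suc m) + fps_X ^ ?c * W n (Suc m))"
    unfolding W_Suc_left by (simp add: algebra_simps power_add)
  also have "fps_X ^ (?c + Suc n) * W n (Suc m) = q k n (Suc m)"
  proof -
    have "?c + Suc n = Suc m * (k - 1) * n + T n + k * n + k * Suc (Suc m + n)"
      unfolding T_Suc unfolding k by (simp add: algebra_simps)
    then show ?thesis unfolding q_def by (simp only:)
  qed
  also have "fps_X ^ ?c * W n (Suc m) = fps_X ^ Suc m * q (k - 1) n (Suc m)"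
  proof -
    have "?c = Suc m + (Suc m * (k - 1) * n + T n + k * n + (k - 1) * Suc (Suc m + n))"
      unfolding T_Suc unfolding k by (simp add: algebra_simps)
    then show ?thesis unfolding q_def by (simp only: power_add mult_ac)
  qed
  finally show ?thesis .
qed

private definition E :: "nat \<Rightarrow> nat \<Rightarrow> nat \<Rightarrow> real fps" where
  "E L i m = (\<Sum>n<L. p i n m - q i n m)"

private lemma p_eq_upto_0: "L \<le> n \<Longrightarrow> eq_upto L (p i n m) 0"
  unfolding p_def using le_T[of n] by (intro eq_upto_X_power) simp

private lemma E_0: "E L 0 m = 0"
  by (simp add: E_def p_def q_def)

text \<open>\<open>step_q\<close> at n is added to \<open>step_p\<close>, which lowers n+1 to n. The
  shift leaves two ends: the p-terms at n = 0 cancel since they do not depend on i, and those at n =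
  L vanish modulo \<open>X^L\<close>.\<close>

private lemma E_step:
  assumes "i + 2 \<le> k"
  shows "eq_upto L (E L (i + 2) m) (E L i m + fps_X ^ (i * Suc m) * (E L (k - i - 1) (Suc m) + fps_X ^ Suc m * E L (k - i - 2) (Suc m)))"
proof -
  let ?a = "\<lambda>n. fps_X ^ (i * Suc m) * (p (k - i - 1) n (Suc m) + fps_X ^ Suc m * p (k - i - 2) n (Suc m))"
  let ?b = "\<lambda>n. fps_X ^ (i * Suc m) * (q (k - i - 1) n (Suc m) + fps_X ^ Suc m * q (k - i - 2) n (Suc m))"
  have rhs: "fps_X ^ (i * Suc m) * (E L (k - i - 1) (Suc m) + fps_X ^ Suc m * E L (k - i - 2) (Suc m)) = (\<Sum>n<L. ?a n - ?b n)"
    unfolding E_def sum_distrib_left sum.distrib[symmetric] by (rule sum.cong[OF refl]) (simp only: ring_distribs, simp)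
  have "(\<Sum>n<L. p (i + 2) n m - p i n m) + (p (i + 2) L m - p i L m) = (\<Sum>n<Suc L. p (i + 2) n m - p i n m)"
    by simp
  also have "\<dots> = (p (i + 2) 0 m - p i 0 m) + (\<Sum>n<L. p (i + 2) (Suc n) m - p i (Suc n) m)"
    by (rule sum.lessThan_Suc_shift)
  also have "\<dots> = (\<Sum>n<L. - ?b n)"
    unfolding step_p[OF assms] by (simp add: p_def)
  finally have shifted: "(\<Sum>n<L. p (i + 2) n m - p i n m) = (\<Sum>n<L. - ?b n) - (p (i + 2) L m - p i L m)"
    by (simp only: eq_diff_eq)
  have "E L (i + 2) m - E L i m = (\<Sum>n<L. (p (i + 2) n m - p i n m) + (q i n m - q (i + 2) n m))"
    unfolding E_def sum_subtractf[symmetric] by (rule sum.cong[OF refl]) simp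
  also have "\<dots> = (\<Sum>n<L. - ?b n) - (p (i + 2) L m - p i L m) + (\<Sum>n<L. ?a n)"
    unfolding sum.distrib shifted step_q[OF assms] ..
  also have "\<dots> = (\<Sum>n<L. ?a n - ?b n) - (p (i + 2) L m - p i L m)"
    unfolding sum_subtractf sum_negf by (rule minus_diff_add)
  finally have "E L (i + 2) m = E L i m + (\<Sum>n<L. ?a n - ?b n) - (p (i + 2) L m - p i L m)"
    by (simp add: algebra_simps)
  moreover have "eq_upto L (E L i m + (\<Sum>n<L. ?a n - ?b n) - (p (i + 2) L m - p i L m)) (E L i m + (\<Sum>n<L. ?a n - ?b n) - (0 - 0))"
    by (intro eq_upto_diff eq_upto_refl p_eq_upto_0) auto
  ultimately show ?thesis unfolding rhs by simp
qed

text \<open>Regrouping \<open>(1+x)(p-q) = (xp - q) + (p - xq)\<close> with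
  \<open>x = X^(m+1)\<close> produces the combinations treated in \<open>step_p_1\<close> and
  \<open>step_q_1\<close>.\<close>

private lemma E_1:
  "eq_upto L ((1 + fps_X ^ Suc m) * E L 1 m) (E L k (Suc m) + fps_X ^ Suc m * E L (k - 1) (Suc m))"
proof -
  let ?x = "fps_X ^ Suc m :: real fps"
  let ?a = "\<lambda>n. p k n (Suc m) + ?x * p (k - 1) n (Suc m)"
  let ?b = "\<lambda>n. q k n (Suc m) + ?x * q (k - 1) n (Suc m)"
  have rhs: "E L k (Suc m) + ?x * E L (k - 1) (Suc m) = (\<Sum>n<L. ?a n - ?b n)"
    unfolding E_def sum_distrib_left sum.distrib[symmetric] by (rule sum.cong[OF refl]) (simp only: ring_distribs, simp)
  have q1: "q 1 L m = ?x * (fps_X ^ L * (fps_X ^ L * p 1 L m))"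
  proof -
    have "m * (k - 1) * L + T L + k * L + 1 * Suc (m + L) = Suc m + (L + (L + (m * (k - 1) * L + T L + (k - 1) * L)))"
      using k_ge by (cases k) (simp_all add: algebra_simps)
    then show ?thesis unfolding q_def p_def by (simp only: power_add mult_ac)
  qed
  have zero: "?x * p 1 0 m - q 1 0 m = 0" by (simp add: p_def q_def T_0)
  have "(\<Sum>n<L. ?x * p 1 n m - q 1 n m) + (?x * p 1 L m - q 1 L m) = (\<Sum>n<Suc L. ?x * p 1 n m - q 1 n m)"
    by simp
  also have "\<dots> = (?x * p 1 0 m - q 1 0 m) + (\<Sum>n<L. ?x * p 1 (Suc n) m - q 1 (Suc n) m)"
    by (rule sum.lessThan_Suc_shift)
  also have "\<dots> = (\<Sum>n<L. - ?b n)"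
    unfolding step_p_1 by (simp only: zero add_0)
  finally have shifted: "(\<Sum>n<L. ?x * p 1 n m - q 1 n m) = (\<Sum>n<L. - ?b n) - (?x * p 1 L m - q 1 L m)"
    by (simp only: eq_diff_eq)
  have "(1 + ?x) * E L 1 m = (\<Sum>n<L. (?x * p 1 n m - q 1 n m) + (p 1 n m - ?x * q 1 n m))"
    unfolding E_def sum_distrib_left by (rule sum.cong[OF refl]) (simp add: algebra_simps)
  also have "\<dots> = (\<Sum>n<L. - ?b n) - (?x * p 1 L m - q 1 L m) + (\<Sum>n<L. ?a n)"
    unfolding sum.distrib shifted step_q_1 ..
  also have "\<dots> = (\<Sum>n<L. ?a n - ?b n) - (?x * p 1 L m - q 1 L m)"
    unfolding sum_subtractf sum_negf by (rule minus_diff_add)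
  finally have "(1 + ?x) * E L 1 m = (\<Sum>n<L. ?a n - ?b n) - (?x * p 1 L m - q 1 L m)" .
  moreover have "eq_upto L ((\<Sum>n<L. ?a n - ?b n) - (?x * p 1 L m - q 1 L m)) ((\<Sum>n<L. ?a n - ?b n) - (?x * 0 - ?x * (fps_X ^ L * (fps_X ^ L * 0))))"
    unfolding q1 by (intro eq_upto_diff eq_upto_mult eq_upto_refl p_eq_upto_0) auto
  ultimately show ?thesis unfolding rhs by simp
qed

private lemma E_limit:
  assumes "L \<le> m" "1 \<le> i"
  shows "eq_upto L (plus_qfac L * inv_qfac fps_X (int L) * E L i m) (plus_qfac m)"
proof (cases "L = 0")
  case True
  then show ?thesis by (simp add: eq_upto_def)
next
  case False
  have "eq_upto L (E L i m) (\<Sum>n<L. if n = 0 then qfac fps_X m else 0)"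
    unfolding E_def
  proof (rule eq_upto_sum)
    fix n
    show "eq_upto L (p i n m - q i n m) (if n = 0 then qfac fps_X m else 0)"
    proof (cases "n = 0")
      case True
      have "L \<le> i * Suc m" using assms by (cases i) auto
      then have "eq_upto L (qfac fps_X m - fps_X ^ (i * Suc m) * qfac fps_X m) (qfac fps_X m - 0)"
        by (intro eq_upto_diff eq_upto_refl eq_upto_X_power)
      then show ?thesis using True by (simp add: p_def q_def T_0 W_def parity_sign_def)
    next
      case False
      have "1 \<le> (k - 1) * n" using False k_ge by (simp add: Suc_le_eq)
      then have "m * 1 \<le> m * ((k - 1) * n)" by (rule mult_le_mono2)
      then have "L \<le> m * (k - 1) * n" using assms(1) by (metis le_trans mult.assoc mult.right_neutral)
      then have "eq_upto L (p i n m - q i n m) (0 - 0)"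
        unfolding p_def q_def by (intro eq_upto_diff eq_upto_X_power) auto
      then show ?thesis using False by simp
    qed
  qed
  also have "(\<Sum>n<L. if n = 0 then qfac fps_X m else 0) = qfac fps_X m"
    using False sum.delta[of "{..<L}" 0 "\<lambda>_. qfac fps_X m"] by simp
  finally have "eq_upto L (plus_qfac L * inv_qfac fps_X (int L) * E L i m) (plus_qfac L * inv_qfac fps_X (int L) * qfac fps_X L)"
    using qfac_eq_upto[of 1 L m] assms(1) by (intro eq_upto_mult eq_upto_refl) (auto intro: eq_upto_trans)
  also have "plus_qfac L * inv_qfac fps_X (int L) * qfac fps_X L = plus_qfac L"
    by (simp add: mult.assoc inv_qfac_mult_qfac)
  also have "eq_upto L (plus_qfac L) (plus_qfac m)" by (rule eq_upto_sym[OF plus_qfac_eq_upto[OF assms(1)]])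
  finally show ?thesis .
qed

text \<open>At m = 0 the weight \<open>W\<close> is a sign; p-terms are the theta terms with r = -n,
  q-terms those with r = n+1. The surplus term r = L vanishes modulo \<open>X^L\<close>.\<close>

private lemma E_theta:
  assumes "1 \<le> i" "i < k"
  shows "eq_upto L (E L i 0) (theta (2 * k - 1) i L)"
proof (cases "L = 0")
  case True
  then show ?thesis by (simp add: eq_upto_def)
next
  case False
  let ?M = "2 * k - 1"
  let ?t = "\<lambda>r. parity_sign r * fps_X ^ nat (theta_exp ?M i r) :: real fps"
  have Wn: "W n 0 = parity_sign (int n)" for n
    using inv_qfac_mult_qfac[OF fps_X_nth_0, of n] by (simp add: W_def mult_ac)
  have tri: "int (tri n) = int n * (int n + 1) div 2" for n
    by (simp add: tri_def zdiv_int algebra_simps)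
  have p0: "p i n 0 = ?t (- int n)" for n
  proof -
    have "T n + (k - i) * n + i * n = ?M * tri n"
    proof -
      have "(k - i) * n + i * n = k * n" using assms by (simp flip: add_mult_distrib)
      then show ?thesis by (simp only: add.assoc T_eq)
    qed
    then have "int (T n + (k - i) * n) + int i * int n = int ?M * int (tri n)"
      by (simp only: of_nat_mult[symmetric] of_nat_add[symmetric])
    then have "theta_exp ?M i (- int n) = int (T n + (k - i) * n)"
      unfolding theta_exp_def tri by (simp add: algebra_simps)
    then have "nat (theta_exp ?M i (- int n)) = T n + (k - i) * n" by (simp only: nat_int)
    then show ?thesis by (simp only: p_def Wn parity_sign_minus mult_0 add_0 mult.commute)
  qed
  have q0: "q i n 0 = - ?t (int (Suc n))" for n
  proof -
    have "theta_exp ?M i (int (Suc n)) = int ?M * int (tri n) + int i * int (Suc n)"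
      unfolding theta_exp_def tri by (simp add: algebra_simps)
    also have "\<dots> = int (T n + k * n + i * Suc n)"
      unfolding T_eq by (simp only: of_nat_add of_nat_mult)
    finally have "nat (theta_exp ?M i (int (Suc n))) = T n + k * n + i * Suc n" by (simp only: nat_int)
    moreover have "parity_sign (int (Suc n)) = - parity_sign (int n)" by (simp add: parity_sign_def)
    ultimately show ?thesis by (simp only: q_def Wn mult_0 add_0) (simp add: mult.commute)
  qed
  have "E L i 0 = (\<Sum>n<L. ?t (- int n)) + (\<Sum>n<L. ?t (int (Suc n)))"
    unfolding E_def p0 q0 by (simp add: sum.distrib)
  also have "(\<Sum>n<L. ?t (int (Suc n))) = (\<Sum>n<L - 1. ?t (int (Suc n))) + ?t (int L)"
    using False by (cases L) simp_all
  also have "(\<Sum>n<L. ?t (- int n)) = (\<Sum>r=1 - int L..0. ?t r)"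
    by (rule sum.reindex_bij_witness[of _ "\<lambda>r. nat (- r)" "\<lambda>n. - int n"]) auto
  also have "(\<Sum>n<L - 1. ?t (int (Suc n))) = (\<Sum>r=1..int L - 1. ?t r)"
    by (rule sum.reindex_bij_witness[of _ "\<lambda>r. nat (r - 1)" "\<lambda>n. int (Suc n)"]) auto
  finally have "E L i 0 = theta ?M i L + ?t (int L)"
  proof -
    assume "E L i 0 = (\<Sum>r=1 - int L..0. ?t r) + ((\<Sum>r=1..int L - 1. ?t r) + ?t (int L))"
    moreover have "{1 - int L..int L - 1} = {1 - int L..0} \<union> {1..int L - 1}" using False by auto
    then have "theta ?M i L = (\<Sum>r=1 - int L..0. ?t r) + (\<Sum>r=1..int L - 1. ?t r)"
      unfolding theta_def by (simp only:) (rule sum.union_disjoint, auto)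
    ultimately show ?thesis by (simp only: add.assoc)
  qed
  moreover have "eq_upto L (?t (int L)) 0"
  proof -
    have "i < ?M" using assms by linarith
    then have "L \<le> nat (theta_exp ?M i (int L))" using theta_exp_ge_abs[of i ?M "int L"] assms(1) by linarith
    then have "eq_upto L (fps_X ^ nat (theta_exp ?M i (int L)) * parity_sign (int L)) 0" by (rule eq_upto_X_power)
    then show ?thesis by (simp only: mult.commute)
  qed
  then have "eq_upto L (theta ?M i L + ?t (int L)) (theta ?M i L + 0)"
    by (intro eq_upto_add eq_upto_refl)
  ultimately show ?thesis by simp
qed

text \<open>Downward induction on m from L, where \<open>lim\<close> fixes the values; inside, i
  grows in steps of two from 0 and 1. Multiplying d by \<open>plus_qfac m\<close> absorbs the factor
  \<open>1 + X^(m+1)\<close> by which the system of d differs from that of \<open>E\<close>.\<close>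

lemma q_difference_solution:
  assumes d0: "\<And>m. d 0 m = 0"
    and d1: "\<And>m. d 1 m = d k (Suc m) + fps_X ^ Suc m * d (k - 1) (Suc m)"
    and d2: "\<And>i m. i + 2 \<le> k \<Longrightarrow> d (i + 2) m = d i m + (1 + fps_X ^ Suc m) * (fps_X ^ (i * Suc m) * (d (k - i - 1) (Suc m) + fps_X ^ Suc m * d (k - i - 2) (Suc m)))"
    and lim: "\<And>i m. L \<le> m \<Longrightarrow> 1 \<le> i \<Longrightarrow> i \<le> k \<Longrightarrow> eq_upto L (d i m) 1"
    and i: "1 \<le> i" "i < k"
  shows "eq_upto L (d i 0) (plus_qfac L * inv_qfac fps_X (int L) * theta (2 * k - 1) i L)"
proof -
  define C where "C = plus_qfac L * inv_qfac fps_X (int L)"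
  have all: "\<forall>i\<le>k. eq_upto L (plus_qfac m * d i m) (C * E L i m)" if "m \<le> L" for m
    using that
  proof (induction m rule: inc_induct)
    case base
    show ?case
    proof (intro allI impI)
      fix i assume "i \<le> k"
      show "eq_upto L (plus_qfac L * d i L) (C * E L i L)"
      proof (cases "i = 0")
        case False
        then have "eq_upto L (plus_qfac L * d i L) (plus_qfac L * 1)"
          using \<open>i \<le> k\<close> by (intro eq_upto_mult eq_upto_refl lim) auto
        also have "eq_upto L (plus_qfac L * 1) (C * E L i L)"
          using False E_limit[of L L i] by (simp add: C_def eq_upto_sym)
        finally show ?thesis .
      qed (simp add: d0 E_0)
    qed
  next
    case (step m)
    let ?x = "fps_X ^ Suc m :: real fps"
    have IH: "eq_upto L (plus_qfac (Suc m) * d i (Suc m)) (C * E L i (Suc m))" if "i \<le> k" for i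
      using step that by blast
    have pair: "eq_upto L (plus_qfac (Suc m) * (d i (Suc m) + ?x * d j (Suc m))) (C * (E L i (Suc m) + ?x * E L j (Suc m)))"
      if "i \<le> k" "j \<le> k" for i j
    proof -
      have "eq_upto L (plus_qfac (Suc m) * d i (Suc m) + ?x * (plus_qfac (Suc m) * d j (Suc m))) (C * E L i (Suc m) + ?x * (C * E L j (Suc m)))"
        using that by (intro eq_upto_add eq_upto_mult eq_upto_refl IH)
      then show ?thesis by (simp only: ring_distribs mult_ac)
    qed
    have "eq_upto L (plus_qfac m * d i m) (C * E L i m)" if "i \<le> k" for i
      using that
    proof (induction i rule: induct_nat_012)
      case 0
      show ?case by (simp add: d0 E_0)
    next
      case 1
      have "eq_upto L ((1 + ?x) * (plus_qfac m * d 1 m)) ((1 + ?x) * (C * E L 1 m))"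
      proof -
        have "(1 + ?x) * (plus_qfac m * d 1 m) = plus_qfac (Suc m) * (d k (Suc m) + ?x * d (k - 1) (Suc m))"
          unfolding d1[of m] plus_qfac_Suc by (simp only: mult_ac)
        also have "eq_upto L \<dots> (C * (E L k (Suc m) + ?x * E L (k - 1) (Suc m)))"
          by (rule pair) auto
        also have "eq_upto L \<dots> (C * ((1 + ?x) * E L 1 m))"
          by (intro eq_upto_mult eq_upto_refl eq_upto_sym[OF E_1])
        finally show ?thesis by (simp only: mult_ac)
      qed
      then have "eq_upto L (plus_qfac m * d 1 m) (C * E L 1 m)"
        by (rule eq_upto_cancel_unit) simp
      then show ?case by simp
    next
      case (ge2 i)
      then have i: "i + 2 \<le> k" by simp
      let ?y = "fps_X ^ (i * Suc m) :: real fps"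
      have ih: "eq_upto L (plus_qfac m * d i m) (C * E L i m)" using ge2.IH(1) i by simp
      have "plus_qfac m * d (i + 2) m = plus_qfac m * d i m + ?y * (plus_qfac (Suc m) * (d (k - i - 1) (Suc m) + ?x * d (k - i - 2) (Suc m)))"
        unfolding d2[OF i] plus_qfac_Suc by (simp only: distrib_left[of "plus_qfac m" "d i m"] mult_ac)
      also have "eq_upto L \<dots> (C * E L i m + ?y * (C * (E L (k - i - 1) (Suc m) + ?x * E L (k - i - 2) (Suc m))))"
        by (rule eq_upto_add[OF ih eq_upto_mult[OF eq_upto_refl pair]]) (use i in auto)
      also have "\<dots> = C * (E L i m + ?y * (E L (k - i - 1) (Suc m) + ?x * E L (k - i - 2) (Suc m)))"
        by (simp only: distrib_left[of C "E L i m"] mult_ac)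
      also have "eq_upto L \<dots> (C * E L (i + 2) m)"
        by (intro eq_upto_mult eq_upto_refl eq_upto_sym[OF E_step[OF i]])
      finally show ?case by simp
    qed
    then show ?case by blast
  qed
  have "eq_upto L (d i 0) (C * E L i 0)"
    using all[of 0] i by simp
  also have "eq_upto L \<dots> (C * theta (2 * k - 1) i L)"
    by (intro eq_upto_mult eq_upto_refl E_theta i)
  finally show ?thesis by (simp only: C_def)
qed

end

section \<open>Overpartitions\<close>

definition first_overlined :: "(nat \<times> bool) list \<Rightarrow> bool" where
  "first_overlined L \<longleftrightarrow> (\<forall>i<length L. snd (L ! i) \<longrightarrow> (\<forall>j<i. fst (L ! j) \<noteq> fst (L ! i)))"

lemma first_overlined_snoc:
  "first_overlined (L @ [x]) \<longleftrightarrow> first_overlined L \<and> (snd x \<longrightarrow> fst x \<notin> fst ` set L)"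
proof -
  have "first_overlined (L @ [x]) \<longleftrightarrow>
      (\<forall>i<length L. snd (L ! i) \<longrightarrow> (\<forall>j<i. fst (L ! j) \<noteq> fst (L ! i))) \<and> (snd x \<longrightarrow> (\<forall>j<length L. fst (L ! j) \<noteq> fst x))"
    unfolding first_overlined_def by (auto simp: nth_append less_Suc_eq)
  also have "(\<forall>j<length L. fst (L ! j) \<noteq> fst x) \<longleftrightarrow> fst x \<notin> fst ` set L"
    unfolding set_conv_nth image_iff mem_Collect_eq Bex_def by metis
  finally show ?thesis by (simp add: first_overlined_def)
qed

lemma overpartition_alt:
  "overpartition n L \<longleftrightarrow> sorted_wrt (\<ge>) (map fst L) \<and> (\<forall>x\<in>set L. 0 < fst x) \<and> sum_list (map fst L) = n \<and> first_overlined L"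
  by (simp add: overpartition_def first_overlined_def)

lemma finite_overpartitions: "finite {L. overpartition n L}"
proof (rule finite_subset)
  show "{L. overpartition n L} \<subseteq> {L. set L \<subseteq> {..n} \<times> UNIV \<and> length L \<le> n}"
  proof clarify
    fix L assume L: "overpartition n L"
    have "length L \<le> sum_list (map fst L)" if "\<forall>x\<in>set L. 0 < fst x" for L :: "(nat \<times> bool) list"
      using that by (induction L) auto
    moreover have "fst x \<le> n" if "x \<in> set L" for x
      using L that member_le_sum_list[of "fst x" "map fst L"] by (auto simp: overpartition_def)
    ultimately show "set L \<subseteq> {..n} \<times> UNIV \<and> length L \<le> n"
      using L by (fastforce simp: overpartition_def)
  qed
  show "finite {L :: (nat \<times> bool) list. set L \<subseteq> {..n} \<times> UNIV \<and> length L \<le> n}"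
    by (rule finite_lists_length_le) auto
qed

text \<open>The parts of the smallest size stand at the end of a non-increasing list, an overlined
  one first; removing them strips a suffix.\<close>

definition block :: "nat \<Rightarrow> nat \<Rightarrow> nat \<Rightarrow> (nat \<times> bool) list" where
  "block c e t = replicate e (c, True) @ replicate t (c, False)"

lemma block_0_Suc: "block c e (Suc t) = block c e t @ [(c, False)]"
  by (simp add: block_def replicate_append_same)

lemma count_list_replicate: "count_list (replicate n x) y = (if x = y then n else 0)"
  by (induction n) auto

lemma f_plain_block: "f_plain (L @ block c e t) l = f_plain L l + (if l = c then t else 0)"
  by (auto simp: f_plain_def block_def count_list_replicate)

lemma f_over_block: "f_over (L @ block c e t) l = f_over L l + (if l = c then e else 0)"
  by (auto simp: f_over_def block_def count_list_replicate)

lemma V_block: "V (L @ block c e t) l = V L l + (if c \<le> l then e else 0)"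
  by (auto simp: V_def block_def filter_replicate)

lemma f_plain_eq_0: "\<forall>x\<in>set L. c < fst x \<Longrightarrow> l \<le> c \<Longrightarrow> f_plain L l = 0"
  by (auto simp: f_plain_def count_list_0_iff)

lemma f_over_eq_0: "\<forall>x\<in>set L. c < fst x \<Longrightarrow> l \<le> c \<Longrightarrow> f_over L l = 0"
  by (auto simp: f_over_def count_list_0_iff)

lemma V_eq_0: "\<forall>x\<in>set L. c < fst x \<Longrightarrow> l \<le> c \<Longrightarrow> V L l = 0"
  by (force simp: V_def filter_empty_conv)

lemma overpartition_append_block:
  assumes "\<forall>x\<in>set L. c < fst x" "0 < c" "e < 2"
  shows "overpartition n (L @ block c e t) \<longleftrightarrow> c * (t + e) \<le> n \<and> overpartition (n - c * (t + e)) L"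
proof -
  have sorted: "sorted_wrt (\<ge>) (map fst (L @ block c e t)) \<longleftrightarrow> sorted_wrt (\<ge>) (map fst L)"
  proof -
    have "sorted_wrt (\<ge>) (map fst (block c e t))"
      by (auto simp: block_def sorted_wrt_append sorted_wrt_iff_nth_less nth_append)
    then show ?thesis using assms(1) by (force simp: sorted_wrt_append block_def)
  qed
  have "e = 0 \<or> e = 1" using assms(3) by auto
  then have "first_overlined (L @ block c e 0) \<longleftrightarrow> first_overlined L"
    using assms(1) by (auto simp: block_def first_overlined_snoc)
  then have fo: "first_overlined (L @ block c e t) \<longleftrightarrow> first_overlined L"
    by (induction t) (simp_all add: block_0_Suc first_overlined_snoc flip: append_assoc)
  have sum: "sum_list (map fst (L @ block c e t)) = sum_list (map fst L) + c * (t + e)"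
    by (simp add: block_def sum_list_replicate algebra_simps)
  have pos: "(\<forall>x\<in>set (L @ block c e t). 0 < fst x) \<longleftrightarrow> (\<forall>x\<in>set L. 0 < fst x)"
    using assms(1,2) by (auto simp: block_def)
  show ?thesis unfolding overpartition_alt sorted fo sum pos by auto
qed

lemma overpartition_split:
  assumes "sorted_wrt (\<ge>) (map fst L)" "first_overlined L" "\<forall>x\<in>set L. m < fst x"
  shows "\<exists>L' e t. L = L' @ block (Suc m) e t \<and> e < 2 \<and> (\<forall>x\<in>set L'. Suc m < fst x)"
  using assms
proof (induction L rule: rev_induct)
  case Nil
  show ?case by (intro exI[of _ "[]"] exI[of _ 0]) (simp add: block_def)
next
  case (snoc x L)
  have ge: "fst x \<le> fst y" if "y \<in> set L" for y using snoc.prems(1) that by (auto simp: sorted_wrt_append)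
  consider "Suc m < fst x" | "fst x = Suc m" "snd x" | "fst x = Suc m" "\<not> snd x"
    using snoc.prems(3) by force
  then show ?case
  proof cases
    case 1
    have "L @ [x] = (L @ [x]) @ block (Suc m) 0 0" by (simp add: block_def)
    moreover have "\<forall>y\<in>set (L @ [x]). Suc m < fst y" using 1 ge by force
    ultimately show ?thesis by (metis zero_less_numeral)
  next
    case 2
    then have "x = (Suc m, True)" by (cases x) auto
    then have "L @ [x] = L @ block (Suc m) 1 0" by (simp add: block_def)
    moreover have "Suc m < fst y" if "y \<in> set L" for y
    proof -
      have "fst y \<noteq> Suc m" using snoc.prems(2) 2 that by (force simp: first_overlined_snoc)
      moreover have "m < fst y" using snoc.prems(3) that by simp
      ultimately show ?thesis by simp
    qed
    ultimately show ?thesis by (metis one_less_numeral_iff semiring_norm(76))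
  next
    case 3
    then have x: "x = (Suc m, False)" by (cases x) auto
    from snoc obtain L' e t where "L = L' @ block (Suc m) e t" "e < 2" "\<forall>x\<in>set L'. Suc m < fst x"
      by (fastforce simp: sorted_wrt_append first_overlined_snoc)
    then show ?thesis using x by (metis append_assoc block_0_Suc)
  qed
qed

text \<open>The parity is that of condition (iii) for the overpartition obtained by subtracting \<open>m\<close> from every part.\<close>

definition D_set :: "nat \<Rightarrow> nat \<Rightarrow> nat \<Rightarrow> nat \<Rightarrow> (nat \<times> bool) list set" where
  "D_set k i m n = {L. overpartition n L \<and> (\<forall>x\<in>set L. m < fst x) \<and> f_plain L (Suc m) < i \<and>
     (\<forall>l>m. f_plain L l + f_over L l + f_plain L (Suc l) < k) \<and>
     (\<forall>l>m. f_plain L l + f_over L l + f_plain L (Suc l) = k - 1 \<longrightarrow>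
        even (l * f_plain L l + l * f_over L l + Suc l * f_plain L (Suc l) + V L l + i + 1 + m * (k - 1)))}"

lemma finite_D_set: "finite (D_set k i m n)"
  by (rule finite_subset[OF _ finite_overpartitions[of n]]) (auto simp: D_set_def)

lemma D_bar_eq_card:
  assumes "1 \<le> a" "1 \<le> k"
  shows "D_bar k a n = card (D_set k a 0 n)"
proof -
  have cong: "[int x = int v + int a - 1] (mod 2) \<longleftrightarrow> even (x + v + a + 1)" for x v
  proof -
    have "[int x = int v + int a - 1] (mod 2) \<longleftrightarrow> even (int x - (int v + int a - 1))"
      by (simp add: cong_iff_dvd_diff)
    also have "\<dots> \<longleftrightarrow> even (int (x + v + a + 1))" by auto
    finally show ?thesis by (simp only: even_of_nat)
  qed
  have lt: "int f \<le> int c - 1 \<longleftrightarrow> f < c" for f c by linarith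
  have eq: "int f = int k - 1 \<longleftrightarrow> f = k - 1" for f using assms by linarith
  have one: "(\<forall>l\<ge>1. P l) \<longleftrightarrow> (\<forall>l>0. P l)" for P :: "nat \<Rightarrow> bool" by (simp add: Suc_le_eq)
  have pos: "overpartition n L \<Longrightarrow> \<forall>x\<in>set L. 0 < fst x" for L by (simp add: overpartition_def)
  show ?thesis
    unfolding D_bar_def D_set_def cong lt eq one Suc_eq_plus1 mult_0 add_0_right add_0 
    using pos by (intro arg_cong[of _ _ card] Collect_cong) blast
qed

text \<open>The strict bound on the number s of plain parts m+2 after removing t plain and e
  overlined parts m+1. If t+e+s = k-1, the parity in \<open>D_set\<close> at l = m+1 reduces to that
  of t+i+1, as \<open>m (k-1) = m (t+e+s)\<close>; so for t+i even the value k-1 is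
  forbidden.\<close>

definition next_bound :: "nat \<Rightarrow> nat \<Rightarrow> nat \<Rightarrow> nat \<Rightarrow> nat" where
  "next_bound k i e t = k - t - e - (if even (t + i) then 1 else 0)"

lemma parity_shift:
  "even (e + i) = even (j + c) \<Longrightarrow> even (x + (v + e) + i + 1 + A) = even (x + v + j + 1 + (c + A))" for e i j c x v A :: nat
  by presburger

text \<open>\<open>next_bound\<close> does double duty: when positive it is congruent to e+i+k-1
  modulo 2, so it is also the right parity parameter for the remaining parts, whose \<open>V\<close>
  no longer counts the e overlined parts removed.\<close>

lemma append_block_in_D_set:
  assumes "1 \<le> k" "e < 2" "\<forall>x\<in>set L. Suc m < fst x" "t < i"
  shows "L @ block (Suc m) e t \<in> D_set k i m n \<longleftrightarrow>
    Suc m * (t + e) \<le> n \<and> L \<in> D_set k (next_bound k i e t) (Suc m) (n - Suc m * (t + e))"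
proof -
  let ?B = "L @ block (Suc m) e t" and ?j = "next_bound k i e t"
  define s where "s = f_plain L (Suc (Suc m))"
  have L0: "f_plain L (Suc m) = 0" "f_over L (Suc m) = 0" "V L (Suc m) = 0"
    using assms(3) by (auto intro: f_plain_eq_0 f_over_eq_0 V_eq_0)
  have split: "(\<forall>l>m. P l) \<longleftrightarrow> P (Suc m) \<and> (\<forall>l>Suc m. P l)" for P :: "nat \<Rightarrow> bool"
    by (metis Suc_lessD Suc_lessI lessI)
  have gt: "(\<forall>x\<in>set ?B. m < fst x)" using assms(3) by (auto simp: block_def)
  have first: "(t + e + s < k \<and> (t + e + s = k - 1 \<longrightarrow> even (Suc m * t + Suc m * e + Suc (Suc m) * s + e + i + 1 + m * (k - 1)))) \<longleftrightarrow> s < ?j"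
  proof (cases "t + e < k")
    case True
    have "even (Suc m * t + Suc m * e + Suc (Suc m) * s + e + i + 1 + m * (k - 1)) \<longleftrightarrow> odd (t + i)" if "t + e + s = k - 1"
      unfolding that[symmetric] by (auto simp: algebra_simps)
    then show ?thesis using True assms(1) unfolding next_bound_def by auto
  next
    case False
    then show ?thesis by (simp add: next_bound_def)
  qed
  have parity: "even (x + (v + e) + i + 1 + m * (k - 1)) \<longleftrightarrow> even (x + v + ?j + 1 + Suc m * (k - 1))" if "0 < ?j" for x v
  proof -
    have "even (e + i) \<longleftrightarrow> even (?j + (k - 1))"
      using that assms(1) unfolding next_bound_def by (cases "even (t + i)") (auto simp: even_diff_nat)
    then show ?thesis unfolding mult_Suc by (rule parity_shift)
  qed
  have b1: "f_plain ?B (Suc m) = t" "f_over ?B (Suc m) = e" "f_plain ?B (Suc (Suc m)) = s" "V ?B (Suc m) = e"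
    by (simp_all add: f_plain_block f_over_block V_block L0 s_def)
  have b2: "f_plain ?B l = f_plain L l" "f_over ?B l = f_over L l" "f_plain ?B (Suc l) = f_plain L (Suc l)" "V ?B l = V L l + e"
    if "Suc m < l" for l
    using that by (simp_all add: f_plain_block f_over_block V_block)
  have bound: "(\<forall>l>m. f_plain ?B l + f_over ?B l + f_plain ?B (Suc l) < k) \<longleftrightarrow>
      t + e + s < k \<and> (\<forall>l>Suc m. f_plain L l + f_over L l + f_plain L (Suc l) < k)"
    by (rule trans[OF split]) (simp only: b1 b2 cong: imp_cong)
  have cond: "(\<forall>l>m. f_plain ?B l + f_over ?B l + f_plain ?B (Suc l) = k - 1 \<longrightarrow>
        even (l * f_plain ?B l + l * f_over ?B l + Suc l * f_plain ?B (Suc l) + V ?B l + i + 1 + m * (k - 1))) \<longleftrightarrow>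
      (t + e + s = k - 1 \<longrightarrow> even (Suc m * t + Suc m * e + Suc (Suc m) * s + e + i + 1 + m * (k - 1))) \<and>
      (\<forall>l>Suc m. f_plain L l + f_over L l + f_plain L (Suc l) = k - 1 \<longrightarrow>
         even (l * f_plain L l + l * f_over L l + Suc l * f_plain L (Suc l) + (V L l + e) + i + 1 + m * (k - 1)))"
    by (rule trans[OF split]) (simp only: b1 b2 cong: imp_cong)
  have "?B \<in> D_set k i m n \<longleftrightarrow> (Suc m * (t + e) \<le> n \<and> overpartition (n - Suc m * (t + e)) L) \<and>
      (t + e + s < k \<and> (t + e + s = k - 1 \<longrightarrow> even (Suc m * t + Suc m * e + Suc (Suc m) * s + e + i + 1 + m * (k - 1)))) \<and>
      (\<forall>l>Suc m. f_plain L l + f_over L l + f_plain L (Suc l) < k) \<and>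
      (\<forall>l>Suc m. f_plain L l + f_over L l + f_plain L (Suc l) = k - 1 \<longrightarrow>
         even (l * f_plain L l + l * f_over L l + Suc l * f_plain L (Suc l) + (V L l + e) + i + 1 + m * (k - 1)))"
  proof -
    have i: "f_plain ?B (Suc m) < i" using assms(4) by (simp only: b1)
    show ?thesis
      unfolding D_set_def mem_Collect_eq bound cond overpartition_append_block[OF assms(3) zero_less_Suc assms(2)]
      using gt i by blast
  qed
  also have "\<dots> \<longleftrightarrow> Suc m * (t + e) \<le> n \<and> L \<in> D_set k ?j (Suc m) (n - Suc m * (t + e))"
  \<comment> \<open>If the truncated subtraction gives 0, both sides are false and its parity is
    irrelevant.\<close>
  proof (cases "0 < ?j")
    case True
    show ?thesis
      unfolding first D_set_def mem_Collect_eq s_def[symmetric] parity[OF True] using assms(3) by blast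
  next
    case False
    then have "\<not> s < ?j" "\<not> f_plain L (Suc (Suc m)) < ?j" by simp_all
    then show ?thesis unfolding first D_set_def mem_Collect_eq by blast
  qed
  finally show ?thesis .
qed

lemma card_D_set_step:
  assumes "1 \<le> k"
  shows "card (D_set k i m n) = (\<Sum>t<i. \<Sum>e<2. if Suc m * (t + e) \<le> n then card (D_set k (next_bound k i e t) (Suc m) (n - Suc m * (t + e))) else 0)"
proof -
  let ?S = "\<lambda>t e. if Suc m * (t + e) \<le> n then D_set k (next_bound k i e t) (Suc m) (n - Suc m * (t + e)) else {}"
  let ?f = "\<lambda>(t, e, L). L @ block (Suc m) e t"
  let ?A = "SIGMA t:{..<i}. SIGMA e:{..<2}. ?S t e"
  have gt: "\<forall>x\<in>set L. Suc m < fst x" if "L \<in> ?S t e" for L t e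
    using that by (auto simp: D_set_def split: if_splits)
  have "bij_betw ?f ?A (D_set k i m n)"
  proof (rule bij_betw_imageI)
    show "inj_on ?f ?A"
    proof (rule inj_onI)
      fix u v assume uv: "u \<in> ?A" "v \<in> ?A" "?f u = ?f v"
      obtain t e L t' e' L' where u: "u = (t, e, L)" and v: "v = (t', e', L')" by (cases u, cases v) auto
      have a: "L \<in> ?S t e" "L' \<in> ?S t' e'" "L @ block (Suc m) e t = L' @ block (Suc m) e' t'"
        using uv unfolding u v prod.case by blast+
      have L: "f_plain L (Suc m) = 0" "f_over L (Suc m) = 0" "f_plain L' (Suc m) = 0" "f_over L' (Suc m) = 0"
        using gt[OF a(1)] gt[OF a(2)] by (auto intro: f_plain_eq_0 f_over_eq_0)
      have "t = t'" using arg_cong[OF a(3), of "\<lambda>x. f_plain x (Suc m)"] L by (simp add: f_plain_block)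
      moreover have "e = e'" using arg_cong[OF a(3), of "\<lambda>x. f_over x (Suc m)"] L by (simp add: f_over_block)
      ultimately show "u = v" using a(3) by (simp add: u v)
    qed
    show "?f ` ?A = D_set k i m n"
    proof (intro equalityI subsetI)
      fix L assume "L \<in> ?f ` ?A"
      then obtain t e L' where L: "L = L' @ block (Suc m) e t" "t < i" "e < 2" "L' \<in> ?S t e" by auto
      then have "Suc m * (t + e) \<le> n" by (meson empty_iff)
      then show "L \<in> D_set k i m n"
        using L append_block_in_D_set[OF assms L(3) gt[OF L(4)] L(2), of n] by simp
    next
      fix L assume L: "L \<in> D_set k i m n"
      then obtain L' e t where L': "L = L' @ block (Suc m) e t" "e < 2" "\<forall>x\<in>set L'. Suc m < fst x"
        using overpartition_split[of L m] by (auto simp: D_set_def overpartition_alt)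
      have "t < i" using L L' by (auto simp: D_set_def f_plain_block)
      then have "L' \<in> ?S t e" using L append_block_in_D_set[OF assms L'(2,3), of t i n] by (simp add: L'(1))
      then show "L \<in> ?f ` ?A" using L' \<open>t < i\<close> by force
    qed
  qed
  then have "card (D_set k i m n) = card ?A" by (rule bij_betw_same_card[symmetric])
  also have "\<dots> = (\<Sum>t<i. \<Sum>e<2. card (?S t e))"
  proof -
    have fin: "finite (?S t e)" for t e by (simp add: finite_D_set)
    then have "card (SIGMA e:{..<2}. ?S t e) = (\<Sum>e<2. card (?S t e))" for t
      by simp
    moreover have "card ?A = (\<Sum>t<i. card (SIGMA e:{..<2}. ?S t e))"
      using fin by (intro card_SigmaI) blast+
    ultimately show ?thesis by (simp only:)
  qed
  finally show ?thesis by (simp add: if_distrib cong: if_cong)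
qed

definition D_gf :: "nat \<Rightarrow> nat \<Rightarrow> nat \<Rightarrow> real fps" where
  "D_gf k i m = Abs_fps (\<lambda>n. of_nat (card (D_set k i m n)))"

lemma D_gf_step:
  assumes "1 \<le> k"
  shows "D_gf k i m = (\<Sum>t<i. \<Sum>e<2. fps_X ^ (Suc m * (t + e)) * D_gf k (next_bound k i e t) (Suc m))"
proof (rule fps_ext)
  fix n
  show "fps_nth (D_gf k i m) n = fps_nth (\<Sum>t<i. \<Sum>e<2. fps_X ^ (Suc m * (t + e)) * D_gf k (next_bound k i e t) (Suc m)) n"
    unfolding D_gf_def fps_nth_Abs_fps card_D_set_step[OF assms, of i m n] fps_sum_nth fps_X_power_mult_nth of_nat_sum
    by (intro sum.cong refl) auto
qed

lemma D_gf_0: "D_gf k 0 m = 0"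
  by (simp add: D_gf_def D_set_def fps_eq_iff)

lemma D_gf_1: "1 \<le> k \<Longrightarrow> D_gf k 1 m = D_gf k k (Suc m) + fps_X ^ Suc m * D_gf k (k - 1) (Suc m)"
  unfolding D_gf_step[of k 1 m] by (simp add: next_bound_def numeral_2_eq_2)

text \<open>i and i+2 have the same parity, hence the same \<open>next_bound\<close>; only t = i and
  t = i+1 are new. Their bounds coincide, the parity correction at t = i making up for the extra
  part at t = i+1, whence the factor \<open>1 + X^(m+1)\<close>.\<close>

lemma D_gf_plus_2:
  assumes "1 \<le> k"
  shows "D_gf k (i + 2) m = D_gf k i m + (1 + fps_X ^ Suc m) * (fps_X ^ (i * Suc m) * (D_gf k (k - i - 1) (Suc m) + fps_X ^ Suc m * D_gf k (k - i - 2) (Suc m)))"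
proof -
  let ?g = "\<lambda>i t. \<Sum>e<2. fps_X ^ (Suc m * (t + e)) * D_gf k (next_bound k i e t) (Suc m)"
  have nb: "next_bound k (i + 2) e t = next_bound k i e t" for e t by (simp add: next_bound_def)
  have nb_i: "next_bound k i e i = k - Suc (i + e)" for e by (simp add: next_bound_def)
  have nb_Suc: "next_bound k i e (Suc i) = k - Suc (i + e)" for e by (simp add: next_bound_def)
  have "D_gf k (i + 2) m = D_gf k i m + ?g i i + ?g i (Suc i)"
    unfolding D_gf_step[OF assms, of "i + 2" m] D_gf_step[OF assms, of i m] nb
    unfolding add_2_eq_Suc' sum.lessThan_Suc by (rule refl)
  also have "?g i i = fps_X ^ (i * Suc m) * (D_gf k (k - i - 1) (Suc m) + fps_X ^ Suc m * D_gf k (k - i - 2) (Suc m))"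
    by (simp add: nb_i nb_Suc numeral_2_eq_2 algebra_simps power_add)
  also have "?g i (Suc i) = fps_X ^ Suc m * (fps_X ^ (i * Suc m) * (D_gf k (k - i - 1) (Suc m) + fps_X ^ Suc m * D_gf k (k - i - 2) (Suc m)))"
    by (simp add: nb_i nb_Suc numeral_2_eq_2 algebra_simps power_add)
  finally show ?thesis by (simp add: algebra_simps)
qed

lemma D_gf_limit:
  assumes "2 \<le> k" "1 \<le> i" "L \<le> m"
  shows "eq_upto L (D_gf k i m) 1"
  unfolding eq_upto_def
proof (intro allI impI)
  fix n assume n: "n < L"
  have "D_set k i m n = (if n = 0 then {[]} else {})"
  proof (intro equalityI subsetI)
    fix L' assume L': "L' \<in> D_set k i m n"
    have "L' = []"
    proof (rule ccontr)
      assume "L' \<noteq> []"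
      then obtain x where "x \<in> set L'" by (meson list.set_sel(1))
      then have "m < fst x" "fst x \<le> n"
        using L' member_le_sum_list[of "fst x" "map fst L'"] by (auto simp: D_set_def overpartition_def)
      then show False using n assms(3) by simp
    qed
    then show "L' \<in> (if n = 0 then {[]} else {})" using L' by (simp add: D_set_def overpartition_def)
  next
    fix L' :: "(nat \<times> bool) list" assume "L' \<in> (if n = 0 then {[]} else {})"
    then show "L' \<in> D_set k i m n"
      using assms by (auto simp: D_set_def overpartition_def f_plain_def f_over_def split: if_splits)
  qed
  then show "fps_nth (D_gf k i m) n = fps_nth 1 n" by (simp add: D_gf_def)
qed

lemma D_bar_eq_upto:
  assumes "1 \<le> a" "a < k"
  shows "eq_upto L (Abs_fps (\<lambda>n. of_nat (D_bar k a n))) (plus_qfac L * inv_qfac fps_X (int L) * theta (2 * k - 1) a L)"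
proof -
  have "Abs_fps (\<lambda>n. of_nat (D_bar k a n)) = D_gf k a 0"
    using assms by (simp add: D_gf_def D_bar_eq_card)
  moreover have "eq_upto L (D_gf k a 0) (plus_qfac L * inv_qfac fps_X (int L) * theta (2 * k - 1) a L)"
    using assms by (intro q_difference_solution D_gf_0 D_gf_1 D_gf_plus_2 D_gf_limit) auto
  ultimately show ?thesis by simp
qed

section \<open>Step lists in a strip\<close>

fun step_height :: "step \<Rightarrow> int" where
  "step_height NE_step = 1" | "step_height SE_step = - 1" | "step_height N_step = 1" | "step_height E_step = 0"

definition is_up :: "step \<Rightarrow> bool" where
  "is_up s \<longleftrightarrow> s = NE_step \<or> s = N_step"

lemma is_up_simps [simp]: "is_up NE_step" "is_up N_step" "\<not> is_up SE_step" "\<not> is_up E_step"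
  by (simp_all add: is_up_def)

text \<open>The condition on peaks of relative height \<open>k - 1\<close> says that the ceiling \<open>k - 1\<close> drops to
  \<open>k - 2\<close> while the number of E steps taken so far is odd. The flag \<open>p\<close> records this parity and
  \<open>s\<close> is the step leading to the current vertex.\<close>

fun admissible :: "nat \<Rightarrow> bool \<Rightarrow> step \<Rightarrow> int \<Rightarrow> step list \<Rightarrow> bool" where
  "admissible k p s h [] \<longleftrightarrow> h = 0 \<and> of_bool p < int k \<and> s = SE_step"
| "admissible k p s h (x # S) \<longleftrightarrow> 0 \<le> h \<and> h + of_bool p < int k \<and> (x = E_step \<longrightarrow> h = 0) \<and>
     (s = N_step \<longrightarrow> x = SE_step) \<and> admissible k (p \<noteq> (x = E_step)) x (h + step_height x) S"

fun peaks :: "step \<Rightarrow> step list \<Rightarrow> nat" where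
  "peaks s [] = 0"
| "peaks s (x # S) = of_bool (is_up s \<and> x = SE_step) + peaks x S"

text \<open>The sum of the weights of the peaks relative to the weight of the current vertex.\<close>

fun peak_sum :: "step \<Rightarrow> step list \<Rightarrow> nat" where
  "peak_sum s [] = 0"
| "peak_sum s (x # S) = peak_sum x S + (if x = N_step then 0 else peaks x S)"

text \<open>From a positive height no E step is possible before a descent, so the convention on the
  leftmost peak says that the path begins with NE steps, possibly none, followed by SE.\<close>

fun first_peak_NESE :: "step list \<Rightarrow> bool" where
  "first_peak_NESE (NE_step # S) \<longleftrightarrow> first_peak_NESE S"
| "first_peak_NESE (SE_step # S) \<longleftrightarrow> True"
| "first_peak_NESE _ \<longleftrightarrow> False"

lemma admissible_bounds:
  assumes "admissible k p s h S"
  shows "0 \<le> h" "h + of_bool p < int k"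
  using assms by (cases S; auto)+

text \<open>The path ends with SE and has E steps only at height 0, so every rise and every E step
  has a peak ahead. Without peaks only the straight descent remains.\<close>

lemma admissible_no_peaks:
  assumes "admissible k p s h S" "peaks s S = 0"
  shows "\<not> is_up s \<and> S = replicate (nat h) SE_step \<and> (h = 0 \<longrightarrow> s = SE_step)"
  using assms
proof (induction S arbitrary: p s h)
  case Nil
  then show ?case by simp
next
  case (Cons x S)
  have adm: "admissible k (p \<noteq> (x = E_step)) x (h + step_height x) S" and "peaks x S = 0" using Cons.prems by auto
  then have IH: "\<not> is_up x" "S = replicate (nat (h + step_height x)) SE_step" "h + step_height x = 0 \<longrightarrow> x = SE_step"
    using Cons.IH by blast+
  show ?case
  proof (cases x)
    case SE_step
    then have "0 < h" using admissible_bounds(1)[OF adm] by simp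
    then have "nat h = Suc (nat (h - 1))" by simp
    then show ?thesis using SE_step IH Cons.prems \<open>0 < h\<close> by simp
  qed (use IH Cons.prems in auto)
qed

text \<open>Each NE or E step has a peak ahead and adds at least 1 to \<open>peak_sum\<close>; each
  N step makes a peak of its own; the SE steps number h plus the rises. The summand 2 accounts for
  an N step just taken. The bound serves finiteness.\<close>

lemma admissible_length:
  assumes "admissible k p s h S"
  shows "int (length S) + (if s = N_step then 2 else 0) \<le> h + 2 * int (peak_sum s S) + 2 * int (peaks s S)"
  using assms
proof (induction S arbitrary: p s h)
  case Nil
  then show ?case by simp
next
  case (Cons x S)
  have adm: "admissible k (p \<noteq> (x = E_step)) x (h + step_height x) S" and "s = N_step \<longrightarrow> x = SE_step" "x = E_step \<longrightarrow> h = 0"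
    using Cons.prems by auto
  have "0 < peaks x S" if "x = NE_step \<or> x = E_step"
    using admissible_no_peaks[OF adm] that \<open>x = E_step \<longrightarrow> h = 0\<close> by force
  then show ?case using Cons.IH[OF adm] \<open>s = N_step \<longrightarrow> x = SE_step\<close> by (cases x) (auto simp: of_bool_def)
qed

definition paths :: "nat \<Rightarrow> bool \<Rightarrow> step \<Rightarrow> int \<Rightarrow> nat \<Rightarrow> nat \<Rightarrow> step list set" where
  "paths k p s h n w = {S. admissible k p s h S \<and> peaks s S = n \<and> peak_sum s S = w}"

lemma finite_step_lists: "finite {S :: step list. length S \<le> m}"
proof -
  have "(UNIV :: step set) = {NE_step, SE_step, N_step, E_step}" using step.exhaust by auto
  moreover have "finite {NE_step, SE_step, N_step, E_step}" by simp
  ultimately have "finite (UNIV :: step set)" by (simp only:)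
  then show ?thesis using finite_lists_length_le[of "UNIV :: step set" m] by simp
qed

lemma finite_paths: "finite (paths k p s h n w)"
  by (rule finite_subset[OF _ finite_step_lists[of "nat h + 2 * w + 2 * n"]])
    (use admissible_length in \<open>fastforce simp: paths_def split: if_splits\<close>)

lemma card_Cons_split:
  assumes "finite F" "[] \<notin> F"
  shows "card F = card {S. SE_step # S \<in> F} + card {S. NE_step # S \<in> F} + card {S. N_step # S \<in> F} + card {S. E_step # S \<in> F}"
proof -
  let ?A = "\<lambda>x. (#) x ` {S. x # S \<in> F}"
  have c: "card (?A x) = card {S. x # S \<in> F}" for x by (intro card_image) (auto simp: inj_on_def)
  have fin: "finite (?A x)" for x by (rule finite_subset[OF _ assms(1)]) auto
  have "F = ?A SE_step \<union> ?A NE_step \<union> ?A N_step \<union> ?A E_step"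
  proof (intro equalityI subsetI)
    fix S assume "S \<in> F"
    then obtain x S' where "S = x # S'" using assms(2) by (cases S) auto
    then show "S \<in> ?A SE_step \<union> ?A NE_step \<union> ?A N_step \<union> ?A E_step" using \<open>S \<in> F\<close> by (cases x) auto
  qed auto
  then have "card F = card (?A SE_step \<union> ?A NE_step \<union> ?A N_step \<union> ?A E_step)" by (rule arg_cong)
  also have "\<dots> = card (?A SE_step) + card (?A NE_step) + card (?A N_step) + card (?A E_step)"
    using fin by (subst card_Un_disjoint; auto)+
  finally show ?thesis by (simp only: c)
qed

definition path_gf :: "nat \<Rightarrow> bool \<Rightarrow> step \<Rightarrow> int \<Rightarrow> nat \<Rightarrow> real fps" where
  "path_gf k p s h n = Abs_fps (\<lambda>w. of_nat (card (paths k p s h n w)))"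

lemma path_gf_out_of_range: "\<not> (0 \<le> h \<and> h + of_bool p < int k) \<Longrightarrow> path_gf k p s h n = 0"
proof -
  assume "\<not> (0 \<le> h \<and> h + of_bool p < int k)"
  then have "paths k p s h n w = {}" for w using admissible_bounds by (force simp: paths_def)
  then show ?thesis by (simp add: path_gf_def fps_eq_iff)
qed

lemma path_gf_0:
  assumes "0 \<le> h" "h + of_bool p < int k"
  shows "path_gf k p SE_step h 0 = 1"
proof -
  let ?R = "replicate (nat h) SE_step"
  have adm: "admissible k p SE_step (int m) (replicate m SE_step)" if "int m + of_bool p < int k" for m
    using that by (induction m) auto
  have pk: "peaks SE_step (replicate m SE_step) = 0" for m by (induction m) auto
  have ps: "peak_sum SE_step (replicate m SE_step) = 0" for m using pk by (induction m) auto
  have R: "admissible k p SE_step h ?R" using adm[of "nat h"] assms by simp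
  have "S \<in> paths k p SE_step h 0 w \<longleftrightarrow> w = 0 \<and> S = ?R" for S w
  proof
    assume "S \<in> paths k p SE_step h 0 w"
    then have S: "admissible k p SE_step h S" "peaks SE_step S = 0" "peak_sum SE_step S = w"
      by (simp_all add: paths_def)
    then have "S = ?R" using admissible_no_peaks[OF S(1,2)] by blast
    then show "w = 0 \<and> S = ?R" using S(3) ps by simp
  next
    assume "w = 0 \<and> S = ?R"
    then show "S \<in> paths k p SE_step h 0 w" using R pk ps by (simp add: paths_def)
  qed
  then have "paths k p SE_step h 0 w = (if w = 0 then {?R} else {})" for w by auto
  then show ?thesis by (simp add: path_gf_def fps_eq_iff)
qed

lemma nonempty_paths: "0 < n \<Longrightarrow> [] \<notin> paths k p s h n w"
  by (simp add: paths_def)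

lemma path_gf_E: "0 < n \<Longrightarrow> path_gf k p E_step h n = path_gf k p SE_step h n"
proof -
  assume n: "0 < n"
  have "S \<in> paths k p E_step h n w \<longleftrightarrow> S \<in> paths k p SE_step h n w" for S w
    using n by (cases S) (auto simp: paths_def)
  then have "paths k p E_step h n w = paths k p SE_step h n w" for w by blast
  then show ?thesis by (simp add: path_gf_def)
qed

text \<open>A step of width 1 moves all peaks still to come one unit to the right, whence
  \<open>X^n\<close>; if the current vertex is itself the next peak, it has relative weight 0 and
  only n-1 peaks move.\<close>

lemma path_gf_step:
  assumes "0 \<le> h" "h + of_bool p < int k" "0 < n"
  shows "path_gf k p s h n = (if is_up s then fps_X ^ (n - 1) * path_gf k p SE_step (h - 1) (n - 1) else fps_X ^ n * path_gf k p SE_step (h - 1) n)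
    + (if s = N_step then 0 else fps_X ^ n * path_gf k p NE_step (h + 1) n + path_gf k p N_step (h + 1) n
        + (if h = 0 then fps_X ^ n * path_gf k (\<not> p) E_step 0 n else 0))" (is "?l = ?r")
proof (rule fps_ext)
  fix w
  have se: "{S. SE_step # S \<in> paths k p s h n w} = (if is_up s
      then if n - 1 \<le> w then paths k p SE_step (h - 1) (n - 1) (w - (n - 1)) else {}
      else if n \<le> w then paths k p SE_step (h - 1) n (w - n) else {})"
    using assms by (auto simp: paths_def)
  have ne: "{S. NE_step # S \<in> paths k p s h n w} = (if s = N_step then {} else if n \<le> w then paths k p NE_step (h + 1) n (w - n) else {})"
    using assms by (auto simp: paths_def)
  have nn: "{S. N_step # S \<in> paths k p s h n w} = (if s = N_step then {} else paths k p N_step (h + 1) n w)"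
    using assms by (auto simp: paths_def)
  have ee: "{S. E_step # S \<in> paths k p s h n w} = (if s = N_step \<or> h \<noteq> 0 then {} else if n \<le> w then paths k (\<not> p) E_step 0 n (w - n) else {})"
    using assms by (auto simp: paths_def)
  show "fps_nth ?l w = fps_nth ?r w"
    unfolding path_gf_def fps_nth_Abs_fps card_Cons_split[OF finite_paths[of k p s h n w] nonempty_paths[OF assms(3)]] se ne nn ee
    by (simp add: fps_X_power_mult_nth)
qed

lemma path_gf_N:
  assumes "0 \<le> h" "0 < n"
  shows "path_gf k p N_step (h + 1) n = (if h + 1 + of_bool p < int k then fps_X ^ (n - 1) * path_gf k p SE_step h (n - 1) else 0)"
  using assms path_gf_step[of "h + 1" p k n N_step] path_gf_out_of_range[of "h + 1" p k N_step n] by auto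

text \<open>At height 0 an E step, which flips the flag, takes the place of the descent. The last
  term is an N step with its compulsory SE step, back to height h.\<close>

lemma path_gf_SE:
  assumes "0 \<le> h" "h + of_bool p < int k" "0 < n"
  shows "path_gf k p SE_step h n =
    fps_X ^ n * (if h = 0 then path_gf k (\<not> p) SE_step 0 n else path_gf k p SE_step (h - 1) n)
    + (if h + 1 + of_bool p < int k then fps_X ^ n * path_gf k p NE_step (h + 1) n + fps_X ^ (n - 1) * path_gf k p SE_step h (n - 1) else 0)"
  using path_gf_step[OF assms, of SE_step] path_gf_N[OF assms(1,3), of k p]
    path_gf_out_of_range[of "- 1" p k SE_step n] path_gf_out_of_range[of "h + 1" p k NE_step n] path_gf_E[OF assms(3)] assms(1)
  by (auto simp: algebra_simps)

lemma path_gf_NE: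
  assumes "1 \<le> h" "h + of_bool p < int k" "0 < n"
  shows "path_gf k p NE_step h n = fps_X ^ (n - 1) * path_gf k p SE_step (h - 1) (n - 1)
    + (if h + 1 + of_bool p < int k then fps_X ^ n * path_gf k p NE_step (h + 1) n + fps_X ^ (n - 1) * path_gf k p SE_step h (n - 1) else 0)"
  using path_gf_step[of h p k n NE_step] path_gf_N[of h n k p] path_gf_out_of_range[of "h + 1" p k NE_step n] assms
  by (auto simp: algebra_simps)

section \<open>Solution of the strip recurrence\<close>

definition strip_gf :: "nat \<Rightarrow> nat \<Rightarrow> int \<Rightarrow> real fps" where
  "strip_gf k n h = fps_X ^ tri (n - 1) * plus_qfac n * bailey_sum (int k - 1) n h"

lemma strip_gf_0: "strip_gf k 0 h = 1"
  by (simp add: strip_gf_def)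

lemma strip_gf_minus: "strip_gf k n (- h) = strip_gf k n h"
  by (simp add: strip_gf_def bailey_sum_minus)

lemma strip_gf_top: "2 \<le> k \<Longrightarrow> strip_gf k n (int k - 1) = fps_X ^ n * strip_gf k n (int k - 2)"
  using bailey_sum_top[of "int k - 1" n] by (simp add: strip_gf_def)

lemma strip_gf_recurrence:
  assumes "\<bar>h\<bar> + 1 < int k"
  shows "(1 + fps_X ^ (2 * Suc n)) * strip_gf k (Suc n) h - fps_X ^ Suc n * (strip_gf k (Suc n) (h - 1) + strip_gf k (Suc n) (h + 1))
    = fps_X ^ n * (1 + fps_X ^ Suc n) * strip_gf k n h"
proof -
  let ?A = "fps_X ^ tri n * plus_qfac (Suc n) :: real fps"
  have "(1 + fps_X ^ (2 * Suc n)) * strip_gf k (Suc n) h - fps_X ^ Suc n * (strip_gf k (Suc n) (h - 1) + strip_gf k (Suc n) (h + 1))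
      = ?A * ((1 + fps_X ^ (2 * Suc n)) * bailey_sum (int k - 1) (Suc n) h - fps_X ^ Suc n * (bailey_sum (int k - 1) (Suc n) (h - 1) + bailey_sum (int k - 1) (Suc n) (h + 1)))"
    unfolding strip_gf_def diff_Suc_1 by (simp only: ring_distribs mult_ac)
  also have "\<dots> = ?A * bailey_sum (int k - 1) n h"
    using assms by (subst bailey_sum_recurrence) auto
  also have "\<dots> = fps_X ^ n * (1 + fps_X ^ Suc n) * strip_gf k n h"
  proof -
    have "tri n = n + tri (n - 1)" by (cases n) (simp_all add: tri_Suc)
    then have "fps_X ^ tri n = fps_X ^ n * (fps_X ^ tri (n - 1) :: real fps)" by (simp only: power_add)
    then show ?thesis unfolding strip_gf_def plus_qfac_Suc by (simp only: mult_ac)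
  qed
  finally show ?thesis .
qed

text \<open>The strip with the lower ceiling is reflected to the heights \<open>-1-h\<close>; by symmetry these may be replaced by \<open>h+1\<close>.\<close>

definition strip_SE :: "nat \<Rightarrow> bool \<Rightarrow> int \<Rightarrow> nat \<Rightarrow> real fps" where
  "strip_SE k p h n = strip_gf k n (h + of_bool p)"

text \<open>Read off by subtracting \<open>path_gf_NE\<close> from \<open>path_gf_SE\<close>, whose
  rising terms coincide and cancel.\<close>

definition strip_NE :: "nat \<Rightarrow> bool \<Rightarrow> int \<Rightarrow> nat \<Rightarrow> real fps" where
  "strip_NE k p h n = strip_SE k p h n - fps_X ^ n * strip_SE k p (h - 1) n + fps_X ^ (n - 1) * strip_SE k p (h - 1) (n - 1)"

text \<open>Eliminating \<open>strip_NE\<close> leaves the three-term relation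
  \<open>strip_gf_recurrence\<close>; at the ceiling the rising terms are absent and
  \<open>strip_gf_top\<close> takes its place.\<close>

lemma strip_SE_step:
  assumes "2 \<le> k" "0 \<le> h" "h + of_bool p < int k" "0 < n"
  shows "strip_SE k p h n = fps_X ^ n * strip_SE k p (h - 1) n
    + (if h + 1 + of_bool p < int k then fps_X ^ n * strip_NE k p (h + 1) n + fps_X ^ (n - 1) * strip_SE k p h (n - 1) else 0)"
proof (cases "h + 1 + of_bool p < int k")
  case True
  obtain m where n: "n = Suc m" using assms(4) by (cases n) auto
  let ?X = "fps_X ^ n :: real fps" and ?h = "h + of_bool p"
  have "\<bar>?h\<bar> + 1 < int k" using True assms(2) by simp
  from strip_gf_recurrence[OF this, of m]
  have "(1 + ?X * ?X) * strip_gf k n ?h - ?X * (strip_gf k n (?h - 1) + strip_gf k n (?h + 1)) = fps_X ^ m * (1 + ?X) * strip_gf k m ?h"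
    unfolding n mult_2 power_add[of _ "Suc m" "Suc m"] .
  then have "strip_gf k n ?h = ?X * strip_gf k n (?h - 1) + (?X * (strip_gf k n (?h + 1) - ?X * strip_gf k n ?h + fps_X ^ m * strip_gf k m ?h) + fps_X ^ m * strip_gf k m ?h)"
    by (simp add: algebra_simps)
  then show ?thesis using True by (simp add: strip_SE_def strip_NE_def n algebra_simps)
next
  case False
  then have e: "h + of_bool p = int k - 1" "h - 1 + of_bool p = int k - 2" using assms(3) by auto
  show ?thesis unfolding strip_SE_def e using False strip_gf_top[OF assms(1), of n] by (simp only: if_False add_0_right)
qed

text \<open>Here the two strips are glued: an E step at height 0 acts as a descent to height -1 of
  the other, reflected strip.\<close>

lemma strip_SE_reflect: "strip_SE k p (- 1) n = strip_SE k (\<not> p) 0 n"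
  using strip_gf_minus[of k n 1] by (cases p) (simp_all add: strip_SE_def)

text \<open>Outer induction on the number of peaks, inner induction on the precision: references to
  the same n > 0 carry \<open>X^n\<close>, so the SE and NE series together gain one order per
  round.\<close>

lemma path_gf_eq:
  assumes "2 \<le> k" "0 \<le> h" "h + of_bool p < int k"
  shows "path_gf k p SE_step h n = strip_SE k p h n"
  using assms(2,3)
proof (induction n arbitrary: p h)
  case 0
  then show ?case by (simp add: path_gf_0 strip_SE_def strip_gf_0)
next
  case (Suc m)
  let ?n = "Suc m"
  have shift: "eq_upto (Suc N) (fps_X ^ ?n * f) (fps_X ^ ?n * g)" if "eq_upto N f g" for N f g
    using that by (intro eq_upto_X_power_shift[of "Suc N" 1]) auto
  have "(\<forall>p h. 0 \<le> h \<longrightarrow> h + of_bool p < int k \<longrightarrow> eq_upto N (path_gf k p SE_step h ?n) (strip_SE k p h ?n)) \<and>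
      (\<forall>p h. 1 \<le> h \<longrightarrow> h + of_bool p < int k \<longrightarrow> eq_upto N (path_gf k p NE_step h ?n) (strip_NE k p h ?n))" for N
  proof (induction N)
    case 0
    show ?case by (simp add: eq_upto_def)
  next
    case (Suc N)
    have P: "eq_upto N (path_gf k p SE_step h ?n) (strip_SE k p h ?n)" if "0 \<le> h" "h + of_bool p < int k" for p h
      using Suc.IH that by blast
    have Q: "eq_upto N (path_gf k p NE_step h ?n) (strip_NE k p h ?n)" if "1 \<le> h" "h + of_bool p < int k" for p h
      using Suc.IH that by blast
    have tail: "eq_upto (Suc N)
        (if h + 1 + of_bool p < int k then fps_X ^ ?n * path_gf k p NE_step (h + 1) ?n + fps_X ^ (?n - 1) * path_gf k p SE_step h (?n - 1) else 0)
        (if h + 1 + of_bool p < int k then fps_X ^ ?n * strip_NE k p (h + 1) ?n + fps_X ^ (?n - 1) * strip_SE k p h (?n - 1) else 0)"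
      if "0 \<le> h" "h + of_bool p < int k" for p h
      using that Suc.prems by (auto simp del: power_Suc simp: \<open>\<And>p h. 0 \<le> h \<Longrightarrow> h + of_bool p < int k \<Longrightarrow> path_gf k p SE_step h m = strip_SE k p h m\<close> intro!: eq_upto_add shift Q)
    have "eq_upto (Suc N) (path_gf k p SE_step h ?n) (strip_SE k p h ?n)" if h: "0 \<le> h" "h + of_bool p < int k" for p h
    proof -
      have "eq_upto N (if h = 0 then path_gf k (\<not> p) SE_step 0 ?n else path_gf k p SE_step (h - 1) ?n) (strip_SE k p (h - 1) ?n)"
        using h assms(1) by (auto simp: strip_SE_reflect intro!: P)
      then show ?thesis
        unfolding path_gf_SE[OF h zero_less_Suc] strip_SE_step[OF assms(1) h zero_less_Suc]
        by (intro eq_upto_add shift tail h)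
    qed
    moreover have "eq_upto (Suc N) (path_gf k p NE_step h ?n) (strip_NE k p h ?n)" if h: "1 \<le> h" "h + of_bool p < int k" for p h
    proof -
      have h': "0 \<le> h" "0 \<le> h - 1" "h - 1 + of_bool p < int k" using h by auto
      have "strip_NE k p h ?n = fps_X ^ (?n - 1) * path_gf k p SE_step (h - 1) (?n - 1) + (strip_SE k p h ?n - fps_X ^ ?n * strip_SE k p (h - 1) ?n)"
        using \<open>\<And>p h. 0 \<le> h \<Longrightarrow> h + of_bool p < int k \<Longrightarrow> path_gf k p SE_step h m = strip_SE k p h m\<close>[OF h'(2,3)]
        by (simp add: strip_NE_def)
      also have "strip_SE k p h ?n - fps_X ^ ?n * strip_SE k p (h - 1) ?n =
          (if h + 1 + of_bool p < int k then fps_X ^ ?n * strip_NE k p (h + 1) ?n + fps_X ^ (?n - 1) * strip_SE k p h (?n - 1) else 0)"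
        using strip_SE_step[OF assms(1) h'(1) h(2) zero_less_Suc, of m] by simp
      finally show ?thesis
        unfolding path_gf_NE[OF h zero_less_Suc] by (simp only:) (intro eq_upto_add eq_upto_refl tail h' h)
    qed
    ultimately show ?case by blast
  qed
  then show ?case using Suc.prems by (intro eq_upto_all_imp_eq) blast
qed

section \<open>The condition on the leftmost peak\<close>

definition rising_gf :: "nat \<Rightarrow> step \<Rightarrow> int \<Rightarrow> nat \<Rightarrow> real fps" where
  "rising_gf k s h n = Abs_fps (\<lambda>w. of_nat (card {S \<in> paths k False s h n w. first_peak_NESE S}))"

lemma rising_gf_step:
  assumes "1 \<le> h" "h < int k" "0 < n" "s = NE_step \<or> s = SE_step"
  shows "rising_gf k s h n = (if s = NE_step then fps_X ^ (n - 1) * path_gf k False SE_step (h - 1) (n - 1) else fps_X ^ n * path_gf k False SE_step (h - 1) n)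
     + (if h + 1 < int k then fps_X ^ n * rising_gf k NE_step (h + 1) n else 0)" (is "?l = ?r")
proof (rule fps_ext)
  fix w
  let ?F = "{S \<in> paths k False s h n w. first_peak_NESE S}"
  have se: "{S. SE_step # S \<in> ?F} = (if s = NE_step
      then if n - 1 \<le> w then paths k False SE_step (h - 1) (n - 1) (w - (n - 1)) else {}
      else if n \<le> w then paths k False SE_step (h - 1) n (w - n) else {})"
    using assms by (auto simp: paths_def)
  have ne: "{S. NE_step # S \<in> ?F} = (if h + 1 < int k \<and> n \<le> w then {S \<in> paths k False NE_step (h + 1) n (w - n). first_peak_NESE S} else {})"
    using assms by (auto simp: paths_def dest: admissible_bounds)
  have nn: "{S. N_step # S \<in> ?F} = {}" "{S. E_step # S \<in> ?F} = {}"
    by auto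
  have "finite ?F" "[] \<notin> ?F" using finite_paths by auto
  from card_Cons_split[OF this] show "fps_nth ?l w = fps_nth ?r w"
    unfolding rising_gf_def path_gf_def fps_nth_Abs_fps se ne nn
    using assms by (auto simp add: fps_X_power_mult_nth)
qed

text \<open>Induction downward from the ceiling. Multiplied by \<open>1 + X^n\<close>, each NE step
  telescopes by \<open>strip_gf_recurrence\<close>, and at the ceiling the remainder vanishes by
  \<open>strip_gf_top\<close>.\<close>

lemma rising_gf_NE:
  assumes "2 \<le> k" "1 \<le> h" "h < int k" "0 < n"
  shows "(1 + fps_X ^ n) * rising_gf k NE_step h n = strip_gf k n (h - 1) - fps_X ^ n * strip_gf k n (h - 2)"
  using assms(2,3)
proof (induction "nat (int k - h)" arbitrary: h)
  case 0
  then show ?case by simp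
next
  case (Suc d)
  obtain m where n: "n = Suc m" using assms(4) by (cases n) auto
  let ?X = "fps_X ^ n :: real fps"
  have "\<bar>h - 1\<bar> + 1 < int k" using Suc.prems by simp
  from strip_gf_recurrence[OF this, of m]
  have "(1 + ?X * ?X) * strip_gf k n (h - 1) - ?X * (strip_gf k n (h - 1 - 1) + strip_gf k n (h - 1 + 1)) = fps_X ^ m * (1 + ?X) * strip_gf k m (h - 1)"
    unfolding n mult_2 power_add[of _ "Suc m" "Suc m"] .
  then have 1: "(1 + ?X) * (fps_X ^ m * strip_gf k m (h - 1)) = strip_gf k n (h - 1) - ?X * strip_gf k n (h - 2) - ?X * (strip_gf k n h - ?X * strip_gf k n (h - 1))"
    by (simp add: algebra_simps)
  have 2: "rising_gf k NE_step h n = fps_X ^ m * strip_gf k m (h - 1) + (if h + 1 < int k then ?X * rising_gf k NE_step (h + 1) n else 0)"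
    using rising_gf_step[OF Suc.prems assms(4), of NE_step] path_gf_eq[OF assms(1), of "h - 1" False m] Suc.prems
    by (simp add: n strip_SE_def)
  show ?case
  proof (cases "h + 1 < int k")
    case True
    then have "(1 + ?X) * rising_gf k NE_step (h + 1) n = strip_gf k n h - ?X * strip_gf k n (h - 1)"
      using Suc.hyps(1)[of "h + 1"] Suc.hyps(2) Suc.prems by (simp add: algebra_simps)
    then have "(1 + ?X) * rising_gf k NE_step h n = (1 + ?X) * (fps_X ^ m * strip_gf k m (h - 1)) + ?X * (strip_gf k n h - ?X * strip_gf k n (h - 1))"
      unfolding 2 using True by (simp only: if_True distrib_left mult.left_commute[of "1 + ?X" ?X])
    then show ?thesis unfolding 1 by simp
  next
    case False
    then have "h = int k - 1" using Suc.prems by simp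
    then have "strip_gf k n h - ?X * strip_gf k n (h - 1) = 0" using strip_gf_top[OF assms(1), of n] by simp
    then show ?thesis using False 1 unfolding 2 by simp
  qed
qed

text \<open>Cancelling \<open>1 + X^n\<close> shortens \<open>(-q)_n\<close> to
  \<open>(-q)_(n-1)\<close>, and the leading \<open>X^n\<close> turns n(n-1)/2 into n(n+1)/2. For n
  = 0 the value 1/2 halves 1 + 1.\<close>

lemma rising_gf_SE:
  assumes "2 \<le> k" "1 \<le> h" "h < int k"
  shows "rising_gf k SE_step h n = first_factor n * (bailey_sum (int k - 1) n (h - 1) + bailey_sum (int k - 1) n h)"
proof (cases n)
  case 0
  have fp: "first_peak_NESE (replicate (nat h) SE_step)" using assms(2) by (cases "nat h") auto
  have "first_peak_NESE S" if "S \<in> paths k False SE_step h 0 w" for S w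
    using that fp admissible_no_peaks[of k False SE_step h S] by (auto simp: paths_def)
  then have "{S \<in> paths k False SE_step h 0 w. first_peak_NESE S} = paths k False SE_step h 0 w" for w
    by blast
  then have "rising_gf k SE_step h 0 = path_gf k False SE_step h 0" by (simp add: rising_gf_def path_gf_def)
  then have "rising_gf k SE_step h 0 = 1" using assms by (simp add: path_gf_0)
  moreover have "fps_const (1 / 2) * (1 + 1 :: real fps) = 1"
    by (simp add: fps_eq_iff fps_numeral_nth)
  ultimately show ?thesis using 0 by (simp add: first_factor_def)
next
  case (Suc m)
  let ?X = "fps_X ^ n :: real fps"
  have n: "0 < n" using Suc by simp
  have 2: "rising_gf k SE_step h n = ?X * strip_gf k n (h - 1) + (if h + 1 < int k then ?X * rising_gf k NE_step (h + 1) n else 0)"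
    using rising_gf_step[OF assms(2,3) n, of SE_step] path_gf_eq[OF assms(1), of "h - 1" False n] assms
    by (simp add: strip_SE_def)
  have "(1 + ?X) * rising_gf k SE_step h n = (1 + ?X) * (?X * strip_gf k n (h - 1)) + ?X * (strip_gf k n h - ?X * strip_gf k n (h - 1))"
  proof (cases "h + 1 < int k")
    case True
    have "(1 + ?X) * rising_gf k NE_step (h + 1) n = strip_gf k n h - ?X * strip_gf k n (h - 1)"
      using rising_gf_NE[OF assms(1) _ True n] assms(2) by (simp add: algebra_simps)
    then show ?thesis
      unfolding 2 using True by (simp only: if_True distrib_left mult.left_commute[of "1 + ?X" ?X])
  next
    case False
    then have "h = int k - 1" using assms by simp
    then have "strip_gf k n h - ?X * strip_gf k n (h - 1) = 0" using strip_gf_top[OF assms(1), of n] by simp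
    then show ?thesis using False unfolding 2 by simp
  qed
  also have "\<dots> = ?X * (strip_gf k n (h - 1) + strip_gf k n h)" by (simp add: algebra_simps)
  also have "\<dots> = (1 + ?X) * (first_factor n * (bailey_sum (int k - 1) n (h - 1) + bailey_sum (int k - 1) n h))"
    unfolding strip_gf_def first_factor_def Suc by (simp add: tri_Suc plus_qfac_Suc power_add algebra_simps)
  finally have "(1 + ?X) * rising_gf k SE_step h n = (1 + ?X) * (first_factor n * (bailey_sum (int k - 1) n (h - 1) + bailey_sum (int k - 1) n h))" .
  moreover have "1 + ?X \<noteq> 0" using n by (intro nth_0_one_nonzero) simp
  ultimately show ?thesis unfolding mult_cancel_left by blast
qed

definition start_paths :: "nat \<Rightarrow> int \<Rightarrow> nat \<Rightarrow> step list set" where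
  "start_paths k h w = {S. admissible k False SE_step h S \<and> first_peak_NESE S \<and> peak_sum SE_step S = w}"

text \<open>The first step of such a list has width 1, so each peak has weight at least 1; for a
  given major index only finitely many n contribute.\<close>

lemma peaks_le_peak_sum: "first_peak_NESE S \<Longrightarrow> peaks SE_step S \<le> peak_sum SE_step S"
  by (cases S rule: first_peak_NESE.cases) auto

lemma start_paths_eq_upto:
  assumes "2 \<le> k" "1 \<le> h" "h < int k"
  shows "eq_upto L (Abs_fps (\<lambda>w. of_nat (card (start_paths k h w)))) (\<Sum>n<L. first_factor n * (bailey_sum (int k - 1) n (h - 1) + bailey_sum (int k - 1) n h))"
  unfolding eq_upto_def
proof (intro allI impI)
  fix w assume w: "w < L"
  let ?A = "\<lambda>n. {S \<in> paths k False SE_step h n w. first_peak_NESE S}"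
  have "start_paths k h w = (\<Union>n<L. ?A n)"
    using w peaks_le_peak_sum by (fastforce simp: start_paths_def paths_def)
  moreover have "card (\<Union>n<L. ?A n) = (\<Sum>n<L. card (?A n))"
  proof (rule card_UN_disjoint)
    show "\<forall>n\<in>{..<L}. finite (?A n)" using finite_paths by simp
    show "\<forall>i\<in>{..<L}. \<forall>j\<in>{..<L}. i \<noteq> j \<longrightarrow> ?A i \<inter> ?A j = {}" by (auto simp: paths_def)
  qed simp
  ultimately show "fps_nth (Abs_fps (\<lambda>w. of_nat (card (start_paths k h w)))) w
      = fps_nth (\<Sum>n<L. first_factor n * (bailey_sum (int k - 1) n (h - 1) + bailey_sum (int k - 1) n h)) w"
    unfolding rising_gf_SE[OF assms, symmetric] by (simp add: fps_sum_nth rising_gf_def)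
qed

section \<open>Lattice paths\<close>

fun step_weight :: "step \<Rightarrow> int" where
  "step_weight NE_step = 1" | "step_weight SE_step = 1" | "step_weight N_step = 0" | "step_weight E_step = 1"

definition total_weight :: "step list \<Rightarrow> int" where "total_weight S = sum_list (map step_weight S)"

definition total_height :: "step list \<Rightarrow> int" where "total_height S = sum_list (map step_height S)"

lemma total_weight_simps [simp]: "total_weight [] = 0" "total_weight (x # S) = step_weight x + total_weight S" "total_weight (S @ S') = total_weight S + total_weight S'"
  by (simp_all add: total_weight_def)

lemma total_height_simps [simp]: "total_height [] = 0" "total_height (x # S) = step_height x + total_height S" "total_height (S @ S') = total_height S + total_height S'"
  by (simp_all add: total_height_def)

lemma fold_move: "fold move S (x, y) = (x + total_weight S, y + total_height S)"
proof (induction S arbitrary: x y)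
  case (Cons s S)
  then show ?case by (cases s) simp_all
qed simp

lemma weight_eq: "weight (h, S) i = total_weight (take i S)"
  by (simp add: weight_def vertex_def fold_move)

lemma height_eq: "height (h, S) i = h + total_height (take i S)"
  by (simp add: height_def vertex_def fold_move)

lemma total_weight_nonneg: "0 \<le> total_weight S"
proof (induction S)
  case (Cons x S)
  then show ?case by (cases x) auto
qed simp

lemma total_weight_take_mono: "i \<le> j \<Longrightarrow> total_weight (take i S) \<le> total_weight (take j S)"
  using total_weight_nonneg[of "take (j - i) (drop i S)"] by (auto simp: le_iff_add take_add)

lemma total_weight_take_less:
  assumes "i < j" "j \<le> length S" "S ! i = SE_step"
  shows "total_weight (take i S) < total_weight (take j S)"
proof -
  have "total_weight (take (Suc i) S) = total_weight (take i S) + 1"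
    using assms by (simp add: take_Suc_conv_app_nth)
  then show ?thesis using total_weight_take_mono[of "Suc i" j S] assms(1) by simp
qed

lemma count_list_take: "i \<le> length S \<Longrightarrow> count_list (take i S) y = card {j. j < i \<and> S ! j = y}"
  by (auto simp: count_list_eq_length_filter length_filter_conv_card min_def intro!: arg_cong[of _ _ card])

lemma total_weight_total_height_parity: "even (total_weight S + total_height S + int (count_list S N_step) + int (count_list S E_step))"
proof (induction S)
  case (Cons x S)
  then show ?case by (cases x) auto
qed simp

lemma peak_iff: "peak (h, S) i \<longleftrightarrow> i < length S \<and> is_up ((SE_step # S) ! i) \<and> S ! i = SE_step"
  by (cases i) (auto simp: peak_def is_up_def)

lemma sum_peaks:
  "(\<Sum>i<length S. if is_up ((s # S) ! i) \<and> S ! i = SE_step then c + total_weight (take i S) else 0) = c * int (peaks s S) + int (peak_sum s S)"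
proof (induction S arbitrary: s c)
  case (Cons x S)
  have "(\<Sum>i<length S. if is_up ((x # S) ! i) \<and> S ! i = SE_step then c + (step_weight x + total_weight (take i S)) else 0)
      = (c + step_weight x) * int (peaks x S) + int (peak_sum x S)"
    using Cons.IH[of x "c + step_weight x"] by (simp only: add.assoc)
  then show ?case
    unfolding length_Cons sum.lessThan_Suc_shift nth_Cons_Suc nth_Cons_0 take_Suc_Cons total_weight_simps
    by (cases x) (simp_all add: algebra_simps)
qed simp

lemma major_index_eq: "major_index (h, S) = int (peak_sum SE_step S)"
proof -
  have "{i. peak (h, S) i} = {i \<in> {..<length S}. is_up ((SE_step # S) ! i) \<and> S ! i = SE_step}"
    by (auto simp: peak_iff)
  then have "major_index (h, S) = (\<Sum>i<length S. if is_up ((SE_step # S) ! i) \<and> S ! i = SE_step then total_weight (take i S) else 0)"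
    unfolding major_index_def weight_eq by (simp only: sum.inter_filter[OF finite_lessThan])
  then show ?thesis
    using sum_peaks[where S = S and s = SE_step and c = 0, unfolded add_0 mult_zero_left] by simp
qed

definition proper :: "step \<Rightarrow> int \<Rightarrow> step list \<Rightarrow> bool" where
  "proper s h S \<longleftrightarrow> (\<forall>i<Suc (length S). 0 \<le> h + total_height (take i S)) \<and> h + total_height S = 0 \<and>
     (\<forall>i<length S. S ! i = E_step \<longrightarrow> h + total_height (take i S) = 0) \<and>
     (\<forall>i<length S. (s # S) ! i = N_step \<longrightarrow> S ! i = SE_step) \<and> last (s # S) = SE_step"

definition under_ceiling :: "nat \<Rightarrow> bool \<Rightarrow> int \<Rightarrow> step list \<Rightarrow> bool" where
  "under_ceiling k p h S \<longleftrightarrow> (\<forall>i<Suc (length S). h + total_height (take i S) + of_bool (p \<noteq> odd (count_list (take i S) E_step)) < int k)"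

lemma admissible_iff: "admissible k p s h S \<longleftrightarrow> proper s h S \<and> under_ceiling k p h S"
proof (induction S arbitrary: p s h)
  case Nil
  then show ?case by (auto simp: proper_def under_ceiling_def)
next
  case (Cons x S)
  have 1: "proper s h (x # S) \<longleftrightarrow> 0 \<le> h \<and> (x = E_step \<longrightarrow> h = 0) \<and> (s = N_step \<longrightarrow> x = SE_step) \<and> proper x (h + step_height x) S"
    unfolding proper_def length_Cons All_less_Suc2 by (auto simp: add.assoc)
  have "(p \<noteq> odd (count_list (take (Suc i) (x # S)) E_step)) = ((p \<noteq> (x = E_step)) \<noteq> odd (count_list (take i S) E_step))" for i
    by auto
  then have 2: "under_ceiling k p h (x # S) \<longleftrightarrow> h + of_bool p < int k \<and> under_ceiling k (p \<noteq> (x = E_step)) (h + step_height x) S"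
    unfolding under_ceiling_def length_Cons All_less_Suc2[of "Suc (length S)"] by (simp add: add.assoc)
  show ?case unfolding 1 2 admissible.simps Cons.IH by blast
qed

section \<open>Relative height and the ceiling\<close>

lemma Greatest_int_satisfies:
  fixes P :: "int \<Rightarrow> bool"
  assumes "P a" "\<And>y. P y \<Longrightarrow> y \<le> b"
  shows "P (Greatest P)"
proof -
  let ?A = "{y. P y \<and> a \<le> y}"
  have fin: "finite ?A" by (rule finite_subset[of _ "{a..b}"]) (auto dest: assms(2))
  have ne: "?A \<noteq> {}" using assms(1) by auto
  have "P (Max ?A)" using Max_in[OF fin ne] by blast
  moreover have "y \<le> Max ?A" if "P y" for y
  proof (cases "a \<le> y")
    case True
    then show ?thesis using that fin by (intro Max_ge) auto
  next
    case False
    then show ?thesis using Max_ge[OF fin, of a] assms(1) by simp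
  qed
  ultimately have "Greatest P = Max ?A" by (rule Greatest_equality)
  then show ?thesis using \<open>P (Max ?A)\<close> by simp
qed

context
  fixes h :: int and S :: "step list"
  assumes proper: "proper SE_step h S"
begin

private abbreviation (input) "H i \<equiv> h + total_height (take i S)"

private lemma H_nonneg: "i \<le> length S \<Longrightarrow> 0 \<le> H i"
  using proper by (simp add: proper_def less_Suc_eq_le)

private lemma H_last: "H (length S) = 0"
  using proper by (simp add: proper_def)

private lemma E_at_0: "i < length S \<Longrightarrow> S ! i = E_step \<Longrightarrow> H i = 0"
  using proper by (simp add: proper_def)

private lemma H_Suc: "i < length S \<Longrightarrow> H (Suc i) = H i + step_height (S ! i)"
  by (simp add: take_Suc_conv_app_nth)

private lemma N_then_SE:
  assumes "i < length S" "S ! i = N_step"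
  shows "Suc i < length S" "S ! Suc i = SE_step"
proof -
  have "last S = SE_step" using proper assms(1) by (auto simp: proper_def split: if_splits)
  moreover have "S \<noteq> []" using assms(1) by auto
  ultimately have "S ! (length S - 1) = SE_step" by (simp add: last_conv_nth)
  then have "i \<noteq> length S - 1" using assms(2) by auto
  then show i: "Suc i < length S" using assms(1) by simp
  show "S ! Suc i = SE_step" using proper i assms(2) unfolding proper_def by (metis nth_Cons_Suc)
qed

private lemma nse_peak_iff: "nse_peak (h, S) i \<longleftrightarrow> (\<exists>j<length S. i = Suc j \<and> S ! j = N_step)"
  using N_then_SE by (cases i) (auto simp: nse_peak_def peak_iff is_up_def)

private lemma nse_count_eq:
  assumes "peak (h, S) i"
  shows "nse_count (h, S) (weight (h, S) i) = count_list (take i S) N_step"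
proof -
  have i: "i < length S" "S ! i = SE_step" using assms by (auto simp: peak_iff)
  have "nse_peak (h, S) j \<and> weight (h, S) j \<le> weight (h, S) i \<longleftrightarrow> j \<in> Suc ` {j. j < i \<and> S ! j = N_step}" for j
  proof
    assume a: "nse_peak (h, S) j \<and> weight (h, S) j \<le> weight (h, S) i"
    then have "\<not> i < j" using total_weight_take_less[of i j S] i by (auto simp: weight_eq nse_peak_iff)
    then show "j \<in> Suc ` {j. j < i \<and> S ! j = N_step}" using a by (auto simp: nse_peak_iff)
  next
    assume "j \<in> Suc ` {j. j < i \<and> S ! j = N_step}"
    then show "nse_peak (h, S) j \<and> weight (h, S) j \<le> weight (h, S) i"
      using i by (auto simp: nse_peak_iff weight_eq intro!: total_weight_take_mono)
  qed
  then have "nse_count (h, S) (weight (h, S) i) = card (Suc ` {j. j < i \<and> S ! j = N_step})"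
    unfolding nse_count_def by (intro arg_cong[of _ _ card]) blast
  then show ?thesis using i by (simp add: card_image count_list_take)
qed

private definition "drops i x \<longleftrightarrow> (\<exists>u\<le>length S. \<exists>v\<le>length S. H u = H i - x \<and> H v = H i - x \<and>
  total_weight (take u S) \<le> total_weight (take i S) \<and> total_weight (take i S) < total_weight (take v S) \<and>
  (\<forall>j. u \<le> j \<and> j \<le> v \<and> peak (h, S) j \<longrightarrow> H j \<le> H i \<and> (H j = H i \<longrightarrow> total_weight (take i S) \<le> total_weight (take j S))))"

private lemma dropsI:
  assumes "u \<le> length S" "v \<le> length S" "H u = H i - x" "H v = H i - x"
    "total_weight (take u S) \<le> total_weight (take i S)" "total_weight (take i S) < total_weight (take v S)"
    "\<And>j. u \<le> j \<Longrightarrow> j \<le> v \<Longrightarrow> peak (h, S) j \<Longrightarrow> H j \<le> H i \<and> (H j = H i \<longrightarrow> total_weight (take i S) \<le> total_weight (take j S))"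
  shows "drops i x"
  unfolding drops_def using assms by blast

private lemma relative_height_eq: "relative_height (h, S) i = (GREATEST x. drops i x)"
  unfolding relative_height_def drops_def height_eq weight_eq by simp

private lemma drops_le: "drops i x \<Longrightarrow> x \<le> H i"
  using H_nonneg by (force simp: drops_def)

private lemma drops_relative_height:
  assumes "peak (h, S) i"
  shows "drops i (relative_height (h, S) i)"
  unfolding relative_height_eq
proof (rule Greatest_int_satisfies)
  obtain j where i: "i = Suc j" "i < length S" "is_up (S ! j)" "S ! i = SE_step"
    using assms by (cases i) (auto simp: peak_iff)
  have "H i = H j + 1" using H_Suc[of j] i by (auto simp: is_up_def)
  moreover have "H (Suc i) = H i - 1" using H_Suc[of i] i by simp
  moreover have "l = i" if "j \<le> l" "l \<le> Suc i" "peak (h, S) l" for l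
  proof -
    have "l = j \<or> l = i \<or> l = Suc i" using that i(1) by auto
    moreover have "l \<noteq> j" using that i by (auto simp: peak_iff)
    moreover have "l \<noteq> Suc i" using that i by (auto simp: peak_iff)
    ultimately show ?thesis by blast
  qed
  ultimately have Hs: "H i = H j + 1" "H (Suc i) = H i - 1"
    and only: "\<And>l. j \<le> l \<Longrightarrow> l \<le> Suc i \<Longrightarrow> peak (h, S) l \<Longrightarrow> l = i" by blast+
  show "drops i 1"
  proof (rule dropsI[of j "Suc i"])
    show "H l \<le> H i \<and> (H l = H i \<longrightarrow> total_weight (take i S) \<le> total_weight (take l S))" if "j \<le> l" "l \<le> Suc i" "peak (h, S) l" for l
      using only[OF that] by simp
  qed (use i Hs total_weight_take_mono[of j i S] total_weight_take_less[of i "Suc i" S] in simp_all)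
  show "x \<le> H i" if "drops i x" for x using that by (rule drops_le)
qed

private lemma peak_parity:
  assumes "peak (h, S) i" "H i = int k - 1" "h = int k - int a"
  shows "[weight (h, S) i = int (nse_count (h, S) (weight (h, S) i)) + int a - 1] (mod 2) \<longleftrightarrow> even (count_list (take i S) E_step)"
proof -
  have "total_height (take i S) = int a - 1" using assms(2,3) by simp
  then have "even (total_weight (take i S) + (int a - 1) + int (count_list (take i S) N_step) + int (count_list (take i S) E_step))"
    using total_weight_total_height_parity[of "take i S"] by simp
  moreover have "[weight (h, S) i = int (nse_count (h, S) (weight (h, S) i)) + int a - 1] (mod 2) \<longleftrightarrow>
      even (total_weight (take i S) - (int (count_list (take i S) N_step) + int a - 1))"
    unfolding nse_count_eq[OF assms(1)] by (simp add: weight_eq cong_iff_dvd_diff)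
  ultimately show ?thesis by (auto simp: algebra_simps)
qed

text \<open>A peak of relative height k-1 has height k-1, which the ceiling allows only with an even
  number of E steps. Conversely, a vertex violating the ceiling is traced back to a peak of relative
  height k-1 with the same odd number of E steps, where the parity condition fails.\<close>

lemma ceiling_iff:
  assumes "h = int k - int a" "2 \<le> k"
  shows "(\<forall>i\<le>length S. H i < int k) \<and>
     (\<forall>i. peak (h, S) i \<and> relative_height (h, S) i = int k - 1 \<longrightarrow>
        [weight (h, S) i = int (nse_count (h, S) (weight (h, S) i)) + int a - 1] (mod 2)) \<longleftrightarrow> under_ceiling k False h S"
    (is "?bound \<and> ?parity \<longleftrightarrow> _")
proof (intro iffI conjI)
  assume u: "under_ceiling k False h S"
  have c: "H i + of_bool (odd (count_list (take i S) E_step)) < int k" if "i \<le> length S" for i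
    using u that by (simp add: under_ceiling_def less_Suc_eq_le)
  show ?bound using c by (force simp: of_bool_def split: if_splits)
  show ?parity
  proof (intro allI impI)
    fix i assume i: "peak (h, S) i \<and> relative_height (h, S) i = int k - 1"
    then have "int k - 1 \<le> H i" using drops_relative_height[of i] drops_le by metis
    moreover have "i \<le> length S" using i by (simp add: peak_iff)
    ultimately have "H i = int k - 1" "even (count_list (take i S) E_step)"
      using c[of i] by (auto simp: of_bool_def split: if_splits)
    then show "[weight (h, S) i = int (nse_count (h, S) (weight (h, S) i)) + int a - 1] (mod 2)"
      using peak_parity[of i k a] i assms(1) by simp
  qed
next
  assume "?bound \<and> ?parity"
  then have bound: "\<And>i. i \<le> length S \<Longrightarrow> H i < int k" and parity: ?parity by blast+
  show "under_ceiling k False h S"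
  proof (rule ccontr)
    assume "\<not> under_ceiling k False h S"
    then obtain i where i: "i \<le> length S" "\<not> H i + of_bool (odd (count_list (take i S) E_step)) < int k"
      by (auto simp: under_ceiling_def less_Suc_eq_le)
    then have Hi: "H i = int k - 1" and odd: "odd (count_list (take i S) E_step)"
      using bound[of i] by (auto simp: of_bool_def split: if_splits)
    let ?Z = "{u. u \<le> i \<and> H u = 0}"
    have "count_list (take i S) E_step \<noteq> 0" using odd by (metis even_zero)
    then obtain j where "j < i" "S ! j = E_step" using i(1) by (auto simp: count_list_take)
    then have "j \<in> ?Z" using E_at_0[of j] i(1) by simp
    \<comment> \<open>The last visit to height 0 up to i, which exists because of the E step found
      above; no E step lies between it and i.\<close>
    define u where "u = Max ?Z"
    have fin: "finite ?Z" by simp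
    have u: "u \<le> i" "H u = 0" using Max_in[OF fin] \<open>j \<in> ?Z\<close> unfolding u_def by blast+
    have u_max: "H l \<noteq> 0" if "u < l" "l \<le> i" for l
      using Max_ge[OF fin, of l] that unfolding u_def[symmetric] by auto
    have k1: "int k - 1 > 0" using assms(2) by simp
    then have "u \<noteq> i" using u(2) Hi by auto
    then have "u < i" using u(1) by simp
    \<comment> \<open>The first vertex of height k-1 after u. It is reached by a rise, and the
      ceiling k-1 forces a descent after it.\<close>
    define m where "m = (LEAST m. u < m \<and> H m = int k - 1)"
    have m: "u < m" "H m = int k - 1"
      using LeastI[of "\<lambda>m. u < m \<and> H m = int k - 1" i] \<open>u < i\<close> Hi unfolding m_def by blast+
    have m_least: "m \<le> l" if "u < l" "H l = int k - 1" for l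
      unfolding m_def by (rule Least_le) (use that in blast)
    have "m \<le> i" using m_least[OF \<open>u < i\<close> Hi] .
    then have "m \<le> length S" using i(1) by simp
    moreover have "m \<noteq> length S" using m(2) H_last k1 by auto
    ultimately have mlt: "m < length S" by simp
    obtain m' where m': "m = Suc m'" using m(1) by (cases m) auto
    have "is_up (S ! m')"
    proof (cases "S ! m'")
      case SE_step
      then have "H m' = int k" using H_Suc[of m'] m(2) m' mlt by simp
      then show ?thesis using bound[of m'] m' mlt by simp
    next
      case E_step
      then have "H m = 0" using H_Suc[of m'] E_at_0[of m'] m' mlt by simp
      then show ?thesis using m(2) k1 by simp
    qed simp_all
    moreover have "S ! m = SE_step"
    proof (cases "S ! m")
      case E_step
      then show ?thesis using E_at_0[of m] mlt m(2) k1 by simp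
    qed (use H_Suc[of m] mlt m(2) bound[of "Suc m"] in simp_all)
    ultimately have peak: "peak (h, S) m" using m' mlt by (simp add: peak_iff)
    \<comment> \<open>The two bounding vertices are u and the end of the path, both at height 0. By
      the choice of m no peak of height k-1 lies between u and m.\<close>
    have "drops m (int k - 1)"
    proof (rule dropsI[of u "length S"])
      show "u \<le> length S" using u(1) i(1) by simp
      show "total_weight (take u S) \<le> total_weight (take m S)" using m(1) by (intro total_weight_take_mono) simp
      show "total_weight (take m S) < total_weight (take (length S) S)" using mlt \<open>S ! m = SE_step\<close> by (intro total_weight_take_less) auto
      fix j assume j: "u \<le> j" "j \<le> length S" "peak (h, S) j"
      have "total_weight (take m S) \<le> total_weight (take j S)" if Hj: "H j = H m"
      proof (rule total_weight_take_mono)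
        have "j \<noteq> u" using u(2) m(2) k1 Hj by auto
        then show "m \<le> j" using m_least[of j] j(1) Hj m(2) by simp
      qed
      then show "H j \<le> H m \<and> (H j = H m \<longrightarrow> total_weight (take m S) \<le> total_weight (take j S))"
        using bound[OF j(2)] m(2) by simp
    qed (use m(2) u(2) H_last in simp_all)
    then have "relative_height (h, S) m = int k - 1"
      unfolding relative_height_eq using drops_le[of m] m(2) by (intro Greatest_equality) auto
    then have "even (count_list (take m S) E_step)"
      using parity peak peak_parity[OF peak m(2) assms(1)] by blast
    moreover have "{j. j < i \<and> S ! j = E_step} = {j. j < m \<and> S ! j = E_step}"
    proof -
      have "S ! j \<noteq> E_step" if "u \<le> j" "j < i" for j
      proof
        assume E: "S ! j = E_step"
        then have "H j = 0" using E_at_0[of j] that i(1) by simp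
        moreover have "H (Suc j) = H j" using H_Suc[of j] E that i(1) by simp
        ultimately show False using u_max[of "Suc j"] that by simp
      qed
      then show ?thesis using \<open>m \<le> i\<close> m(1) by (metis less_imp_le_nat less_le_trans linorder_not_less order_less_imp_le)
    qed
    ultimately show False using odd i(1) \<open>m \<le> length S\<close> by (simp add: count_list_take)
  qed
qed

text \<open>All depends on the first step c other than NE. The positive height excludes E. If c =
  SE, the path starts with SE or its leftmost peak is NESE; if c = N, the leftmost peak is NSE and
  the path starts with NE or N.\<close>

lemma first_peak_iff:
  assumes "0 < h"
  shows "(\<forall>i. nse_peak (h, S) i \<and> (\<forall>j. peak (h, S) j \<longrightarrow> i \<le> j) \<longrightarrow> S ! 0 = SE_step \<or> (fst (h, S) = 0 \<and> S ! 0 = E_step))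
     \<longleftrightarrow> first_peak_NESE S" (is "?first \<longleftrightarrow> _")
proof -
  have "S \<noteq> []" using assms proper by (auto simp: proper_def)
  then have last: "last S = SE_step" using proper by (simp add: proper_def)
  define j where "j = length (takeWhile (\<lambda>x. x = NE_step) S)"
  have "SE_step \<in> set S" using last last_in_set[OF \<open>S \<noteq> []\<close>] by simp
  then have "dropWhile (\<lambda>x. x = NE_step) S \<noteq> []"
    by (auto simp: dropWhile_eq_Nil_conv)
  then obtain c r where cr: "dropWhile (\<lambda>x. x = NE_step) S = c # r" by (meson neq_Nil_conv)
  then have c: "c \<noteq> NE_step" using hd_dropWhile[of "\<lambda>x. x = NE_step" S] by simp
  have "takeWhile (\<lambda>x. x = NE_step) S = replicate j NE_step"
    unfolding j_def by (rule replicate_length_same[symmetric]) (auto dest: set_takeWhileD)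
  then have S: "S = replicate j NE_step @ c # r" using takeWhile_dropWhile_id[of "\<lambda>x. x = NE_step" S] cr by simp
  have ne: "S ! l = NE_step" if "l < j" for l using that by (simp add: S nth_append)
  have cj: "S ! j = c" and jlt: "j < length S" by (simp_all add: S nth_append)
  have fp: "first_peak_NESE S \<longleftrightarrow> c = SE_step"
  proof -
    have "first_peak_NESE (replicate j NE_step @ c # r) \<longleftrightarrow> first_peak_NESE (c # r)"
      by (induction j) auto
    then show ?thesis using c by (cases c) (simp_all add: S)
  qed
  show ?thesis
  proof (cases "c = SE_step")
    case True
    have ?first
    proof (intro allI impI)
      fix i assume i: "nse_peak (h, S) i \<and> (\<forall>j. peak (h, S) j \<longrightarrow> i \<le> j)"
      then obtain l where l: "i = Suc l" "S ! l = N_step" by (auto simp: nse_peak_iff)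
      show "S ! 0 = SE_step \<or> (fst (h, S) = 0 \<and> S ! 0 = E_step)"
      proof (cases j)
        case 0
        then show ?thesis using cj True by simp
      next
        case (Suc j')
        then have "peak (h, S) j" using ne[of j'] cj True jlt by (simp add: peak_iff)
        then have "l < j" using i l(1) by force
        then show ?thesis using ne[of l] l(2) by simp
      qed
    qed
    then show ?thesis using fp True by blast
  next
    case False
    have "H j = h + int j"
    proof -
      have "total_height (replicate j NE_step) = int j" by (induction j) auto
      then show ?thesis by (simp add: S)
    qed
    then have "c \<noteq> E_step" using E_at_0[OF jlt] cj assms by auto
    then have cN: "c = N_step" using c False by (cases c) auto
    then have "nse_peak (h, S) (Suc j)" using cj jlt by (simp add: nse_peak_iff)
    moreover have "Suc j \<le> l" if "peak (h, S) l" for l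
    proof (rule ccontr)
      assume "\<not> Suc j \<le> l"
      then have "S ! l \<noteq> SE_step" using ne[of l] cj cN by (cases "l = j") auto
      then show False using that by (simp add: peak_iff)
    qed
    moreover have "S ! 0 \<noteq> SE_step" using ne[of 0] cj cN by (cases j) auto
    ultimately have "\<not> ?first" using assms by auto
    then show ?thesis using fp False by blast
  qed
qed

end

lemma lattice_path_iff:
  assumes "0 < h"
  shows "lattice_path (h, S) \<longleftrightarrow> proper SE_step h S \<and> first_peak_NESE S"
proof -
  have N: "(\<forall>i. i + 1 < length S \<and> S ! i = N_step \<longrightarrow> S ! (i + 1) = SE_step) \<longleftrightarrow>
      (\<forall>i<length S. (SE_step # S) ! i = N_step \<longrightarrow> S ! i = SE_step)"
  proof (intro iffI allI impI)
    fix i assume a: "\<forall>i. i + 1 < length S \<and> S ! i = N_step \<longrightarrow> S ! (i + 1) = SE_step"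
      "i < length S" "(SE_step # S) ! i = N_step"
    then show "S ! i = SE_step" by (cases i) auto
  next
    fix i assume a: "\<forall>i<length S. (SE_step # S) ! i = N_step \<longrightarrow> S ! i = SE_step" "i + 1 < length S \<and> S ! i = N_step"
    then show "S ! (i + 1) = SE_step" using spec[OF a(1), of "Suc i"] by simp
  qed
  have "proper SE_step h S \<longleftrightarrow> (\<forall>i\<le>length S. 0 \<le> weight (h, S) i \<and> 0 \<le> height (h, S) i) \<and>
     height (h, S) (length S) = 0 \<and> (\<forall>i<length S. S ! i = E_step \<longrightarrow> height (h, S) i = 0) \<and>
     (\<forall>i. i + 1 < length S \<and> S ! i = N_step \<longrightarrow> S ! (i + 1) = SE_step) \<and> (S = [] \<or> last S = SE_step)"
    unfolding N proper_def height_eq weight_eq less_Suc_eq_le using total_weight_nonneg by auto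
  then show ?thesis
    unfolding lattice_path_def snd_conv using first_peak_iff[OF _ assms, of S] by blast
qed

lemma F_bar_eq_card:
  assumes "1 \<le> a" "a < k"
  shows "F_bar k a n = card (start_paths k (int k - int a) n)"
proof -
  let ?h = "int k - int a"
  have h: "0 < ?h" using assms by simp
  let ?P = "\<lambda>P. lattice_path P \<and> special_conditions k a P \<and> major_index P = int n \<and>
     (\<forall>i. peak P i \<and> relative_height P i = int k - 1 \<longrightarrow>
        [weight P i = int (nse_count P (weight P i)) + int a - 1] (mod 2))"
  have "?P (?h, S) \<longleftrightarrow> S \<in> start_paths k ?h n" for S
  proof (cases "proper SE_step ?h S")
    case True
    have "2 \<le> k" using assms by simp
    have sc: "special_conditions k a (?h, S) \<longleftrightarrow> (\<forall>i\<le>length S. ?h + total_height (take i S) < int k)"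
      by (simp add: special_conditions_def height_eq)
    show ?thesis
      using ceiling_iff[OF True refl \<open>2 \<le> k\<close>]
      unfolding lattice_path_iff[OF h] sc start_paths_def mem_Collect_eq admissible_iff major_index_eq of_nat_eq_iff
      by blast
  next
    case False
    then show ?thesis by (simp add: lattice_path_iff[OF h] start_paths_def admissible_iff)
  qed
  moreover have "fst P = ?h" if "?P P" for P using that by (simp add: special_conditions_def)
  ultimately have "{P. ?P P} = Pair ?h ` start_paths k ?h n"
  proof -
    assume 1: "\<And>S. ?P (?h, S) \<longleftrightarrow> S \<in> start_paths k ?h n" and 2: "\<And>P. ?P P \<Longrightarrow> fst P = ?h"
    have "?P P \<longleftrightarrow> P \<in> Pair ?h ` start_paths k ?h n" for P
    proof
      assume P: "?P P"
      then have "P = (?h, snd P)" using 2[OF P] by (metis prod.collapse)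
      then show "P \<in> Pair ?h ` start_paths k ?h n" using 1[of "snd P"] P by (metis imageI)
    next
      assume "P \<in> Pair ?h ` start_paths k ?h n"
      then obtain S where "P = (?h, S)" "S \<in> start_paths k ?h n" by blast
      then show "?P P" using 1[of S] by (simp only:)
    qed
    then show ?thesis by blast
  qed
  then have "F_bar k a n = card (Pair ?h ` start_paths k ?h n)" unfolding F_bar_def by (rule arg_cong)
  also have "\<dots> = card (start_paths k ?h n)" by (intro card_image) (auto simp: inj_on_def)
  finally show ?thesis .
qed

lemma F_bar_eq_upto_sum:
  assumes "1 \<le> a" "a < k"
  shows "eq_upto L (Abs_fps (\<lambda>n. of_nat (F_bar k a n))) (\<Sum>n<L. first_factor n * (bailey_sum (int k - 1) n (int k - int a - 1) + bailey_sum (int k - 1) n (int k - int a)))"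
  unfolding F_bar_eq_card[OF assms] using assms by (intro start_paths_eq_upto) auto

lemma F_bar_eq_upto_theta:
  assumes "1 \<le> a" "a < k"
  shows "eq_upto L (Abs_fps (\<lambda>n. of_nat (F_bar k a n))) (plus_qfac L * inv_qfac fps_X (int L) * theta (2 * k - 1) a L)"
proof -
  have e: "2 * (k - 1) + 1 = 2 * k - 1" "(k - 1) + 1 - (k - a) = a" "int (k - 1) = int k - 1" "int (k - a) = int k - int a"
    using assms by auto
  have "eq_upto L (\<Sum>n<L. first_factor n * (bailey_sum (int k - 1) n (int k - int a - 1) + bailey_sum (int k - 1) n (int k - int a)))
     (plus_qfac L * inv_qfac fps_X (int L) * theta (2 * k - 1) a L)"
    using first_factor_bailey_sum_sum[of "k - a" "k - 1" L] assms unfolding e by simp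
  then show ?thesis using F_bar_eq_upto_sum[OF assms] eq_upto_trans by blast
qed

lemma product_eq_upto_theta:
  assumes "1 \<le> a" "a < k"
  shows "eq_upto L (qpoch_inf (- fps_X) fps_X * (qpoch_inf (fps_X ^ a) (fps_X ^ (2 * k - 1))
          * qpoch_inf (fps_X ^ (2 * k - 1 - a)) (fps_X ^ (2 * k - 1))
          * qpoch_inf (fps_X ^ (2 * k - 1)) (fps_X ^ (2 * k - 1))) / qpoch_inf fps_X fps_X)
     (plus_qfac L * inv_qfac fps_X (int L) * theta (2 * k - 1) a L)"
proof -
  let ?M = "2 * k - 1" and ?B = "qpoch_inf fps_X fps_X"
  have M: "0 < ?M" "a < ?M" "0 < a" using assms by auto
  have inf: "eq_upto N (qpoch_inf (fps_X ^ b) (fps_X ^ M)) (\<Prod>i<N. 1 - fps_X ^ b * (fps_X ^ M) ^ i)"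
    if "0 < b" "0 < M" for b M N
    using that by (intro qpoch_inf_eq_upto) (auto simp: fps_nth_power_0 zero_power)
  have B: "eq_upto N ?B (qfac fps_X N)" for N
    using inf[of 1 1 N] by (simp add: qfac_def)
  have "fps_nth ?B 0 = 1" using B[of 1] by (simp add: eq_upto_def qfac_def)
  then have unit: "inverse ?B * ?B = 1" by (intro inverse_mult_eq_1) simp
  have inv: "eq_upto L (inverse ?B) (inv_qfac fps_X (int L))"
  proof -
    have "inverse ?B = inverse ?B * (qfac fps_X L * inv_qfac fps_X (int L))"
      using inv_qfac_mult_qfac[OF fps_X_nth_0, of L] by (simp add: mult.commute)
    also have "eq_upto L \<dots> (inverse ?B * (?B * inv_qfac fps_X (int L)))"
      by (intro eq_upto_mult eq_upto_refl eq_upto_sym[OF B])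
    also have "\<dots> = inv_qfac fps_X (int L)" by (simp only: mult.assoc[symmetric] unit mult_1)
    finally show ?thesis .
  qed
  have "eq_upto L (qpoch_inf (fps_X ^ a) (fps_X ^ ?M) * qpoch_inf (fps_X ^ (?M - a)) (fps_X ^ ?M) * qpoch_inf (fps_X ^ ?M) (fps_X ^ ?M))
      ((\<Prod>i<L. 1 - fps_X ^ a * (fps_X ^ ?M) ^ i) * (\<Prod>i<L. 1 - fps_X ^ (?M - a) * (fps_X ^ ?M) ^ i) * (\<Prod>i<L. 1 - fps_X ^ ?M * (fps_X ^ ?M) ^ i))"
    using M by (intro eq_upto_mult inf) auto
  also have "\<dots> = qfac (fps_X ^ ?M) L * ((\<Prod>i<L. 1 - fps_X ^ a * (fps_X ^ ?M) ^ i) * (\<Prod>i<L. 1 - fps_X ^ (?M - a) * (fps_X ^ ?M) ^ i))"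
    by (simp add: qfac_def mult.commute)
  also have "eq_upto L \<dots> (theta ?M a L)"
    using M by (intro eq_upto_sym[OF jacobi_triple_eq_upto]) auto
  finally have "eq_upto L (qpoch_inf (- fps_X) fps_X * (qpoch_inf (fps_X ^ a) (fps_X ^ ?M) * qpoch_inf (fps_X ^ (?M - a)) (fps_X ^ ?M) * qpoch_inf (fps_X ^ ?M) (fps_X ^ ?M)) * inverse ?B)
      (plus_qfac L * theta ?M a L * inv_qfac fps_X (int L))"
    by (intro eq_upto_mult qpoch_inf_minus_X inv)
  then show ?thesis
    unfolding divide_eq_mult_inverse[OF unit] by (simp only: mult_ac)
qed

theorem theorem1p4:
  fixes k a :: nat and q :: "real fps"
  assumes "k - 1 \<ge> a" and "a \<ge> 1"
  defines "q \<equiv> fps_X"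
  shows "(\<forall>n. F_bar k a n = D_bar k a n) \<and>
    ((\<lambda>N. q ^ ((N 1 + 1) * N 1 div 2 + (\<Sum>i=2..k-1. (N i)\<^sup>2) + (\<Sum>i=a+1..k-1. N i))
           * qpoch (- q) q (int (N 1) - 1) * (1 + q ^ N a)
           / ((\<Prod>i=1..k-2. qpoch q q (int (N i) - int (N (i + 1))))
               * qpoch (q ^ 2) (q ^ 2) (int (N (k - 1)))))
      has_sum Abs_fps (\<lambda>n. of_nat (F_bar k a n))) (decreasing_tuples (k - 1)) \<and>
    Abs_fps (\<lambda>n. of_nat (F_bar k a n)) =
      qpoch_inf (- q) q * (qpoch_inf (q ^ a) (q ^ (2 * k - 1))
          * qpoch_inf (q ^ (2 * k - 1 - a)) (q ^ (2 * k - 1))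
          * qpoch_inf (q ^ (2 * k - 1)) (q ^ (2 * k - 1)))
        / qpoch_inf q q"
proof (intro conjI)
  have a: "1 \<le> a" "a < k" "a + 1 \<le> k" using assms(1,2) by auto
  have "Abs_fps (\<lambda>n. of_nat (F_bar k a n)) = (Abs_fps (\<lambda>n. of_nat (D_bar k a n)) :: real fps)"
    by (rule eq_upto_all_imp_eq) (rule eq_upto_trans[OF F_bar_eq_upto_theta eq_upto_sym[OF D_bar_eq_upto]], use a in auto)
  then show "\<forall>n. F_bar k a n = D_bar k a n" by (simp add: fps_eq_iff)
  show "((\<lambda>N. q ^ ((N 1 + 1) * N 1 div 2 + (\<Sum>i=2..k-1. (N i)\<^sup>2) + (\<Sum>i=a+1..k-1. N i))
           * qpoch (- q) q (int (N 1) - 1) * (1 + q ^ N a)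
           / ((\<Prod>i=1..k-2. qpoch q q (int (N i) - int (N (i + 1))))
               * qpoch (q ^ 2) (q ^ 2) (int (N (k - 1)))))
      has_sum Abs_fps (\<lambda>n. of_nat (F_bar k a n))) (decreasing_tuples (k - 1))"
    using summand_has_sum[OF a(1,3) F_bar_eq_upto_sum[OF a(1,2)]]
    unfolding q_def summand_def[OF a(1,3), abs_def] .
  show "Abs_fps (\<lambda>n. of_nat (F_bar k a n)) =
      qpoch_inf (- q) q * (qpoch_inf (q ^ a) (q ^ (2 * k - 1))
          * qpoch_inf (q ^ (2 * k - 1 - a)) (q ^ (2 * k - 1))
          * qpoch_inf (q ^ (2 * k - 1)) (q ^ (2 * k - 1)))
        / qpoch_inf q q"
    unfolding q_def
    by (rule eq_upto_all_imp_eq) (rule eq_upto_trans[OF F_bar_eq_upto_theta eq_upto_sym[OF product_eq_upto_theta]], use a in auto)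
qed

end
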